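(* Let $n\geq 1$ and let $\phi_0,\phi_1,\ldots,\phi_{n-1}$ be the Foulkes characters of $S_n$. The number of characters of $S_n$ that depend only on $\ell$ and lie in the fundamental parallelepiped $\left\{\sum_{i=0}^{n-1} t_i\phi_i \mid t_i\in[0,1)\right\}$ equals $$\frac{n!}{\gcd(1,n)\gcd(2,n)\cdots\gcd(n,n)}.$$
   Context: Convention: $\binom{u}{v}=0$ unless $u\geq v\geq 0$. For $\pi\in S_n$, $\ell(\pi)$ is the number of cycles of $\pi$ (fixed points counted). A class function $\theta$ of $S_n$ depends only on $\ell$ if $\theta(\pi)=\theta(\sigma)$ whenever $\ell(\pi)=\ell(\sigma)$. A character of $S_n$ is a non-negative integer linear combination of the irreducible complex characters of $S_n$ (the zero function is included). The Foulkes character $\phi_i$ of $S_n$ ($0\leq i\leq n-1$) is the character afforded by the direct sum of the (skew) Specht modules $V_\beta$ over all border shapes (ribbons: connected skew shapes containing no $2\times 2$ square) $\beta$ with exactly $n$ boxes and $i+1$ rows; equivalently (well known), $\phi_i(\pi)=\sum_{j=0}^{n-1}(-1)^{i-j}\binom{n+1}{i-j}(j+1)^{\ell(\pi)}$. *)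

theory Defs
  imports
    Complex_Main
    "HOL-Library.FuncSet"
    "HOL-Library.Function_Algebras"
    "HOL-Combinatorics.Orbits"
    "HOL-Algebra.Sym_Groups"
    "Jordan_Normal_Form.Matrix"
begin

section \<open>Complex characters of a group\<close>

text \<open>Class functions and characters are extensional functions on the carrier of the group
  (\<^const>\<open>undefined\<close> outside it), so that equality of characters is equality of functions.\<close>

definition mat_representation ::
    "('g, 'r) monoid_scheme \<Rightarrow> nat \<Rightarrow> ('g \<Rightarrow> complex mat) \<Rightarrow> bool" where
  "mat_representation G d \<rho> \<longleftrightarrow>
     (\<forall>g \<in> carrier G. \<rho> g \<in> carrier_mat d d) \<and>
     \<rho> \<one>\<^bsub>G\<^esub> = 1\<^sub>m d \<and>
     (\<forall>g \<in> carrier G. \<forall>h \<in> carrier G. \<rho> (g \<otimes>\<^bsub>G\<^esub> h) = \<rho> g * \<rho> h)"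

definition vec_subspace :: "nat \<Rightarrow> complex vec set \<Rightarrow> bool" where
  "vec_subspace d W \<longleftrightarrow>
     W \<subseteq> carrier_vec d \<and> 0\<^sub>v d \<in> W \<and>
     (\<forall>v \<in> W. \<forall>w \<in> W. v + w \<in> W) \<and>
     (\<forall>c. \<forall>v \<in> W. c \<cdot>\<^sub>v v \<in> W)"

definition irreducible_representation ::
    "('g, 'r) monoid_scheme \<Rightarrow> nat \<Rightarrow> ('g \<Rightarrow> complex mat) \<Rightarrow> bool" where
  "irreducible_representation G d \<rho> \<longleftrightarrow>
     mat_representation G d \<rho> \<and> d > 0 \<and>
     (\<forall>W. vec_subspace d W \<and> (\<forall>g \<in> carrier G. \<forall>w \<in> W. \<rho> g *\<^sub>v w \<in> W)
        \<longrightarrow> W = {0\<^sub>v d} \<or> W = carrier_vec d)"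

definition irreducible_characters :: "('g, 'r) monoid_scheme \<Rightarrow> ('g \<Rightarrow> complex) set" where
  "irreducible_characters G =
     {\<lambda>g \<in> carrier G. \<Sum>k<d. \<rho> g $$ (k, k) | d \<rho>. irreducible_representation G d \<rho>}"

definition characters :: "('g, 'r) monoid_scheme \<Rightarrow> ('g \<Rightarrow> complex) set" where
  "characters G =
     {\<lambda>g \<in> carrier G. \<Sum>\<chi>\<in>X. of_nat (m \<chi>) * \<chi> g | X m.
        finite X \<and> X \<subseteq> irreducible_characters G}"


section \<open>Trace of a linear operator on a subspace of a function space\<close>

interpretation fun_space: vector_space "\<lambda>(c :: complex) (v :: 'a \<Rightarrow> complex) x. c * v x"
  by unfold_locales (auto simp: fun_eq_iff algebra_simps)

text \<open>Intended for finite-dimensional \<open>V\<close> that are invariant under the linear map \<open>f\<close>; the value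
  then does not depend on the chosen basis \<open>B\<close>.\<close>

definition trace_on ::
    "('a \<Rightarrow> complex) set \<Rightarrow> (('a \<Rightarrow> complex) \<Rightarrow> ('a \<Rightarrow> complex)) \<Rightarrow> complex" where
  "trace_on V f =
     (let B = (SOME B. fun_space.independent B \<and> fun_space.span B = V)
      in \<Sum>b\<in>B. fun_space.representation B (f b) b)"


section \<open>Skew Specht modules\<close>

text \<open>A cell \<open>(r, c)\<close> lies in row \<open>r\<close> and column \<open>c\<close>; rows are numbered downwards from \<open>0\<close>.\<close>

type_synonym cell = "nat \<times> nat"
type_synonym tableau = "cell \<Rightarrow> nat"

definition young_diagram :: "cell set \<Rightarrow> bool" where
  "young_diagram Y \<longleftrightarrow>
     finite Y \<and> (\<forall>r c r' c'. (r, c) \<in> Y \<and> r' \<le> r \<and> c' \<le> c \<longrightarrow> (r', c') \<in> Y)"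

definition skew_shape :: "cell set \<Rightarrow> bool" where
  "skew_shape D \<longleftrightarrow>
     (\<exists>L M. young_diagram L \<and> young_diagram M \<and> M \<subseteq> L \<and> D = L - M)"

text \<open>Tableaux are \<open>0\<close> outside their shape. As \<open>0\<close> is not an entry, the shape can be recovered
  from the tableau, and composing with a permutation of \<open>{1..n}\<close> gives a tableau again.\<close>

definition tableaux :: "nat \<Rightarrow> cell set \<Rightarrow> tableau set" where
  "tableaux n D = {t. bij_betw t D {1..n} \<and> (\<forall>x. x \<notin> D \<longrightarrow> t x = 0)}"

definition tabloid :: "nat \<Rightarrow> cell set \<Rightarrow> tableau \<Rightarrow> tableau set" where
  "tabloid n D t =
     {s \<in> tableaux n D. \<forall>r. s ` {x \<in> D. fst x = r} = t ` {x \<in> D. fst x = r}}"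

definition column_stabilizer :: "nat \<Rightarrow> cell set \<Rightarrow> tableau \<Rightarrow> (nat \<Rightarrow> nat) set" where
  "column_stabilizer n D t =
     {\<pi>. \<pi> permutes {1..n} \<and>
         (\<forall>c. \<pi> ` t ` {x \<in> D. snd x = c} = t ` {x \<in> D. snd x = c})}"

text \<open>The permutation module on tabloids consists of functions from tabloids to the complex numbers;
  the indicator function of a tabloid is the corresponding basis vector.\<close>

definition polytabloid :: "nat \<Rightarrow> cell set \<Rightarrow> tableau \<Rightarrow> tableau set \<Rightarrow> complex" where
  "polytabloid n D t =
     (\<lambda>T. \<Sum>\<pi> \<in> column_stabilizer n D t.
        of_int (sign \<pi>) * (if T = tabloid n D (\<pi> \<circ> t) then 1 else 0))"

definition specht_module :: "nat \<Rightarrow> cell set \<Rightarrow> (tableau set \<Rightarrow> complex) set" where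
  "specht_module n D = fun_space.span (polytabloid n D ` tableaux n D)"

text \<open>The linear extension of \<open>\<pi> \<cdot> {t} = {\<pi> \<circ> t}\<close>, that is,
  \<open>(\<pi> \<cdot> v)(T) = v (\<pi>\<inverse> \<cdot> T)\<close>.\<close>

definition perm_action ::
    "(nat \<Rightarrow> nat) \<Rightarrow> (tableau set \<Rightarrow> complex) \<Rightarrow> tableau set \<Rightarrow> complex" where
  "perm_action \<pi> v = (\<lambda>T. v ((\<lambda>s. inv_into UNIV \<pi> \<circ> s) ` T))"

definition specht_character :: "nat \<Rightarrow> cell set \<Rightarrow> (nat \<Rightarrow> nat) \<Rightarrow> complex" where
  "specht_character n D = (\<lambda>\<pi> \<in> carrier (sym_group n). trace_on (specht_module n D) (perm_action \<pi>))"


section \<open>Foulkes characters\<close>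

definition adjacent_cells :: "cell \<Rightarrow> cell \<Rightarrow> bool" where
  "adjacent_cells x y \<longleftrightarrow>
     (fst x = fst y \<and> (snd y = Suc (snd x) \<or> snd x = Suc (snd y))) \<or>
     (snd x = snd y \<and> (fst y = Suc (fst x) \<or> fst x = Suc (fst y)))"

definition connected_shape :: "cell set \<Rightarrow> bool" where
  "connected_shape D \<longleftrightarrow>
     (\<forall>x \<in> D. \<forall>y \<in> D. (x, y) \<in> {(u, v). u \<in> D \<and> v \<in> D \<and> adjacent_cells u v}\<^sup>*)"

definition border_shape :: "cell set \<Rightarrow> bool" where
  "border_shape D \<longleftrightarrow>
     skew_shape D \<and> connected_shape D \<and>
     (\<forall>r c. \<not> {(r, c), (r, Suc c), (Suc r, c), (Suc r, Suc c)} \<subseteq> D)"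

text \<open>Shapes are counted up to translation: the representative chosen meets row \<open>0\<close> and
  column \<open>0\<close>.\<close>

definition border_shapes :: "nat \<Rightarrow> nat \<Rightarrow> cell set set" where
  "border_shapes n k =
     {D. border_shape D \<and> card D = n \<and> card (fst ` D) = k \<and> 0 \<in> fst ` D \<and> 0 \<in> snd ` D}"

text \<open>The character of a direct sum is the sum of the characters of the summands.\<close>

definition foulkes_character :: "nat \<Rightarrow> nat \<Rightarrow> (nat \<Rightarrow> nat) \<Rightarrow> complex" where
  "foulkes_character n i =
     (\<lambda>\<pi> \<in> carrier (sym_group n). \<Sum>D \<in> border_shapes n (i + 1). specht_character n D \<pi>)"


section \<open>Functions of the number of cycles, and the fundamental parallelepiped\<close>

definition num_cycles :: "nat \<Rightarrow> (nat \<Rightarrow> nat) \<Rightarrow> nat" where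
  "num_cycles n \<pi> = card (orbit \<pi> ` {1..n})"

definition depends_only_on_num_cycles :: "nat \<Rightarrow> ((nat \<Rightarrow> nat) \<Rightarrow> complex) \<Rightarrow> bool" where
  "depends_only_on_num_cycles n \<theta> \<longleftrightarrow>
     (\<forall>\<pi> \<in> carrier (sym_group n). \<forall>\<sigma> \<in> carrier (sym_group n).
        num_cycles n \<pi> = num_cycles n \<sigma> \<longrightarrow> \<theta> \<pi> = \<theta> \<sigma>)"

definition foulkes_parallelepiped :: "nat \<Rightarrow> ((nat \<Rightarrow> nat) \<Rightarrow> complex) set" where
  "foulkes_parallelepiped n =
     {\<lambda>\<pi> \<in> carrier (sym_group n). \<Sum>i<n. complex_of_real (t i) * foulkes_character n i \<pi> | t.
        \<forall>i<n. t i \<in> {0..<1}}"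

end

theory Submission
  imports Defs "HOL-Number_Theory.Cong" "HOL-Computational_Algebra.Primes"
begin

text \<open>The proof is about the functions \<open>k ^ \<ell>\<close> for \<open>1 \<le> k \<le> n\<close>, where \<open>\<ell>\<close> is the number of cycles.

  The value of \<open>k ^ \<ell>\<close> at a permutation is the number of words of length \<open>n\<close> over \<open>k\<close> letters that
  it fixes (\<open>card_fixed_words\<close>). Ribbons with \<open>n\<close> boxes correspond to sets \<open>T \<subseteq> {1..<n}\<close> of down
  steps (\<open>border_shapes_eq\<close>), and their Specht modules embed into the space of functions on \<open>S\<^sub>n\<close>
  (\<open>specht_trace_eq_ribbon_trace\<close>). There the modules for all \<open>T \<subseteq> S\<close> are independent and together
  make up the functions that are invariant under the Young subgroup with rows cut at \<open>S\<close>
  (\<open>ribbon_modules_independent\<close>, \<open>row_invariant_spanned\<close>). Such an invariant module is the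
  permutation module on the words whose letters occur with given positive multiplicities
  (\<open>trace_row_invariant_eq_card\<close>). Sorting all words by multiplicities yields
  \<open>k ^ \<ell> = \<Sum>\<^sub>i (k + n - 1 - i choose n) \<phi>\<^sub>i\<close> (\<open>power_num_cycles_eq_sum_foulkes\<close>). The matrix of
  these coefficients is integral and unitriangular. Hence the combinations \<open>\<Sum>\<^sub>i t\<^sub>i \<phi>\<^sub>i\<close> are the
  combinations \<open>\<Sum>\<^sub>k s\<^sub>k k ^ \<ell>\<close>; all of them depend only on \<open>\<ell>\<close>, and \<open>t\<close> is integral exactly if \<open>s\<close>
  is.

  For \<open>t \<ge> 0\<close> the combination is a character exactly if \<open>s\<^sub>k k / gcd k n\<close> is an integer for all
  \<open>k\<close> (\<open>foulkes_combination_in_characters_iff\<close>). The condition is sufficient because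
  \<open>gcd k n / k * k ^ \<ell>\<close> is a permutation character: it belongs to the words over the residues
  modulo \<open>k\<close> whose letter sum lies in a set of \<open>gcd k n\<close> residues
  (\<open>scaled_power_num_cycles_character\<close>). So the combination is an integral combination of
  characters, and its multiplicities are nonnegative because \<open>t\<close> is. The condition is necessary
  because the sign character of a Young subgroup has an integral multiplicity in any character. In
  \<open>k ^ \<ell>\<close> this multiplicity is a product of binomial coefficients \<open>k choose m\<close> over the block
  sizes \<open>m\<close> (\<open>sign_multiplicity_integral\<close>), and suitable block sizes determine the denominator of
  \<open>s\<^sub>k\<close> one prime at a time (\<open>integral_binomial_sums\<close>).

  The admissible \<open>t\<close> form a lattice that contains the integral vectors with index
  \<open>\<Prod>\<^sub>k k / gcd k n\<close>, and the half-open unit cube contains one point of each coset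
  (\<open>card_cube_points\<close>). Different \<open>t\<close> give different functions (\<open>foulkes_combination_inj\<close>), and
  the product is the quotient in the theorem.\<close>

section \<open>Traces of linear operators on function spaces\<close>

text \<open>Up to beta conversion this rule moves parentheses in every pointwise product of three factors
  to the left, against \<open>algebra_simps\<close>.\<close>

declare fun_space.scale_scale [simp del]

definition linear_map :: "(('a \<Rightarrow> complex) \<Rightarrow> ('b \<Rightarrow> complex)) \<Rightarrow> bool" where
  "linear_map f \<longleftrightarrow> (\<forall>v w. f (v + w) = f v + f w) \<and> (\<forall>c v. f (\<lambda>x. c * v x) = (\<lambda>x. c * f v x))"

lemma linear_map_add: "linear_map f \<Longrightarrow> f (v + w) = f v + f w"
  and linear_map_scale: "linear_map f \<Longrightarrow> f (\<lambda>x. c * v x) = (\<lambda>x. c * f v x)"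
  by (auto simp: linear_map_def)

lemma linear_map_0: "linear_map f \<Longrightarrow> f 0 = 0"
  using linear_map_scale[of f 0 0] by (simp add: zero_fun_def)

lemma linear_map_diff: "linear_map f \<Longrightarrow> f (v - w) = f v - f w"
  by (metis add_diff_cancel diff_add_cancel linear_map_add)

lemma linear_map_sum: "linear_map f \<Longrightarrow> f (\<Sum>i\<in>I. v i) = (\<Sum>i\<in>I. f (v i))"
  by (induction I rule: infinite_finite_induct) (auto simp: linear_map_add linear_map_0)

lemma linear_map_linear:
  "linear_map f \<Longrightarrow> Vector_Spaces.linear (\<lambda>c v x. c * v x) (\<lambda>c v x. c * v x) f"
  unfolding Vector_Spaces.linear_iff by (intro conjI fun_space.vector_space_axioms) (auto simp: linear_map_def)

lemma linear_map_image_span: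
  assumes "linear_map f"
  shows "f ` fun_space.span B = fun_space.span (f ` B)"
proof -
  interpret h: module_hom "\<lambda>c (v :: 'a \<Rightarrow> complex) x. c * v x" "\<lambda>c (v :: 'b \<Rightarrow> complex) x. c * v x" f
    using linear_map_linear[OF assms] by (simp add: linear_iff_module_hom)
  show ?thesis by (rule h.span_image[symmetric])
qed

definition finite_dim :: "('a \<Rightarrow> complex) set \<Rightarrow> bool" where
  "finite_dim V \<longleftrightarrow> (\<exists>B. finite B \<and> fun_space.independent B \<and> fun_space.span B = V)"

lemma finite_dimE:
  assumes "finite_dim V"
  obtains B where "finite B" "fun_space.independent B" "fun_space.span B = V"
  using assms by (auto simp: finite_dim_def)

lemma finite_dim_subspace: "finite_dim V \<Longrightarrow> fun_space.subspace V"
  by (auto simp: finite_dim_def)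

lemma finite_dim_subset:
  assumes "finite B" "V \<subseteq> fun_space.span B" "fun_space.subspace V"
  shows "finite_dim V"
proof -
  obtain C where C: "C \<subseteq> V" "fun_space.independent C" "V \<subseteq> fun_space.span C"
    using fun_space.maximal_independent_subset by blast
  have "finite C"
    using fun_space.independent_span_bound[OF assms(1) C(2)] C(1) assms(2) by blast
  moreover have "fun_space.span C = V"
    using C(1,3) assms(3) by (intro fun_space.span_subspace) auto
  ultimately show ?thesis using C(2) by (auto simp: finite_dim_def)
qed

lemma finite_dim_span: "finite B \<Longrightarrow> finite_dim (fun_space.span B)"
  by (rule finite_dim_subset[of B]) auto

lemma finite_dim_mono: "finite_dim W \<Longrightarrow> V \<subseteq> W \<Longrightarrow> fun_space.subspace V \<Longrightarrow> finite_dim V"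
  by (metis finite_dimE finite_dim_subset)

lemma linear_map_expand:
  assumes f: "linear_map f" and B: "finite B" "fun_space.independent B" and v: "v \<in> fun_space.span B"
  shows "f v = (\<Sum>b\<in>B. (\<lambda>x. fun_space.representation B v b * f b x))"
proof -
  have "v = (\<Sum>b\<in>B. (\<lambda>x. fun_space.representation B v b * b x))"
    using fun_space.sum_representation_eq[OF B(2) v B(1)] by simp
  then have "f v = f (\<Sum>b\<in>B. (\<lambda>x. fun_space.representation B v b * b x))" by simp
  also have "\<dots> = (\<Sum>b\<in>B. (\<lambda>x. fun_space.representation B v b * f b x))"
    by (simp add: linear_map_sum[OF f] linear_map_scale[OF f])
  finally show ?thesis .
qed

lemma representation_linear_combination:
  assumes "fun_space.independent B" "\<And>i. i \<in> I \<Longrightarrow> v i \<in> fun_space.span B"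
  shows "fun_space.representation B (\<Sum>i\<in>I. (\<lambda>x. c i * v i x)) b
         = (\<Sum>i\<in>I. c i * fun_space.representation B (v i) b)"
proof -
  have "fun_space.representation B (\<Sum>i\<in>I. (\<lambda>x. c i * v i x))
        = (\<lambda>b. \<Sum>i\<in>I. fun_space.representation B (\<lambda>x. c i * v i x) b)"
    using assms fun_space.span_scale by (intro fun_space.representation_sum) blast+
  also have "\<dots> = (\<lambda>b. \<Sum>i\<in>I. c i * fun_space.representation B (v i) b)"
    using fun_space.representation_scale[OF assms(1) assms(2)] by (intro ext sum.cong) (auto simp: fun_eq_iff)
  finally show ?thesis by simp
qed

text \<open>Both sides are the double sum of the products of the two change-of-basis coefficients, with
  \<open>f\<close> inserted at one of them.\<close>

lemma trace_basis_independent: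
  assumes B: "finite B" "fun_space.independent B" and C: "finite C" "fun_space.independent C"
    and eq: "fun_space.span B = fun_space.span C"
    and f: "linear_map f" and inv: "\<And>v. v \<in> fun_space.span C \<Longrightarrow> f v \<in> fun_space.span C"
  shows "(\<Sum>b\<in>B. fun_space.representation B (f b) b) = (\<Sum>c\<in>C. fun_space.representation C (f c) c)"
proof -
  let ?B = "fun_space.representation B" and ?C = "fun_space.representation C"
  have b: "b \<in> fun_space.span C" if "b \<in> B" for b
    using that eq fun_space.span_base by blast
  have c: "c \<in> fun_space.span B" if "c \<in> C" for c
    using that eq fun_space.span_base by blast
  have 1: "?B (f b) b = (\<Sum>c\<in>C. ?C (f b) c * ?B c b)" if "b \<in> B" for b
  proof -
    have "f b = (\<Sum>c\<in>C. (\<lambda>x. ?C (f b) c * c x))"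
      using fun_space.sum_representation_eq[OF C(2) inv[OF b[OF that]] C(1)] by simp
    then have "?B (f b) b = ?B (\<Sum>c\<in>C. (\<lambda>x. ?C (f b) c * c x)) b" by simp
    also have "\<dots> = (\<Sum>c\<in>C. ?C (f b) c * ?B c b)"
      using c by (intro representation_linear_combination B(2))
    finally show ?thesis .
  qed
  have 2: "?C (f c) c = (\<Sum>b\<in>B. ?B c b * ?C (f b) c)" if "c \<in> C" for c
  proof -
    have "f c = (\<Sum>b\<in>B. (\<lambda>x. ?B c b * f b x))"
      by (rule linear_map_expand[OF f B c[OF that]])
    then have "?C (f c) c = ?C (\<Sum>b\<in>B. (\<lambda>x. ?B c b * f b x)) c" by simp
    also have "\<dots> = (\<Sum>b\<in>B. ?B c b * ?C (f b) c)"
      using b inv by (intro representation_linear_combination C(2)) auto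
    finally show ?thesis .
  qed
  have "(\<Sum>b\<in>B. ?B (f b) b) = (\<Sum>b\<in>B. \<Sum>c\<in>C. ?C (f b) c * ?B c b)"
    using 1 by (rule sum.cong[OF refl])
  also have "\<dots> = (\<Sum>c\<in>C. \<Sum>b\<in>B. ?C (f b) c * ?B c b)" by (rule sum.swap)
  also have "\<dots> = (\<Sum>c\<in>C. ?C (f c) c)" using 2 by (intro sum.cong) (auto simp: mult.commute)
  finally show ?thesis .
qed

text \<open>The bases of \<open>V\<close> among which the definition chooses are all finite, so the choice is
  immaterial and any basis computes the trace.\<close>

lemma trace_on_eq:
  assumes B: "finite B" "fun_space.independent B" "fun_space.span B = V"
    and f: "linear_map f" "\<And>v. v \<in> V \<Longrightarrow> f v \<in> V"
  shows "trace_on V f = (\<Sum>b\<in>B. fun_space.representation B (f b) b)"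
proof -
  define C where "C = (SOME C. fun_space.independent C \<and> fun_space.span C = V)"
  have C: "fun_space.independent C \<and> fun_space.span C = V"
    unfolding C_def by (rule someI[of _ B]) (use B in auto)
  have "finite C"
    using fun_space.independent_span_bound[OF B(1), of C] C B(3) fun_space.span_superset by blast
  then show ?thesis
    unfolding trace_on_def C_def[symmetric] Let_def
    using C B f by (intro trace_basis_independent) auto
qed

text \<open>The union of bases of the summands is a basis of the sum, and coordinates of a vector of one
  summand in the larger basis are its coordinates in the smaller one.\<close>

lemma trace_on_direct_sum:
  assumes fd: "finite_dim V" "finite_dim W" and int: "V \<inter> W = {0}"
    and f: "linear_map f" "\<And>v. v \<in> V \<Longrightarrow> f v \<in> V" "\<And>w. w \<in> W \<Longrightarrow> f w \<in> W"
  shows "trace_on {v + w | v w. v \<in> V \<and> w \<in> W} f = trace_on V f + trace_on W f"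
    and "finite_dim {v + w | v w. v \<in> V \<and> w \<in> W}"
proof -
  obtain B where B: "finite B" "fun_space.independent B" "fun_space.span B = V"
    using finite_dimE[OF fd(1)] by blast
  obtain C where C: "finite C" "fun_space.independent C" "fun_space.span C = W"
    using finite_dimE[OF fd(2)] by blast
  have sum: "fun_space.span (B \<union> C) = {v + w | v w. v \<in> V \<and> w \<in> W}"
    by (simp add: fun_space.span_Un B C)
  have disj: "B \<inter> C = {}"
  proof -
    have "B \<inter> C \<subseteq> V \<inter> W" using B C fun_space.span_base by blast
    then have "B \<inter> C \<subseteq> {0}" using int by simp
    moreover have "0 \<notin> B" using B(2) fun_space.dependent_zero by blast
    ultimately show ?thesis by auto
  qed
  have ind: "fun_space.independent (B \<union> C)"
  proof (rule fun_space.independent_if_scalars_zero)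
    fix k x assume eq: "(\<Sum>x\<in>B \<union> C. (\<lambda>y. k x * x y)) = 0" and x: "x \<in> B \<union> C"
    have "(\<Sum>x\<in>B. (\<lambda>y. k x * x y)) + (\<Sum>x\<in>C. (\<lambda>y. k x * x y)) = 0"
      using eq disj B(1) C(1) by (simp add: sum.union_disjoint)
    then have eq: "(\<Sum>x\<in>B. (\<lambda>y. k x * x y)) = - (\<Sum>x\<in>C. (\<lambda>y. k x * x y))"
      by (simp add: eq_neg_iff_add_eq_0)
    have V: "(\<Sum>x\<in>B. (\<lambda>y. k x * x y)) \<in> V"
      unfolding B(3)[symmetric] by (intro fun_space.span_sum fun_space.span_scale fun_space.span_base)
    have W: "(\<Sum>x\<in>C. (\<lambda>y. k x * x y)) \<in> W"
      unfolding C(3)[symmetric] by (intro fun_space.span_sum fun_space.span_scale fun_space.span_base)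
    have "(\<Sum>x\<in>B. (\<lambda>y. k x * x y)) \<in> W"
      unfolding eq using W fd(2) finite_dim_subspace fun_space.subspace_neg by blast
    then have 0: "(\<Sum>x\<in>B. (\<lambda>y. k x * x y)) = 0" using V int by blast
    then have 1: "(\<Sum>x\<in>C. (\<lambda>y. k x * x y)) = 0" using eq by simp
    show "k x = 0"
    proof (cases "x \<in> B")
      case True
      then show ?thesis using B(1,2) 0 unfolding fun_space.dependent_finite[OF B(1)] by blast
    next
      case False
      then show ?thesis using x C(1,2) 1 unfolding fun_space.dependent_finite[OF C(1)] by blast
    qed
  qed (use B C in auto)
  show "finite_dim {v + w | v w. v \<in> V \<and> w \<in> W}"
    unfolding sum[symmetric] using B C ind by (auto simp: finite_dim_def)
  have inv: "f u \<in> {v + w | v w. v \<in> V \<and> w \<in> W}" if "u \<in> {v + w | v w. v \<in> V \<and> w \<in> W}" for u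
    using that f linear_map_add[OF f(1)] by blast
  have 1: "fun_space.representation (B \<union> C) (f b) b = fun_space.representation B (f b) b" if "b \<in> B" for b
    using that B f fun_space.span_base by (subst fun_space.representation_extend[OF ind, of _ B]) auto
  have 2: "fun_space.representation (B \<union> C) (f b) b = fun_space.representation C (f b) b" if "b \<in> C" for b
    using that C f fun_space.span_base by (subst fun_space.representation_extend[OF ind, of _ C]) auto
  have "trace_on {v + w | v w. v \<in> V \<and> w \<in> W} f
        = (\<Sum>b\<in>B \<union> C. fun_space.representation (B \<union> C) (f b) b)"
    using B C ind sum f(1) inv by (intro trace_on_eq) auto
  also have "\<dots> = (\<Sum>b\<in>B. fun_space.representation B (f b) b) + (\<Sum>b\<in>C. fun_space.representation C (f b) b)"
    using B C disj by (simp add: sum.union_disjoint 1 2)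
  also have "\<dots> = trace_on V f + trace_on W f"
    using B C f by (simp add: trace_on_eq)
  finally show "trace_on {v + w | v w. v \<in> V \<and> w \<in> W} f = trace_on V f + trace_on W f" .
qed

lemma independent_image:
  assumes "linear_map \<Psi>" "inj_on \<Psi> (fun_space.span B)" "finite B" "fun_space.independent B"
  shows "fun_space.independent (\<Psi> ` B)"
proof -
  interpret h: module_hom "\<lambda>c (v :: 'a \<Rightarrow> complex) x. c * v x" "\<lambda>c (v :: 'b \<Rightarrow> complex) x. c * v x" \<Psi>
    using linear_map_linear[OF assms(1)] by (simp add: linear_iff_module_hom)
  show ?thesis using h.independent_injective_image assms by blast
qed

text \<open>An injective linear map carries a basis to a basis of the image without changing
  coordinates.\<close>

lemma trace_on_transfer:
  assumes fd: "finite_dim V" and \<Psi>: "linear_map \<Psi>" "inj_on \<Psi> V"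
    and f: "linear_map f" "\<And>v. v \<in> V \<Longrightarrow> f v \<in> V" and g: "linear_map g"
    and comm: "\<And>v. v \<in> V \<Longrightarrow> \<Psi> (f v) = g (\<Psi> v)"
  shows "trace_on V f = trace_on (\<Psi> ` V) g" and "finite_dim (\<Psi> ` V)"
proof -
  obtain B where B: "finite B" "fun_space.independent B" "fun_space.span B = V"
    using finite_dimE[OF fd] by blast
  have sp: "fun_space.span (\<Psi> ` B) = \<Psi> ` V"
    using linear_map_image_span[OF \<Psi>(1), of B] B by simp
  have ind: "fun_space.independent (\<Psi> ` B)"
    by (rule independent_image) (use \<Psi> B in auto)
  show "finite_dim (\<Psi> ` V)" using B ind sp by (auto simp: finite_dim_def)
  have injB: "inj_on \<Psi> B" using \<Psi>(2) B fun_space.span_superset by (metis inj_on_subset)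
  have BV: "b \<in> V" if "b \<in> B" for b using that B fun_space.span_base by blast
  have rep: "fun_space.representation (\<Psi> ` B) (\<Psi> v) (\<Psi> b) = fun_space.representation B v b"
    if "v \<in> V" "b \<in> B" for v b
  proof -
    have "\<Psi> v = (\<Sum>b\<in>B. (\<lambda>x. fun_space.representation B v b * \<Psi> b x))"
      using that B by (intro linear_map_expand \<Psi>) auto
    then have "fun_space.representation (\<Psi> ` B) (\<Psi> v) (\<Psi> b)
       = (\<Sum>b'\<in>B. fun_space.representation B v b' * fun_space.representation (\<Psi> ` B) (\<Psi> b') (\<Psi> b))"
      using representation_linear_combination[OF ind, of B \<Psi> "fun_space.representation B v" "\<Psi> b"]
      by (simp add: fun_space.span_base)
    also have "\<dots> = (\<Sum>b'\<in>B. fun_space.representation B v b' * (if b' = b then 1 else 0))"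
      using that injB fun_space.representation_basis[OF ind]
      by (intro sum.cong) (auto simp: inj_on_def)
    also have "\<dots> = fun_space.representation B v b" using that B(1) by (simp add: sum.delta' if_distrib cong: if_cong)
    finally show ?thesis .
  qed
  have "trace_on (\<Psi> ` V) g = (\<Sum>b\<in>\<Psi> ` B. fun_space.representation (\<Psi> ` B) (g b) b)"
    using B ind sp g comm f by (intro trace_on_eq) (auto simp flip: comm)
  also have "\<dots> = (\<Sum>b\<in>B. fun_space.representation (\<Psi> ` B) (\<Psi> (f b)) (\<Psi> b))"
    using injB BV by (simp add: sum.reindex comm)
  also have "\<dots> = (\<Sum>b\<in>B. fun_space.representation B (f b) b)"
    using rep BV f by (intro sum.cong) auto
  also have "\<dots> = trace_on V f" using B f by (simp add: trace_on_eq)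
  finally show "trace_on V f = trace_on (\<Psi> ` V) g" by simp
qed

lemma trace_on_id:
  assumes "finite_dim V" "linear_map f" "\<And>v. v \<in> V \<Longrightarrow> f v = v"
  shows "trace_on V f \<in> \<nat>" and "V \<noteq> {0} \<Longrightarrow> trace_on V f \<noteq> 0"
proof -
  obtain B where B: "finite B" "fun_space.independent B" "fun_space.span B = V"
    using finite_dimE[OF assms(1)] by blast
  have "trace_on V f = (\<Sum>b\<in>B. fun_space.representation B (f b) b)"
    using B assms by (intro trace_on_eq) auto
  also have "\<dots> = (\<Sum>b\<in>B. 1)"
    using B assms(3) by (intro sum.cong refl) (auto simp: fun_space.representation_basis fun_space.span_base)
  finally have *: "trace_on V f = of_nat (card B)" by simp
  show "trace_on V f \<in> \<nat>" using * by simp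
  show "trace_on V f \<noteq> 0" if "V \<noteq> {0}"
    using that * B by auto
qed

text \<open>An idempotent splits the space into its image, where it is the identity, and its kernel.\<close>

lemma idempotent_splitting:
  assumes V: "fun_space.subspace V" and f: "linear_map f" "\<And>v. v \<in> V \<Longrightarrow> f v \<in> V"
    and idem: "\<And>v. v \<in> V \<Longrightarrow> f (f v) = f v"
  shows "V = {v + w | v w. v \<in> f ` V \<and> w \<in> {v \<in> V. f v = 0}}"
    and "f ` V \<inter> {v \<in> V. f v = 0} = {0}"
    and "fun_space.subspace (f ` V)" and "fun_space.subspace {v \<in> V. f v = 0}"
proof -
  define K where "K = {v \<in> V. f v = 0}"
  show sI: "fun_space.subspace (f ` V)"
    using linear_map_image_span[OF f(1), of V] V
    by (metis fun_space.span_eq_iff fun_space.subspace_span)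
  have sK: "fun_space.subspace K"
    using V f(1) unfolding fun_space.subspace_def K_def
    by (auto simp: linear_map_add linear_map_scale linear_map_0)
  then show "fun_space.subspace {v \<in> V. f v = 0}" by (simp add: K_def)
  have "V = {v + w | v w. v \<in> f ` V \<and> w \<in> K}"
  proof (intro equalityI subsetI)
    fix v assume v: "v \<in> V"
    have "v - f v \<in> K"
      using v f V idem unfolding K_def by (auto simp: linear_map_diff fun_space.subspace_diff)
    then show "v \<in> {v + w | v w. v \<in> f ` V \<and> w \<in> K}"
      using v by (intro CollectI exI[of _ "f v"] exI[of _ "v - f v"]) auto
  next
    fix v assume "v \<in> {v + w | v w. v \<in> f ` V \<and> w \<in> K}"
    then obtain u w where "v = f u + w" "u \<in> V" "w \<in> V" by (auto simp: K_def)
    then show "v \<in> V" using f(2) V by (simp add: fun_space.subspace_add)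
  qed
  then show "V = {v + w | v w. v \<in> f ` V \<and> w \<in> {v \<in> V. f v = 0}}" by (simp add: K_def)
  have "f ` V \<inter> K = {0}"
    using idem fun_space.subspace_0[OF sI] fun_space.subspace_0[OF sK] by (auto simp: K_def)
  then show "f ` V \<inter> {v \<in> V. f v = 0} = {0}" by (simp add: K_def)
qed

text \<open>The trace is the dimension of the image.\<close>

lemma trace_on_idempotent:
  assumes fd: "finite_dim V" and f: "linear_map f" "\<And>v. v \<in> V \<Longrightarrow> f v \<in> V"
    and idem: "\<And>v. v \<in> V \<Longrightarrow> f (f v) = f v"
  shows "trace_on V f \<in> \<nat>" and "\<exists>v\<in>V. f v \<noteq> 0 \<Longrightarrow> trace_on V f \<noteq> 0"
proof -
  define K where "K = {v \<in> V. f v = 0}"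
  note split = idempotent_splitting[OF finite_dim_subspace[OF fd] f idem, folded K_def]
  have fdI: "finite_dim (f ` V)" by (rule finite_dim_mono[OF fd _ split(3)]) (use f(2) in auto)
  have fdK: "finite_dim K" by (rule finite_dim_mono[OF fd _ split(4)]) (auto simp: K_def)
  have "trace_on V f = trace_on (f ` V) f + trace_on K f"
    by (subst split(1), simp, rule trace_on_direct_sum)
       (use fdI fdK split(2) f K_def fun_space.subspace_0[OF split(4)] in \<open>auto simp: linear_map_0\<close>)
  moreover have "trace_on K f = 0"
  proof -
    obtain B where B: "finite B" "fun_space.independent B" "fun_space.span B = K"
      using finite_dimE[OF fdK] by blast
    have "trace_on K f = (\<Sum>b\<in>B. fun_space.representation B (f b) b)"
      using B f fun_space.subspace_0[OF split(4)] by (intro trace_on_eq) (auto simp: K_def)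
    also have "\<dots> = 0"
    proof (rule sum.neutral, rule ballI)
      fix b assume "b \<in> B"
      then have "f b = 0" using B(3) fun_space.span_base K_def by blast
      then show "fun_space.representation B (f b) b = 0" by (simp add: fun_space.representation_zero)
    qed
    finally show ?thesis .
  qed
  ultimately have tr: "trace_on V f = trace_on (f ` V) f" by simp
  show "trace_on V f \<in> \<nat>"
    unfolding tr using fdI f(1) idem by (intro trace_on_id) auto
  show "trace_on V f \<noteq> 0" if "\<exists>v\<in>V. f v \<noteq> 0"
    unfolding tr using fdI f(1) idem that by (intro trace_on_id(2)) auto
qed

definition supported_on :: "'a set \<Rightarrow> ('a \<Rightarrow> complex) set" where
  "supported_on I = {v. \<forall>x. x \<notin> I \<longrightarrow> v x = 0}"

definition point_mass :: "'a \<Rightarrow> 'a \<Rightarrow> complex" where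
  "point_mass i = (\<lambda>x. if x = i then 1 else 0)"

lemma inj_point_mass: "inj point_mass"
  by (rule injI) (metis point_mass_def zero_neq_one)

lemma supported_on_expand:
  assumes "finite I" "v \<in> supported_on I"
  shows "v = (\<Sum>i\<in>I. (\<lambda>x. v i * point_mass i x))"
proof
  fix x
  have "(\<Sum>i\<in>I. (\<lambda>x. v i * point_mass i x)) x = (\<Sum>i\<in>I. v i * point_mass i x)"
    by (induction I rule: infinite_finite_induct) auto
  also have "\<dots> = v x"
    using assms by (auto simp: point_mass_def supported_on_def if_distrib cong: if_cong)
  finally show "v x = (\<Sum>i\<in>I. (\<lambda>x. v i * point_mass i x)) x" by simp
qed

lemma point_mass_basis:
  assumes "finite I"
  shows "fun_space.independent (point_mass ` I)"
    and "fun_space.span (point_mass ` I) = supported_on I"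
proof -
  have ev: "(\<Sum>b\<in>A. (\<lambda>x. k b * b x)) y = (\<Sum>b\<in>A. k b * b y)" for A and k :: "('a \<Rightarrow> complex) \<Rightarrow> complex" and y
    by (induction A rule: infinite_finite_induct) auto
  show "fun_space.independent (point_mass ` I)"
  proof (rule fun_space.independent_if_scalars_zero)
    fix k x assume eq: "(\<Sum>x\<in>point_mass ` I. (\<lambda>y. k x * x y)) = 0" and x: "x \<in> point_mass ` I"
    obtain i where i: "i \<in> I" "x = point_mass i" using x by blast
    have "0 = (\<Sum>x\<in>point_mass ` I. k x * x i)" using fun_cong[OF eq, of i] ev[of k _ i] by simp
    also have "\<dots> = (\<Sum>j\<in>I. k (point_mass j) * point_mass j i)"
      by (subst sum.reindex) (auto intro: inj_on_subset[OF inj_point_mass])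
    also have "\<dots> = k (point_mass i)"
      using i assms by (auto simp: point_mass_def if_distrib cong: if_cong)
    finally show "k x = 0" using i by simp
  qed (use assms in auto)
  show "fun_space.span (point_mass ` I) = supported_on I"
  proof (rule fun_space.span_subspace)
    show "point_mass ` I \<subseteq> supported_on I" by (auto simp: point_mass_def supported_on_def)
    show "supported_on I \<subseteq> fun_space.span (point_mass ` I)"
    proof
      fix v assume "v \<in> supported_on I"
      then have "v = (\<Sum>i\<in>I. (\<lambda>x. v i * point_mass i x))" by (rule supported_on_expand[OF assms])
      also have "\<dots> \<in> fun_space.span (point_mass ` I)"
        by (intro fun_space.span_sum fun_space.span_scale fun_space.span_base) auto
      finally show "v \<in> fun_space.span (point_mass ` I)" .
    qed
    show "fun_space.subspace (supported_on I)"
      by (auto simp: fun_space.subspace_def supported_on_def)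
  qed
qed

lemma finite_dim_supported_on: "finite I \<Longrightarrow> finite_dim (supported_on I)"
  using point_mass_basis[of I] by (auto simp: finite_dim_def)

lemma trace_on_supported_on:
  assumes I: "finite I" and f: "linear_map f" "\<And>v. v \<in> supported_on I \<Longrightarrow> f v \<in> supported_on I"
  shows "trace_on (supported_on I) f = (\<Sum>i\<in>I. f (point_mass i) i)"
proof -
  note B = point_mass_basis[OF I]
  have rep: "fun_space.representation (point_mass ` I) v (point_mass i) = v i"
    if "v \<in> supported_on I" "i \<in> I" for v i
  proof -
    have "fun_space.representation (point_mass ` I) v (point_mass i)
        = fun_space.representation (point_mass ` I) (\<Sum>i\<in>I. (\<lambda>x. v i * point_mass i x)) (point_mass i)"
      using supported_on_expand[OF I that(1)] by simp
    also have "\<dots> = (\<Sum>j\<in>I. v j * fun_space.representation (point_mass ` I) (point_mass j) (point_mass i))"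
      by (rule representation_linear_combination[OF B(1)]) (simp add: fun_space.span_base)
    also have "\<dots> = (\<Sum>j\<in>I. v j * (if j = i then 1 else 0))"
      by (intro sum.cong) (simp_all add: fun_space.representation_basis[OF B(1)] inj_eq[OF inj_point_mass] eq_commute)
    also have "\<dots> = v i" using that I by (auto simp: if_distrib cong: if_cong)
    finally show ?thesis .
  qed
  have "trace_on (supported_on I) f
      = (\<Sum>b\<in>point_mass ` I. fun_space.representation (point_mass ` I) (f b) b)"
    using I B f by (intro trace_on_eq) auto
  also have "\<dots> = (\<Sum>i\<in>I. fun_space.representation (point_mass ` I) (f (point_mass i)) (point_mass i))"
    by (subst sum.reindex) (auto intro: inj_on_subset[OF inj_point_mass])
  also have "\<dots> = (\<Sum>i\<in>I. f (point_mass i) i)"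
    by (intro sum.cong refl rep f(2)) (auto simp: point_mass_def supported_on_def)
  finally show ?thesis .
qed

text \<open>An idempotent matrix is an idempotent operator on the functions supported on its index set,
  so its trace counts a dimension. Averaging operators over a group appear below as such matrices.\<close>

lemma trace_idempotent_kernel:
  fixes a :: "'a \<Rightarrow> 'a \<Rightarrow> complex"
  assumes I: "finite I" and idem: "\<And>i j. i \<in> I \<Longrightarrow> j \<in> I \<Longrightarrow> (\<Sum>k\<in>I. a i k * a k j) = a i j"
  shows "(\<Sum>i\<in>I. a i i) \<in> \<nat>" and "i \<in> I \<Longrightarrow> j \<in> I \<Longrightarrow> a i j \<noteq> 0 \<Longrightarrow> (\<Sum>i\<in>I. a i i) \<noteq> 0"
proof -
  define f where "f v = (\<lambda>i. if i \<in> I then \<Sum>j\<in>I. a i j * v j else 0)" for v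
  have f: "linear_map f"
    by (auto simp: linear_map_def f_def fun_eq_iff distrib_left sum.distrib sum_distrib_left mult.left_commute)
  have inv: "f v \<in> supported_on I" for v by (auto simp: f_def supported_on_def)
  have ff: "f (f v) = f v" for v
  proof
    fix i
    show "f (f v) i = f v i"
    proof (cases "i \<in> I")
      case True
      then have "f (f v) i = (\<Sum>k\<in>I. \<Sum>j\<in>I. a i k * a k j * v j)"
        by (simp add: f_def sum_distrib_left mult.assoc)
      also have "\<dots> = (\<Sum>j\<in>I. (\<Sum>k\<in>I. a i k * a k j) * v j)"
        by (subst sum.swap) (simp add: sum_distrib_right)
      also have "\<dots> = f v i" using True idem by (simp add: f_def)
      finally show ?thesis .
    qed (simp add: f_def)
  qed
  have e: "f (point_mass j) i = a i j" if "i \<in> I" "j \<in> I" for i j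
    using that I by (auto simp: f_def point_mass_def if_distrib cong: if_cong)
  have tr: "trace_on (supported_on I) f = (\<Sum>i\<in>I. a i i)"
    using trace_on_supported_on[OF I f inv] e by simp
  note id = trace_on_idempotent[OF finite_dim_supported_on[OF I] f inv ff, unfolded tr]
  show "(\<Sum>i\<in>I. a i i) \<in> \<nat>" by (rule id(1))
  show "(\<Sum>i\<in>I. a i i) \<noteq> 0" if "i \<in> I" "j \<in> I" "a i j \<noteq> 0" for i j
  proof (rule id(2))
    have "point_mass j \<in> supported_on I" using that by (auto simp: point_mass_def supported_on_def)
    moreover have "f (point_mass j) \<noteq> 0" using e[OF that(1,2)] that(3) by (metis zero_fun_apply)
    ultimately show "\<exists>v\<in>supported_on I. f v \<noteq> 0" by blast
  qed
qed

section \<open>Representations of finite groups\<close>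

text \<open>Representations on spaces of functions are what the modules below are; they are turned into
  matrix representations only to reach irreducible characters.\<close>

definition fun_rep ::
    "('g, 'r) monoid_scheme \<Rightarrow> ('a \<Rightarrow> complex) set \<Rightarrow> ('g \<Rightarrow> ('a \<Rightarrow> complex) \<Rightarrow> 'a \<Rightarrow> complex) \<Rightarrow> bool" where
  "fun_rep G V act \<longleftrightarrow>
     finite_dim V \<and>
     (\<forall>g\<in>carrier G. linear_map (act g) \<and> (\<forall>v\<in>V. act g v \<in> V)) \<and>
     (\<forall>v\<in>V. act \<one>\<^bsub>G\<^esub> v = v) \<and>
     (\<forall>g\<in>carrier G. \<forall>h\<in>carrier G. \<forall>v\<in>V. act (g \<otimes>\<^bsub>G\<^esub> h) v = act g (act h v))"

lemma fun_repD:
  assumes "fun_rep G V act"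
  shows "finite_dim V"
    and "g \<in> carrier G \<Longrightarrow> linear_map (act g)"
    and "g \<in> carrier G \<Longrightarrow> v \<in> V \<Longrightarrow> act g v \<in> V"
    and "v \<in> V \<Longrightarrow> act \<one>\<^bsub>G\<^esub> v = v"
    and "g \<in> carrier G \<Longrightarrow> h \<in> carrier G \<Longrightarrow> v \<in> V \<Longrightarrow> act (g \<otimes>\<^bsub>G\<^esub> h) v = act g (act h v)"
  using assms unfolding fun_rep_def by blast+

lemma fun_rep_subspace:
  assumes "fun_rep G V act" "fun_space.subspace W" "W \<subseteq> V"
    and "\<And>g w. g \<in> carrier G \<Longrightarrow> w \<in> W \<Longrightarrow> act g w \<in> W"
  shows "fun_rep G W act"
  using assms finite_dim_mono[of V W] unfolding fun_rep_def by blast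

definition basis_matrix ::
    "(nat \<Rightarrow> 'a \<Rightarrow> complex) \<Rightarrow> nat \<Rightarrow> (('a \<Rightarrow> complex) \<Rightarrow> 'a \<Rightarrow> complex) \<Rightarrow> complex mat" where
  "basis_matrix e d f = mat d d (\<lambda>(i, j). fun_space.representation (e ` {..<d}) (f (e j)) (e i))"

lemma fun_rep_mat_representation:
  assumes rep: "fun_rep G V act"
    and e: "inj_on e {..<d}" "fun_space.independent (e ` {..<d})" "fun_space.span (e ` {..<d}) = V"
    and G: "group G"
  shows "mat_representation G d (\<lambda>g. basis_matrix e d (act g))"
    and "g \<in> carrier G \<Longrightarrow> (\<Sum>k<d. basis_matrix e d (act g) $$ (k, k)) = trace_on V (act g)"
proof -
  let ?B = "e ` {..<d}"
  let ?r = "fun_space.representation ?B"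
  interpret group G by (rule G)
  note [simp] = fun_repD[OF rep]
  have eV: "e i \<in> V" if "i < d" for i
    unfolding e(3)[symmetric] using that by (intro fun_space.span_base) auto
  have expand: "f v = (\<Sum>k<d. (\<lambda>x. ?r v (e k) * f (e k) x))" if "linear_map f" "v \<in> V" for f v
  proof -
    have "f v = (\<Sum>b\<in>?B. (\<lambda>x. ?r v b * f b x))" by (rule linear_map_expand) (use that e in auto)
    then show ?thesis using e(1) by (simp add: sum.reindex)
  qed
  have mult: "?r (act (g \<otimes>\<^bsub>G\<^esub> h) (e j)) (e i) = (\<Sum>k<d. ?r (act g (e k)) (e i) * ?r (act h (e j)) (e k))"
    if "g \<in> carrier G" "h \<in> carrier G" "i < d" "j < d" for g h i j
  proof -
    have "act (g \<otimes>\<^bsub>G\<^esub> h) (e j) = act g (act h (e j))" using that eV by simp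
    also have "\<dots> = (\<Sum>k<d. (\<lambda>x. ?r (act h (e j)) (e k) * act g (e k) x))"
      using that eV by (intro expand) auto
    finally have "?r (act (g \<otimes>\<^bsub>G\<^esub> h) (e j)) (e i)
       = ?r (\<Sum>k<d. (\<lambda>x. ?r (act h (e j)) (e k) * act g (e k) x)) (e i)" by simp
    also have "\<dots> = (\<Sum>k<d. ?r (act h (e j)) (e k) * ?r (act g (e k)) (e i))"
      using that eV e(3) by (intro representation_linear_combination e(2)) auto
    finally show ?thesis by (simp add: mult.commute)
  qed
  show "mat_representation G d (\<lambda>g. basis_matrix e d (act g))"
    unfolding mat_representation_def
  proof (intro conjI ballI)
    show "basis_matrix e d (act g) \<in> carrier_mat d d" for g by (simp add: basis_matrix_def)
    show "basis_matrix e d (act \<one>\<^bsub>G\<^esub>) = 1\<^sub>m d"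
    proof (rule eq_matI; (simp add: basis_matrix_def)?)
      fix i j assume ij: "i < d" "j < d"
      have "?r (act \<one>\<^bsub>G\<^esub> (e j)) (e i) = (if e i = e j then 1 else 0)"
        using ij eV by (simp add: fun_space.representation_basis[OF e(2)])
      then show "(i = j \<longrightarrow> ?r (act \<one>\<^bsub>G\<^esub> (e j)) (e j) = 1) \<and> (i \<noteq> j \<longrightarrow> ?r (act \<one>\<^bsub>G\<^esub> (e j)) (e i) = 0)"
        using ij e(1) by (auto simp: inj_on_def)
    qed
    fix g h assume gh: "g \<in> carrier G" "h \<in> carrier G"
    show "basis_matrix e d (act (g \<otimes>\<^bsub>G\<^esub> h)) = basis_matrix e d (act g) * basis_matrix e d (act h)"
      by (rule eq_matI) (auto simp: basis_matrix_def scalar_prod_def mult[OF gh, unfolded lessThan_atLeast0] lessThan_atLeast0)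
  qed
  show "(\<Sum>k<d. basis_matrix e d (act g) $$ (k, k)) = trace_on V (act g)" if "g \<in> carrier G"
  proof -
    have "trace_on V (act g) = (\<Sum>b\<in>?B. ?r (act g b) b)"
      using that e by (intro trace_on_eq) auto
    then show ?thesis using e(1) by (simp add: sum.reindex basis_matrix_def)
  qed
qed

text \<open>The coordinate map \<open>L\<close> of a basis identifies the invariant subspaces of the matrix
  representation with those of \<open>V\<close>.\<close>

lemma fun_rep_irreducible:
  assumes rep: "fun_rep G V act"
    and irr: "\<And>W. fun_space.subspace W \<Longrightarrow> W \<subseteq> V \<Longrightarrow>
                (\<And>g w. g \<in> carrier G \<Longrightarrow> w \<in> W \<Longrightarrow> act g w \<in> W) \<Longrightarrow> W = {0} \<or> W = V"
    and V: "V \<noteq> {0}" and G: "group G"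
  shows "(\<lambda>g\<in>carrier G. trace_on V (act g)) \<in> irreducible_characters G"
proof -
  obtain B where B: "finite B" "fun_space.independent B" "fun_space.span B = V"
    using finite_dimE[OF fun_repD(1)[OF rep]] by blast
  define d where "d = card B"
  obtain e where bij: "bij_betw e {..<d} B"
    using B(1) unfolding d_def by (metis atLeast0LessThan ex_bij_betw_nat_finite)
  have e: "inj_on e {..<d}" "e ` {..<d} = B" using bij by (auto simp: bij_betw_def)
  have e': "inj_on e {..<d}" "fun_space.independent (e ` {..<d})" "fun_space.span (e ` {..<d}) = V"
    using e B by auto
  note mrep = fun_rep_mat_representation[OF rep e' G]
  let ?\<rho> = "\<lambda>g. basis_matrix e d (act g)"
  let ?r = "fun_space.representation B"
  have eV: "e k \<in> V" if "k < d" for k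
    unfolding e'(3)[symmetric] using that by (intro fun_space.span_base) auto
  have eB: "e k \<in> B" if "k < d" for k using that e(2) by blast
  define L :: "complex vec \<Rightarrow> _" where "L w = (\<Sum>k<d. (\<lambda>x. w $ k * e k x))" for w
  have LV: "L w \<in> V" for w
    unfolding L_def e'(3)[symmetric]
    by (intro fun_space.span_sum fun_space.span_scale fun_space.span_base) auto
  have coord: "?r (L w) (e k) = w $ k" if "k < d" for w k
  proof -
    have "?r (L w) (e k) = (\<Sum>j<d. w $ j * ?r (e j) (e k))"
      unfolding L_def by (rule representation_linear_combination[OF B(2)]) (simp add: fun_space.span_base eB)
    also have "\<dots> = (\<Sum>j<d. w $ j * (if j = k then 1 else 0))"
      using that e(1) by (intro sum.cong) (auto simp: fun_space.representation_basis[OF B(2) eB] inj_on_def)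
    also have "\<dots> = w $ k" using that by (simp add: if_distrib cong: if_cong)
    finally show ?thesis .
  qed
  have Linj: "w = w'" if "L w = L w'" "w \<in> carrier_vec d" "w' \<in> carrier_vec d" for w w'
    using that coord by (intro eq_vecI) (auto, metis)
  have expand: "v = (\<Sum>k<d. (\<lambda>x. ?r v (e k) * e k x))" if "v \<in> V" for v
  proof -
    have "v = (\<Sum>b\<in>B. (\<lambda>x. ?r v b * b x))"
      using fun_space.sum_representation_eq[OF B(2) _ B(1)] that B(3) by simp
    then show ?thesis using e(1) unfolding e(2)[symmetric] by (simp add: sum.reindex)
  qed
  have Lsurj: "L (vec d (\<lambda>k. ?r v (e k))) = v" if "v \<in> V" for v
    using expand[OF that] unfolding L_def by simp
  have Ladd: "L (w + w') = L w + L w'" if "w \<in> carrier_vec d" "w' \<in> carrier_vec d" for w w'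
    using that unfolding L_def sum.distrib[symmetric]
    by (intro sum.cong) (auto simp: fun_eq_iff algebra_simps)
  have Lscale: "L (c \<cdot>\<^sub>v w) = (\<lambda>x. c * L w x)" if "w \<in> carrier_vec d" for c w
  proof -
    have "(\<lambda>x. c * L w x) = (\<Sum>k<d. (\<lambda>x. c * (w $ k * e k x)))"
      unfolding L_def by (rule fun_space.scale_sum_right)
    also have "\<dots> = L (c \<cdot>\<^sub>v w)"
      using that unfolding L_def by (intro sum.cong) (auto simp: algebra_simps)
    finally show ?thesis by simp
  qed
  have Lact: "L (?\<rho> g *\<^sub>v w) = act g (L w)" if "g \<in> carrier G" "w \<in> carrier_vec d" for g w
  proof -
    have lin: "linear_map (act g)" using fun_repD(2)[OF rep that(1)] .
    have "act g (L w) = (\<Sum>k<d. (\<lambda>x. w $ k * act g (e k) x))"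
      unfolding L_def by (simp add: linear_map_sum[OF lin] linear_map_scale[OF lin])
    moreover have "?r (\<Sum>k<d. (\<lambda>x. w $ k * act g (e k) x)) (e i) = (\<Sum>k<d. w $ k * ?r (act g (e k)) (e i))" for i
      by (rule representation_linear_combination[OF B(2)])
         (use fun_repD(3)[OF rep that(1) eV] in \<open>simp add: B(3)\<close>)
    ultimately have "?r (act g (L w)) (e i) = (\<Sum>k<d. w $ k * ?r (act g (e k)) (e i))" for i
      by simp
    then have "?r (act g (L w)) (e i) = (?\<rho> g *\<^sub>v w) $ i" if "i < d" for i
      using that \<open>w \<in> carrier_vec d\<close> e(2)
      by (simp add: basis_matrix_def scalar_prod_def lessThan_atLeast0 mult.commute)
    then have "act g (L w) = (\<Sum>k<d. (\<lambda>x. (?\<rho> g *\<^sub>v w) $ k * e k x))"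
      using expand[of "act g (L w)"] fun_repD(3)[OF rep that(1) LV] by simp
    then show ?thesis by (simp add: L_def)
  qed
  have "irreducible_representation G d ?\<rho>"
    unfolding irreducible_representation_def
  proof (intro conjI allI impI)
    show "mat_representation G d ?\<rho>" by (rule mrep(1))
    show "0 < d"
    proof (rule ccontr)
      assume "\<not> 0 < d"
      then have "B = {}" using B(1) by (simp add: d_def)
      then show False using B V by simp
    qed
    fix W assume W: "vec_subspace d W \<and> (\<forall>g\<in>carrier G. \<forall>w\<in>W. ?\<rho> g *\<^sub>v w \<in> W)"
    then have Wc: "W \<subseteq> carrier_vec d" and W0: "0\<^sub>v d \<in> W" by (auto simp: vec_subspace_def)
    have L0: "L (0\<^sub>v d) = 0"
    proof -
      have "0 \<cdot>\<^sub>v 0\<^sub>v d = (0\<^sub>v d :: complex vec)" by (intro eq_vecI) auto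
      then show ?thesis using Lscale[of "0\<^sub>v d" 0] by (simp add: zero_fun_def)
    qed
    have "fun_space.subspace (L ` W)"
      unfolding fun_space.subspace_def
    proof (intro conjI ballI allI)
      show "0 \<in> L ` W" using W0 L0 by force
      fix x y c assume "x \<in> L ` W"
      then obtain w where w: "w \<in> W" "x = L w" by blast
      show "(\<lambda>u. c * x u) \<in> L ` W"
        using W w Lscale[of w c] subsetD[OF Wc, of w] unfolding vec_subspace_def by (intro image_eqI[of _ _ "c \<cdot>\<^sub>v w"]) auto
      assume "y \<in> L ` W"
      then obtain w' where "w' \<in> W" "y = L w'" by blast
      then show "x + y \<in> L ` W"
        using W w Ladd[of w w', symmetric] subsetD[OF Wc, of w] subsetD[OF Wc, of w'] unfolding vec_subspace_def
        by (intro image_eqI[of _ _ "w + w'"]) auto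
    qed
    moreover have "L ` W \<subseteq> V" using LV by blast
    moreover have "act g u \<in> L ` W" if "g \<in> carrier G" "u \<in> L ` W" for g u
      using that W Wc by (auto simp flip: Lact)
    ultimately have "L ` W = {0} \<or> L ` W = V" by (rule irr)
    then show "W = {0\<^sub>v d} \<or> W = carrier_vec d"
    proof
      assume "L ` W = {0}"
      have "w = 0\<^sub>v d" if "w \<in> W" for w
      proof (rule Linj)
        have "L w \<in> L ` W" using that by blast
        then show "L w = L (0\<^sub>v d)" using \<open>L ` W = {0}\<close> L0 by simp
        show "w \<in> carrier_vec d" by (rule subsetD[OF Wc that])
      qed simp
      then show ?thesis using W0 by blast
    next
      assume LW: "L ` W = V"
      have "w \<in> W" if "w \<in> carrier_vec d" for w
      proof -
        have "L w \<in> L ` W" using LV[of w] LW by simp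
        then obtain w' where "w' \<in> W" "L w = L w'" by (rule imageE) simp
        then show ?thesis using Linj[of w w'] that subsetD[OF Wc, of w'] by simp
      qed
      then show ?thesis using Wc by blast
    qed
  qed
  moreover have "(\<lambda>g\<in>carrier G. trace_on V (act g)) = (\<lambda>g\<in>carrier G. \<Sum>k<d. ?\<rho> g $$ (k, k))"
    using mrep(2) by (auto intro: restrict_ext)
  ultimately show ?thesis
    unfolding irreducible_characters_def by (intro CollectI exI[of _ d] exI[of _ ?\<rho>] conjI)
qed

lemma irreducible_characters_subset: "irreducible_characters G \<subseteq> characters G"
proof
  fix \<chi> assume \<chi>: "\<chi> \<in> irreducible_characters G"
  then have "\<chi> = (\<lambda>g\<in>carrier G. \<Sum>\<chi>'\<in>{\<chi>}. of_nat 1 * \<chi>' g)"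
    by (auto simp: irreducible_characters_def)
  then show "\<chi> \<in> characters G"
    using \<chi> unfolding characters_def by (intro CollectI exI[of _ "{\<chi>}"] exI[of _ "\<lambda>_. 1"] conjI) auto
qed

lemma zero_in_characters: "(\<lambda>g\<in>carrier G. 0) \<in> characters G"
  unfolding characters_def by (rule CollectI) (rule exI[of _ "{}"], simp)

lemma characters_add:
  assumes "\<chi> \<in> characters G" "\<psi> \<in> characters G"
  shows "(\<lambda>g\<in>carrier G. \<chi> g + \<psi> g) \<in> characters G"
proof -
  obtain X m where X: "finite X" "X \<subseteq> irreducible_characters G"
      "\<chi> = (\<lambda>g\<in>carrier G. \<Sum>\<chi>\<in>X. of_nat (m \<chi>) * \<chi> g)"
    using assms(1) by (auto simp: characters_def)
  obtain Y k where Y: "finite Y" "Y \<subseteq> irreducible_characters G"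
      "\<psi> = (\<lambda>g\<in>carrier G. \<Sum>\<chi>\<in>Y. of_nat (k \<chi>) * \<chi> g)"
    using assms(2) by (auto simp: characters_def)
  define l where "l \<chi> = (if \<chi> \<in> X then m \<chi> else 0) + (if \<chi> \<in> Y then k \<chi> else 0)" for \<chi>
  have "(\<Sum>\<chi>\<in>X \<union> Y. of_nat (l \<chi>) * \<chi> g) = \<chi> g + \<psi> g" if "g \<in> carrier G" for g
  proof -
    have "(\<Sum>\<chi>\<in>X \<union> Y. of_nat (l \<chi>) * \<chi> g)
        = (\<Sum>\<chi>\<in>X \<union> Y. if \<chi> \<in> X then of_nat (m \<chi>) * \<chi> g else 0)
        + (\<Sum>\<chi>\<in>X \<union> Y. if \<chi> \<in> Y then of_nat (k \<chi>) * \<chi> g else 0)"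
      unfolding sum.distrib[symmetric] by (intro sum.cong) (auto simp: l_def algebra_simps)
    also have "\<dots> = (\<Sum>\<chi>\<in>X. of_nat (m \<chi>) * \<chi> g) + (\<Sum>\<chi>\<in>Y. of_nat (k \<chi>) * \<chi> g)"
      using X(1) Y(1) by (simp flip: sum.inter_restrict add: Int_absorb1 Int_absorb2)
    finally show ?thesis using that X Y by simp
  qed
  then have "(\<lambda>g\<in>carrier G. \<chi> g + \<psi> g) = (\<lambda>g\<in>carrier G. \<Sum>\<chi>\<in>X \<union> Y. of_nat (l \<chi>) * \<chi> g)"
    by (auto intro: restrict_ext)
  then show ?thesis using X Y unfolding characters_def by blast
qed

lemma characters_sum:
  assumes "\<And>i. i \<in> I \<Longrightarrow> \<chi> i \<in> characters G"
  shows "(\<lambda>g\<in>carrier G. \<Sum>i\<in>I. \<chi> i g) \<in> characters G"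
  using assms
proof (induction I rule: infinite_finite_induct)
  case (insert i I)
  then have "(\<lambda>g\<in>carrier G. \<chi> i g + (\<lambda>g\<in>carrier G. \<Sum>i\<in>I. \<chi> i g) g) \<in> characters G"
    by (intro characters_add) auto
  moreover have "(\<lambda>g\<in>carrier G. \<chi> i g + (\<lambda>g\<in>carrier G. \<Sum>i\<in>I. \<chi> i g) g) = (\<lambda>g\<in>carrier G. \<Sum>i\<in>insert i I. \<chi> i g)"
    using insert by (auto intro: restrict_ext)
  ultimately show ?case by (simp only:)
qed (simp_all add: zero_in_characters)

interpretation fun_endo: vector_space_pair
  "\<lambda>(c :: complex) (v :: 'a \<Rightarrow> complex) x. c * v x" "\<lambda>(c :: complex) (v :: 'a \<Rightarrow> complex) x. c * v x" ..

lemma subspace_projection: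
  assumes "fun_space.subspace W"
  obtains p where "linear_map p" "\<And>v. p v \<in> W" "\<And>w. w \<in> W \<Longrightarrow> p w = w"
proof -
  have "linear_map (id :: ('a \<Rightarrow> complex) \<Rightarrow> _)" by (simp add: linear_map_def)
  from fun_endo.linear_exists_left_inverse_on[OF linear_map_linear[OF this] assms]
  obtain p where p: "p ` UNIV \<subseteq> W" "\<forall>v\<in>W. p v = v"
      "Vector_Spaces.linear (\<lambda>c v x. c * v x) (\<lambda>c v x. c * v x) p"
    by auto
  then have "linear_map p" by (simp add: linear_map_def Vector_Spaces.linear_iff)
  then show thesis using p by (intro that[of p]) auto
qed

text \<open>Averaging a projection over the group makes it commute with the action, so its kernel is an
  invariant complement.\<close>

lemma invariant_complement:
  fixes G (structure)
  assumes rep: "fun_rep G V act" and G: "group G" "finite (carrier G)"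
    and W: "fun_space.subspace W" "W \<subseteq> V"
      "\<And>g w. g \<in> carrier G \<Longrightarrow> w \<in> W \<Longrightarrow> act g w \<in> W"
  obtains U where "fun_space.subspace U" "U \<subseteq> V"
      "\<And>g u. g \<in> carrier G \<Longrightarrow> u \<in> U \<Longrightarrow> act g u \<in> U"
      "W \<inter> U = {0}" "V = {v + w | v w. v \<in> W \<and> w \<in> U}"
proof -
  interpret group G by (rule G(1))
  note act = fun_repD[OF rep]
  obtain p where p: "linear_map p" "\<And>v. p v \<in> W" "\<And>w. w \<in> W \<Longrightarrow> p w = w"
    using subspace_projection[OF W(1)] by blast
  define N :: complex where "N = of_nat (card (carrier G))"
  have N: "N \<noteq> 0" using G(2) one_closed by (auto simp: N_def)
  define Q where "Q v = (\<lambda>x. (1 / N) * (\<Sum>h\<in>carrier G. act h (p (act (inv h) v))) x)" for v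
  have lin: "linear_map Q"
  proof -
    have 1: "act h (p (act (inv h) (v + w))) = act h (p (act (inv h) v)) + act h (p (act (inv h) w))"
      if "h \<in> carrier G" for h v w
      using that by (simp only: linear_map_add[OF act(2)] linear_map_add[OF p(1)] inv_closed)
    have 2: "act h (p (act (inv h) (\<lambda>x. c * v x))) = (\<lambda>x. c * act h (p (act (inv h) v)) x)"
      if "h \<in> carrier G" for h v c
      using that by (simp only: linear_map_scale[OF act(2)] linear_map_scale[OF p(1)] inv_closed)
    have "Q (v + w) = Q v + Q w" for v w
      by (simp add: Q_def 1 sum.distrib fun_eq_iff distrib_left cong: sum.cong)
    moreover have "Q (\<lambda>x. c * v x) = (\<lambda>x. c * Q v x)" for c v
    proof -
      have "(\<Sum>h\<in>carrier G. act h (p (act (inv h) (\<lambda>x. c * v x))))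
          = (\<Sum>h\<in>carrier G. (\<lambda>x. c * act h (p (act (inv h) v)) x))"
        using 2 by (intro sum.cong) auto
      also have "\<dots> = (\<lambda>x. c * (\<Sum>h\<in>carrier G. act h (p (act (inv h) v))) x)"
        by (rule fun_space.scale_sum_right[symmetric])
      finally show ?thesis by (simp add: Q_def mult.left_commute)
    qed
    ultimately show ?thesis by (simp add: linear_map_def)
  qed
  have QW: "Q v \<in> W" for v
    unfolding Q_def
    by (rule fun_space.subspace_scale[OF W(1)], rule fun_space.subspace_sum[OF W(1)])
       (simp add: W(3) p(2))
  have Qid: "Q w = w" if w: "w \<in> W" for w
  proof -
    have "act h (p (act (inv h) w)) = w" if "h \<in> carrier G" for h
    proof -
      have "p (act (inv h) w) = act (inv h) w" using w that W(3) p(3) by simp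
      then show ?thesis using act(5)[of h "inv h" w] act(4)[of w] that w W(2) by auto
    qed
    then have "(\<Sum>h\<in>carrier G. act h (p (act (inv h) w))) = (\<Sum>h\<in>carrier G. w)"
      by (rule sum.cong[OF refl])
    also have "\<dots> = (\<lambda>x. N * w x)"
    proof
      fix x show "(\<Sum>h\<in>carrier G. w) x = N * w x"
        unfolding N_def by (induction "carrier G" rule: infinite_finite_induct) (auto simp: algebra_simps)
    qed
    finally show ?thesis using N by (simp add: Q_def)
  qed
  have Qact: "act g (Q v) = Q (act g v)" if g: "g \<in> carrier G" and v: "v \<in> V" for g v
  proof -
    have "act g (Q v) = (\<lambda>x. (1 / N) * (\<Sum>h\<in>carrier G. act g (act h (p (act (inv h) v)))) x)"
      unfolding Q_def linear_map_scale[OF act(2)[OF g]] linear_map_sum[OF act(2)[OF g]] ..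
    also have "(\<Sum>h\<in>carrier G. act g (act h (p (act (inv h) v))))
        = (\<Sum>h\<in>carrier G. act (g \<otimes> h) (p (act (inv (g \<otimes> h)) (act g v))))"
    proof (rule sum.cong[OF refl])
      fix h assume h: "h \<in> carrier G"
      have "act (inv (g \<otimes> h)) (act g v) = act (inv (g \<otimes> h) \<otimes> g) v"
        using g h v by (intro act(5)[symmetric]) auto
      also have "inv (g \<otimes> h) \<otimes> g = inv h" using g h by (simp add: inv_mult_group m_assoc)
      finally show "act g (act h (p (act (inv h) v))) = act (g \<otimes> h) (p (act (inv (g \<otimes> h)) (act g v)))"
        using g h p(2) W(2) by (subst act(5)) auto
    qed
    also have "\<dots> = (\<Sum>h\<in>carrier G. act h (p (act (inv h) (act g v))))"
      using g
      by (intro sum.reindex_bij_witness[of _ "\<lambda>h. inv g \<otimes> h" "\<lambda>h. g \<otimes> h"]) (auto simp: m_assoc[symmetric])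
    finally show ?thesis by (simp add: Q_def)
  qed
  define U where "U = {v \<in> V. Q v = 0}"
  have sV: "fun_space.subspace V" using act(1) by (rule finite_dim_subspace)
  have QV: "Q ` V = W" using QW Qid W(2) by force
  have QinV: "Q v \<in> V" for v using QW W(2) by blast
  have QQ: "Q (Q v) = Q v" for v using QW Qid by blast
  note split = idempotent_splitting[OF sV lin QinV QQ, unfolded QV, folded U_def]
  show thesis
  proof
    show "fun_space.subspace U" "W \<inter> U = {0}" "V = {v + w | v w. v \<in> W \<and> w \<in> U}"
      by (rule split)+
    show "U \<subseteq> V" by (auto simp: U_def)
    show "act g u \<in> U" if "g \<in> carrier G" "u \<in> U" for g u
      using that Qact[of g u] act(3)[of g u] linear_map_0[OF act(2)[of g]] by (auto simp: U_def)
  qed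
qed

lemma dim_less:
  assumes "finite_dim V" "W \<subseteq> V" "fun_space.subspace W" "W \<noteq> V"
  shows "fun_space.dim W < fun_space.dim V"
proof -
  obtain B where B: "B \<subseteq> W" "fun_space.independent B" "W \<subseteq> fun_space.span B" "card B = fun_space.dim W"
    using fun_space.basis_exists by blast
  obtain C where C: "B \<subseteq> C" "C \<subseteq> V" "fun_space.independent C" "V \<subseteq> fun_space.span C"
    using fun_space.maximal_independent_subset_extend[of B V] B assms(2) by blast
  obtain D where D: "finite D" "fun_space.span D = V" using assms(1) by (auto simp: finite_dim_def)
  have "finite C" using fun_space.independent_span_bound[OF D(1) C(3)] C(2) D(2) by blast
  moreover have "B \<noteq> C"
    using B(1) C(4) assms(2,3,4) fun_space.span_minimal[of B W] by blast
  ultimately have "card B < card C" using C(1) by (simp add: psubset_card_mono psubsetI)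
  also have "card C = fun_space.dim V" using C by (intro fun_space.basis_card_eq_dim)
  finally show ?thesis using B(4) by simp
qed

text \<open>Maschke's theorem: split off invariant complements until all pieces are irreducible; traces
  add up over the pieces.\<close>

theorem fun_rep_trace_in_characters:
  assumes "fun_rep G V act" "group G" "finite (carrier G)"
  shows "(\<lambda>g\<in>carrier G. trace_on V (act g)) \<in> characters G"
  using assms(1)
proof (induction "fun_space.dim V" arbitrary: V rule: less_induct)
  case less
  note fd = fun_repD(1)[OF less.prems]
  have sV: "fun_space.subspace V" by (rule finite_dim_subspace[OF fd])
  consider "V = {0}" | "V \<noteq> {0}" "\<And>W. fun_space.subspace W \<Longrightarrow> W \<subseteq> V \<Longrightarrow>
                (\<And>g w. g \<in> carrier G \<Longrightarrow> w \<in> W \<Longrightarrow> act g w \<in> W) \<Longrightarrow> W = {0} \<or> W = V"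
    | W where "fun_space.subspace W" "W \<subseteq> V" "\<And>g w. g \<in> carrier G \<Longrightarrow> w \<in> W \<Longrightarrow> act g w \<in> W"
        "W \<noteq> {0}" "W \<noteq> V"
    by metis
  then show ?case
  proof cases
    case 1
    have "trace_on V (act g) = 0" if "g \<in> carrier G" for g
      using fun_repD(2)[OF less.prems that] 1
      by (subst trace_on_eq[of "{}"]) (auto simp: linear_map_0 fun_space.independent_empty)
    then have "(\<lambda>g\<in>carrier G. trace_on V (act g)) = (\<lambda>g\<in>carrier G. 0)" by (auto intro: restrict_ext)
    then show ?thesis by (simp add: zero_in_characters)
  next
    case 2
    then show ?thesis
      using fun_rep_irreducible[OF less.prems] irreducible_characters_subset assms(2) by blast
  next
    case W: (3 W)
    obtain U where U: "fun_space.subspace U" "U \<subseteq> V"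
      "\<And>g u. g \<in> carrier G \<Longrightarrow> u \<in> U \<Longrightarrow> act g u \<in> U"
      "W \<inter> U = {0}" "V = {v + w | v w. v \<in> W \<and> w \<in> U}"
      using invariant_complement[OF less.prems assms(2,3) W(1,2,3)] by blast
    have "U \<noteq> V" using U(4) W(2,4) fun_space.subspace_0[OF W(1)] by blast
    have repW: "fun_rep G W act" by (rule fun_rep_subspace[OF less.prems W(1,2,3)])
    have repU: "fun_rep G U act" by (rule fun_rep_subspace[OF less.prems U(1,2,3)])
    have "(\<lambda>g\<in>carrier G. trace_on W (act g)) \<in> characters G"
      by (rule less.hyps[OF dim_less[OF fd W(2,1,5)] repW])
    moreover have "(\<lambda>g\<in>carrier G. trace_on U (act g)) \<in> characters G"
      by (rule less.hyps[OF dim_less[OF fd U(2,1) \<open>U \<noteq> V\<close>] repU])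
    ultimately have "(\<lambda>g\<in>carrier G. (\<lambda>g\<in>carrier G. trace_on W (act g)) g + (\<lambda>g\<in>carrier G. trace_on U (act g)) g) \<in> characters G"
      by (rule characters_add)
    moreover have "trace_on V (act g) = trace_on W (act g) + trace_on U (act g)" if "g \<in> carrier G" for g
      unfolding U(5) using fun_repD(1)[OF repW] fun_repD(1)[OF repU] U(4) fun_repD(2)[OF repW that] W(3) U(3) that
      by (intro trace_on_direct_sum) auto
    ultimately show ?thesis by (simp cong: restrict_cong)
  qed
qed

section \<open>Character inner products\<close>

lemma Nats_sum_closed: "(\<And>i. i \<in> I \<Longrightarrow> f i \<in> \<nat>) \<Longrightarrow> sum f I \<in> \<nat>"
  by (induction I rule: infinite_finite_induct) auto

lemma mat_representationD:
  assumes "mat_representation G d \<rho>"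
  shows "g \<in> carrier G \<Longrightarrow> \<rho> g \<in> carrier_mat d d"
    and "\<rho> \<one>\<^bsub>G\<^esub> = 1\<^sub>m d"
    and "g \<in> carrier G \<Longrightarrow> h \<in> carrier G \<Longrightarrow> \<rho> (g \<otimes>\<^bsub>G\<^esub> h) = \<rho> g * \<rho> h"
  using assms by (auto simp: mat_representation_def)

lemma mat_representation_entry:
  assumes "mat_representation G d \<rho>" "g \<in> carrier G" "h \<in> carrier G" "i < d" "j < d"
  shows "\<rho> (g \<otimes>\<^bsub>G\<^esub> h) $$ (i, j) = (\<Sum>k<d. \<rho> g $$ (i, k) * \<rho> h $$ (k, j))"
  using mat_representationD(1)[OF assms(1,2)] mat_representationD(1)[OF assms(1,3)] assms(4,5)
  by (simp add: mat_representationD(3)[OF assms(1-3)] scalar_prod_def lessThan_atLeast0)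

text \<open>For characters \<open>\<psi>(g\<inverse>)\<close> is the complex conjugate of \<open>\<psi>(g)\<close>, so this is the usual inner
  product; in this form it is bilinear and can be expanded in matrix entries.\<close>

definition char_prod ::
    "('g, 'r) monoid_scheme \<Rightarrow> ('g \<Rightarrow> complex) \<Rightarrow> ('g \<Rightarrow> complex) \<Rightarrow> complex" where
  "char_prod G \<chi> \<psi> = (\<Sum>g\<in>carrier G. \<chi> g * \<psi> (inv\<^bsub>G\<^esub> g)) / of_nat (card (carrier G))"

lemma char_prod_sum_left:
  assumes "\<And>g. g \<in> carrier G \<Longrightarrow> \<chi> g = (\<Sum>i\<in>I. c i * \<phi> i g)"
  shows "char_prod G \<chi> \<psi> = (\<Sum>i\<in>I. c i * char_prod G (\<phi> i) \<psi>)"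
proof -
  have "(\<Sum>g\<in>carrier G. \<chi> g * \<psi> (inv\<^bsub>G\<^esub> g))
      = (\<Sum>g\<in>carrier G. \<Sum>i\<in>I. c i * (\<phi> i g * \<psi> (inv\<^bsub>G\<^esub> g)))"
    using assms by (intro sum.cong) (auto simp: sum_distrib_right mult.assoc)
  also have "\<dots> = (\<Sum>i\<in>I. c i * (\<Sum>g\<in>carrier G. \<phi> i g * \<psi> (inv\<^bsub>G\<^esub> g)))"
    by (subst sum.swap) (simp add: sum_distrib_left)
  finally have "char_prod G \<chi> \<psi>
      = (\<Sum>i\<in>I. c i * (\<Sum>g\<in>carrier G. \<phi> i g * \<psi> (inv\<^bsub>G\<^esub> g))) / of_nat (card (carrier G))"
    by (simp add: char_prod_def)
  then show ?thesis by (subst (asm) sum_divide_distrib) (simp add: char_prod_def)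
qed

text \<open>The matrix of the averaging projection \<open>X \<mapsto> 1/|G| \<Sum>\<^sub>g \<rho>(g) X \<sigma>(g\<inverse>)\<close>,
  whose image consists of the intertwiners from \<open>\<sigma>\<close> to \<open>\<rho>\<close>.\<close>

definition intertwiner_kernel ::
    "('g, 'r) monoid_scheme \<Rightarrow> ('g \<Rightarrow> complex mat) \<Rightarrow> ('g \<Rightarrow> complex mat) \<Rightarrow> nat \<times> nat \<Rightarrow> nat \<times> nat \<Rightarrow> complex" where
  "intertwiner_kernel G \<rho> \<sigma> = (\<lambda>(i, j) (k, l).
     (\<Sum>g\<in>carrier G. \<rho> g $$ (i, k) * \<sigma> (inv\<^bsub>G\<^esub> g) $$ (l, j)) / of_nat (card (carrier G)))"

lemma char_prod_eq_kernel_trace: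
  assumes "group G" "\<chi> = (\<lambda>g\<in>carrier G. \<Sum>k<d. \<rho> g $$ (k, k))" "\<psi> = (\<lambda>g\<in>carrier G. \<Sum>k<e. \<sigma> g $$ (k, k))"
  shows "char_prod G \<chi> \<psi> = (\<Sum>x\<in>{..<d} \<times> {..<e}. intertwiner_kernel G \<rho> \<sigma> x x)"
proof -
  interpret group G by (rule assms(1))
  have "(\<Sum>x\<in>{..<d} \<times> {..<e}. intertwiner_kernel G \<rho> \<sigma> x x)
      = (\<Sum>i<d. \<Sum>j<e. \<Sum>g\<in>carrier G. \<rho> g $$ (i, i) * \<sigma> (inv\<^bsub>G\<^esub> g) $$ (j, j)) / of_nat (card (carrier G))"
    by (simp add: intertwiner_kernel_def sum.cartesian_product' sum_divide_distrib)
  also have "(\<Sum>i<d. \<Sum>j<e. \<Sum>g\<in>carrier G. \<rho> g $$ (i, i) * \<sigma> (inv\<^bsub>G\<^esub> g) $$ (j, j))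
     = (\<Sum>g\<in>carrier G. \<Sum>i<d. \<Sum>j<e. \<rho> g $$ (i, i) * \<sigma> (inv\<^bsub>G\<^esub> g) $$ (j, j))"
    by (subst (2) sum.swap, subst sum.swap) simp
  also have "\<dots> = (\<Sum>g\<in>carrier G. \<chi> g * \<psi> (inv\<^bsub>G\<^esub> g))"
    by (intro sum.cong) (auto simp: assms(2,3) sum_product)
  finally show ?thesis by (simp add: char_prod_def)
qed

lemma intertwiner_kernel_idempotent:
  fixes G (structure)
  assumes G: "group G" "finite (carrier G)"
    and \<rho>: "mat_representation G d \<rho>" and \<sigma>: "mat_representation G e \<sigma>"
    and x: "x \<in> {..<d} \<times> {..<e}" and y: "y \<in> {..<d} \<times> {..<e}"
  shows "(\<Sum>z\<in>{..<d} \<times> {..<e}. intertwiner_kernel G \<rho> \<sigma> x z * intertwiner_kernel G \<rho> \<sigma> z y)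
       = intertwiner_kernel G \<rho> \<sigma> x y"
proof -
  interpret group G by (rule G(1))
  obtain i j m n where xy: "x = (i, j)" "y = (m, n)" "i < d" "j < e" "m < d" "n < e" using x y by auto
  define N :: complex where "N = of_nat (card (carrier G))"
  have N: "N \<noteq> 0" using G(2) one_closed by (auto simp: N_def)
  define T where "T g = \<rho> g $$ (i, m) * \<sigma> (inv g) $$ (n, j)" for g
  have T: "(\<Sum>k<d. \<Sum>l<e. (\<rho> g $$ (i, k) * \<sigma> (inv g) $$ (l, j)) * (\<rho> h $$ (k, m) * \<sigma> (inv h) $$ (n, l))) = T (g \<otimes> h)"
    if g: "g \<in> carrier G" and h: "h \<in> carrier G" for g h
  proof -
    have "(\<Sum>k<d. \<Sum>l<e. (\<rho> g $$ (i, k) * \<sigma> (inv g) $$ (l, j)) * (\<rho> h $$ (k, m) * \<sigma> (inv h) $$ (n, l)))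
       = (\<Sum>k<d. \<rho> g $$ (i, k) * \<rho> h $$ (k, m)) * (\<Sum>l<e. \<sigma> (inv h) $$ (n, l) * \<sigma> (inv g) $$ (l, j))"
      by (simp add: sum_product mult_ac)
    also have "\<dots> = T (g \<otimes> h)"
      using g h xy by (simp add: T_def inv_mult_group mat_representation_entry[OF \<rho>] mat_representation_entry[OF \<sigma>])
    finally show ?thesis .
  qed
  have "(\<Sum>z\<in>{..<d} \<times> {..<e}. intertwiner_kernel G \<rho> \<sigma> x z * intertwiner_kernel G \<rho> \<sigma> z y)
     = (\<Sum>k<d. \<Sum>l<e. \<Sum>g\<in>carrier G. \<Sum>h\<in>carrier G.
          (\<rho> g $$ (i, k) * \<sigma> (inv g) $$ (l, j)) * (\<rho> h $$ (k, m) * \<sigma> (inv h) $$ (n, l))) / (N * N)"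
    by (simp add: intertwiner_kernel_def xy sum.cartesian_product' sum_divide_distrib sum_product N_def)
  also have "(\<Sum>k<d. \<Sum>l<e. \<Sum>g\<in>carrier G. \<Sum>h\<in>carrier G.
          (\<rho> g $$ (i, k) * \<sigma> (inv g) $$ (l, j)) * (\<rho> h $$ (k, m) * \<sigma> (inv h) $$ (n, l)))
     = (\<Sum>g\<in>carrier G. \<Sum>h\<in>carrier G. \<Sum>k<d. \<Sum>l<e.
          (\<rho> g $$ (i, k) * \<sigma> (inv g) $$ (l, j)) * (\<rho> h $$ (k, m) * \<sigma> (inv h) $$ (n, l)))"
    unfolding sum.cartesian_product
    by (rule sum.reindex_bij_witness[of _ "\<lambda>(g, h, k, l). (k, l, g, h)" "\<lambda>(k, l, g, h). (g, h, k, l)"]) auto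
  also have "\<dots> = (\<Sum>g\<in>carrier G. \<Sum>h\<in>carrier G. T (g \<otimes> h))"
    using T by (intro sum.cong refl) auto
  also have "\<dots> = (\<Sum>g\<in>carrier G. \<Sum>h\<in>carrier G. T h)"
  proof (rule sum.cong[OF refl])
    fix g assume "g \<in> carrier G"
    then show "(\<Sum>h\<in>carrier G. T (g \<otimes> h)) = (\<Sum>h\<in>carrier G. T h)"
      by (intro sum.reindex_bij_witness[of _ "\<lambda>h. inv g \<otimes> h" "\<lambda>h. g \<otimes> h"]) (auto simp: m_assoc[symmetric])
  qed
  also have "\<dots> = N * (\<Sum>h\<in>carrier G. T h)" by (simp add: N_def)
  finally show ?thesis using N by (simp add: intertwiner_kernel_def xy T_def N_def)
qed

text \<open>Schur's lemma: a nonzero intertwiner between irreducible representations has trivial kernel and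
  full image, hence an inverse.\<close>

lemma schur_trace:
  assumes G: "group G" and \<rho>: "irreducible_representation G d \<rho>" and \<sigma>: "irreducible_representation G e \<sigma>"
    and X: "X \<in> carrier_mat d e" "X \<noteq> 0\<^sub>m d e"
    and comm: "\<And>g. g \<in> carrier G \<Longrightarrow> \<rho> g * X = X * \<sigma> g"
    and g: "g \<in> carrier G"
  shows "(\<Sum>k<d. \<rho> g $$ (k, k)) = (\<Sum>k<e. \<sigma> g $$ (k, k))"
proof -
  have m\<rho>: "mat_representation G d \<rho>" and m\<sigma>: "mat_representation G e \<sigma>"
    using \<rho> \<sigma> by (auto simp: irreducible_representation_def)
  note c\<rho> = mat_representationD(1)[OF m\<rho>] and c\<sigma> = mat_representationD(1)[OF m\<sigma>]
  define K where "K = {w \<in> carrier_vec e. X *\<^sub>v w = 0\<^sub>v d}"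
  define R where "R = {X *\<^sub>v w | w. w \<in> carrier_vec e}"
  have comm_vec: "\<rho> h *\<^sub>v (X *\<^sub>v w) = X *\<^sub>v (\<sigma> h *\<^sub>v w)" if "h \<in> carrier G" "w \<in> carrier_vec e" for h w
    using that assoc_mult_mat_vec[OF c\<rho>[OF that(1)] X(1) that(2)] assoc_mult_mat_vec[OF X(1) c\<sigma>[OF that(1)] that(2)]
      comm[OF that(1)] by simp
  have smult: "X *\<^sub>v (c \<cdot>\<^sub>v w) = c \<cdot>\<^sub>v (X *\<^sub>v w)" if "w \<in> carrier_vec e" for c w
    using mult_mat_vec[OF X(1) that] .
  have add: "X *\<^sub>v (v + w) = X *\<^sub>v v + X *\<^sub>v w" if "v \<in> carrier_vec e" "w \<in> carrier_vec e" for v w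
    using mult_add_distrib_mat_vec[OF X(1) that] .
  have X0: "X *\<^sub>v 0\<^sub>v e = 0\<^sub>v d" using X(1) by auto
  have "vec_subspace e K"
    unfolding vec_subspace_def K_def using X0 by (auto simp: smult add)
  moreover have "\<sigma> h *\<^sub>v w \<in> K" if "h \<in> carrier G" "w \<in> K" for h w
  proof -
    have "\<rho> h *\<^sub>v 0\<^sub>v d = 0\<^sub>v d" using c\<rho>[OF that(1)] by auto
    then show ?thesis using that comm_vec[of h w] c\<sigma>[of h] by (auto simp: K_def)
  qed
  ultimately have K: "K = {0\<^sub>v e} \<or> K = carrier_vec e"
    using \<sigma> unfolding irreducible_representation_def by blast
  have "vec_subspace d R"
    unfolding vec_subspace_def
  proof (intro conjI ballI allI)
    show "R \<subseteq> carrier_vec d" using X(1) by (auto simp: R_def)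
    show "0\<^sub>v d \<in> R" unfolding R_def by (rule CollectI, rule exI[of _ "0\<^sub>v e"]) (simp add: X0)
    fix v assume "v \<in> R"
    then obtain v' where v': "v = X *\<^sub>v v'" "v' \<in> carrier_vec e" by (auto simp: R_def)
    show "c \<cdot>\<^sub>v v \<in> R" for c
      unfolding R_def by (rule CollectI, rule exI[of _ "c \<cdot>\<^sub>v v'"]) (simp add: v' smult)
    fix w assume "w \<in> R"
    then obtain w' where w': "w = X *\<^sub>v w'" "w' \<in> carrier_vec e" by (auto simp: R_def)
    show "v + w \<in> R"
      unfolding R_def by (rule CollectI, rule exI[of _ "v' + w'"]) (simp add: v' w' add)
  qed
  moreover have "\<rho> h *\<^sub>v v \<in> R" if "h \<in> carrier G" "v \<in> R" for h v
  proof -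
    obtain w where w: "v = X *\<^sub>v w" "w \<in> carrier_vec e" using \<open>v \<in> R\<close> by (auto simp: R_def)
    show ?thesis unfolding R_def
      by (rule CollectI, rule exI[of _ "\<sigma> h *\<^sub>v w"]) (use w comm_vec[OF that(1)] c\<sigma>[OF that(1)] in auto)
  qed
  ultimately have R: "R = {0\<^sub>v d} \<or> R = carrier_vec d"
    using \<rho> unfolding irreducible_representation_def by blast
  have col: "X *\<^sub>v unit_vec e j = col X j" if "j < e" for j
    using col_mult2[OF X(1) one_carrier_mat that] X(1) that by simp
  have "\<exists>j<e. col X j \<noteq> 0\<^sub>v d"
  proof (rule ccontr)
    assume "\<not> ?thesis"
    then have "X = 0\<^sub>m d e" using X(1)
      by (intro eq_matI) (auto, metis carrier_matD(1) carrier_matD(2) index_col index_zero_vec(1))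
    then show False using X(2) by simp
  qed
  then obtain j where j: "j < e" "X *\<^sub>v unit_vec e j \<noteq> 0\<^sub>v d" using col by auto
  have K0: "K = {0\<^sub>v e}"
  proof -
    have "unit_vec e j \<notin> K" using j(2) by (simp add: K_def)
    then have "K \<noteq> carrier_vec e" using unit_vec_carrier by metis
    then show ?thesis using K by blast
  qed
  have R1: "R = carrier_vec d"
  proof -
    have "X *\<^sub>v unit_vec e j \<in> R" by (auto simp: R_def)
    then show ?thesis using R j(2) by auto
  qed
  have "\<exists>y. \<forall>k<d. y k \<in> carrier_vec e \<and> X *\<^sub>v y k = unit_vec d k"
  proof -
    have "\<exists>w. w \<in> carrier_vec e \<and> X *\<^sub>v w = unit_vec d k" if "k < d" for k
    proof -
      have "unit_vec d k \<in> R" unfolding R1 by simp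
      then show ?thesis by (auto simp: R_def)
    qed
    then show ?thesis by metis
  qed
  then obtain y where y: "\<And>k. k < d \<Longrightarrow> y k \<in> carrier_vec e" "\<And>k. k < d \<Longrightarrow> X *\<^sub>v y k = unit_vec d k" by blast
  define Y where "Y = mat e d (\<lambda>(i, k). y k $ i)"
  have Y: "Y \<in> carrier_mat e d" by (simp add: Y_def)
  have colY: "col Y k = y k" if "k < d" for k
    using y(1)[OF that] that by (intro eq_vecI) (auto simp: Y_def)
  have XY: "X * Y = 1\<^sub>m d"
  proof (rule mat_col_eqI)
    fix k assume "k < dim_col (1\<^sub>m d :: complex mat)"
    then show "col (X * Y) k = col (1\<^sub>m d) k"
      using col_mult2[OF X(1) Y, of k] colY y(2) by simp
  qed (use X(1) Y in auto)
  have YX: "Y * X = 1\<^sub>m e"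
  proof (rule mat_col_eqI)
    fix k assume "k < dim_col (1\<^sub>m e :: complex mat)"
    then have k: "k < e" by simp
    define v where "v = col (Y * X) k - unit_vec e k"
    have cv: "col (Y * X) k \<in> carrier_vec e" using X(1) Y k by auto
    have "X *\<^sub>v col (Y * X) k = col (X * (Y * X)) k"
      using col_mult2[OF X(1) mult_carrier_mat[OF Y X(1)] k] by simp
    also have "X * (Y * X) = X"
      using assoc_mult_mat[OF X(1) Y X(1)] XY X(1) by simp
    finally have "X *\<^sub>v col (Y * X) k = X *\<^sub>v unit_vec e k" using col[OF k] by simp
    moreover have "X *\<^sub>v v = X *\<^sub>v col (Y * X) k - X *\<^sub>v unit_vec e k"
      unfolding v_def by (rule mult_minus_distrib_mat_vec[OF X(1) cv]) simp
    ultimately have "v \<in> K" using X(1) cv by (auto simp: K_def v_def)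
    then have "v = 0\<^sub>v e" using K0 by simp
    then have "col (Y * X) k = unit_vec e k"
    proof -
      have "col (Y * X) k $ i = unit_vec e k $ i" if "i < e" for i
      proof -
        have "v $ i = 0" using \<open>v = 0\<^sub>v e\<close> that by simp
        then show ?thesis using that cv unfolding v_def by simp
      qed
      then show ?thesis using cv Y by (intro eq_vecI) auto
    qed
    then show "col (Y * X) k = col (1\<^sub>m e) k" using k by simp
  qed (use X(1) Y in auto)
  define tr where "tr A = (\<Sum>k<dim_row A. A $$ (k, k))" for A :: "complex mat"
  have tr_comm: "tr (A * B) = tr (B * A)" if "A \<in> carrier_mat a b" "B \<in> carrier_mat b a" for A B a b
  proof -
    have "tr (A * B) = (\<Sum>k<a. \<Sum>l<b. A $$ (k, l) * B $$ (l, k))"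
      using that by (simp add: tr_def scalar_prod_def lessThan_atLeast0)
    also have "\<dots> = (\<Sum>l<b. \<Sum>k<a. B $$ (l, k) * A $$ (k, l))"
      by (subst sum.swap) (simp add: mult.commute)
    also have "\<dots> = tr (B * A)"
      using that by (simp add: tr_def scalar_prod_def lessThan_atLeast0)
    finally show ?thesis .
  qed
  have "\<rho> g = \<rho> g * (X * Y)" using c\<rho>[OF g] XY by simp
  also have "\<dots> = X * \<sigma> g * Y" using assoc_mult_mat[OF c\<rho>[OF g] X(1) Y] comm[OF g] by simp
  also have "\<dots> = X * (\<sigma> g * Y)" using assoc_mult_mat[OF X(1) c\<sigma>[OF g] Y] .
  finally have "tr (\<rho> g) = tr (X * (\<sigma> g * Y))" by simp
  also have "\<dots> = tr (\<sigma> g * Y * X)" using tr_comm[OF X(1) mult_carrier_mat[OF c\<sigma>[OF g] Y]] .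
  also have "\<sigma> g * Y * X = \<sigma> g" using assoc_mult_mat[OF c\<sigma>[OF g] Y X(1)] YX c\<sigma>[OF g] by simp
  finally show ?thesis using c\<rho>[OF g] c\<sigma>[OF g] by (simp add: tr_def)
qed

text \<open>The inner product is the trace of an idempotent, hence a dimension. If it is not zero, a
  column of the idempotent is a nonzero intertwiner, and Schur's lemma applies. For \<open>\<chi> = \<psi>\<close> the
  idempotent fixes the identity matrix and hence is not zero.\<close>

lemma char_prod_irreducible:
  fixes G (structure)
  assumes G: "group G" "finite (carrier G)"
    and \<chi>: "\<chi> \<in> irreducible_characters G" and \<psi>: "\<psi> \<in> irreducible_characters G"
  shows "char_prod G \<chi> \<psi> \<in> \<nat>" and "char_prod G \<chi> \<psi> \<noteq> 0 \<longleftrightarrow> \<chi> = \<psi>"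
proof -
  interpret group G by (rule G(1))
  define N :: complex where "N = of_nat (card (carrier G))"
  have N: "N \<noteq> 0" using G(2) one_closed by (auto simp: N_def)
  obtain d \<rho> where \<rho>: "irreducible_representation G d \<rho>" "\<chi> = (\<lambda>g\<in>carrier G. \<Sum>k<d. \<rho> g $$ (k, k))"
    using \<chi> by (auto simp: irreducible_characters_def)
  obtain e \<sigma> where \<sigma>: "irreducible_representation G e \<sigma>" "\<psi> = (\<lambda>g\<in>carrier G. \<Sum>k<e. \<sigma> g $$ (k, k))"
    using \<psi> by (auto simp: irreducible_characters_def)
  have m\<rho>: "mat_representation G d \<rho>" and m\<sigma>: "mat_representation G e \<sigma>" and d: "d > 0"
    using \<rho>(1) \<sigma>(1) by (auto simp: irreducible_representation_def)
  note tr = char_prod_eq_kernel_trace[OF G(1) \<rho>(2) \<sigma>(2)]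
  show "char_prod G \<chi> \<psi> \<in> \<nat>"
    unfolding tr by (rule trace_idempotent_kernel) (use intertwiner_kernel_idempotent[OF G m\<rho> m\<sigma>] in auto)
  have "\<chi> = \<psi>" if nz: "char_prod G \<chi> \<psi> \<noteq> 0"
  proof -
    obtain m n where mn: "m < d" "n < e" "intertwiner_kernel G \<rho> \<sigma> (m, n) (m, n) \<noteq> 0"
    proof -
      obtain x where "x \<in> {..<d} \<times> {..<e}" "intertwiner_kernel G \<rho> \<sigma> x x \<noteq> 0"
        using nz unfolding tr by (meson sum.not_neutral_contains_not_neutral)
      then show thesis using that by (cases x) auto
    qed
    \<comment> \<open>The average over the group of the matrix unit at \<open>(m, n)\<close>.\<close>
    define X where "X = mat d e (\<lambda>x. intertwiner_kernel G \<rho> \<sigma> x (m, n))"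
    have X: "X \<in> carrier_mat d e" by (simp add: X_def)
    have X0: "X \<noteq> 0\<^sub>m d e"
    proof
      assume "X = 0\<^sub>m d e"
      then have "X $$ (m, n) = 0" using mn by simp
      then show False using mn by (simp add: X_def)
    qed
    have comm: "\<rho> g * X = X * \<sigma> g" if g: "g \<in> carrier G" for g
    proof (rule eq_matI)
      note cg = mat_representationD(1)[OF m\<rho> g] mat_representationD(1)[OF m\<sigma> g]
      fix i j assume "i < dim_row (X * \<sigma> g)" "j < dim_col (X * \<sigma> g)"
      then have ij: "i < d" "j < e" using X cg by auto
      have "(\<rho> g * X) $$ (i, j) = (\<Sum>k<d. \<rho> g $$ (i, k) * intertwiner_kernel G \<rho> \<sigma> (k, j) (m, n))"
        using ij cg by (simp add: X_def scalar_prod_def lessThan_atLeast0)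
      also have "\<dots> = (\<Sum>k<d. \<Sum>h\<in>carrier G. \<rho> g $$ (i, k) * (\<rho> h $$ (k, m) * \<sigma> (inv h) $$ (n, j))) / N"
        by (simp add: intertwiner_kernel_def N_def sum_distrib_left sum_divide_distrib)
      also have "(\<Sum>k<d. \<Sum>h\<in>carrier G. \<rho> g $$ (i, k) * (\<rho> h $$ (k, m) * \<sigma> (inv h) $$ (n, j)))
         = (\<Sum>h\<in>carrier G. \<rho> (g \<otimes> h) $$ (i, m) * \<sigma> (inv h) $$ (n, j))"
        using g ij mn by (subst sum.swap) (simp add: mat_representation_entry[OF m\<rho>] sum_distrib_right mult.assoc)
      also have "\<dots> = (\<Sum>h\<in>carrier G. \<rho> h $$ (i, m) * \<sigma> (inv h \<otimes> g) $$ (n, j))"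
        using g
        by (intro sum.reindex_bij_witness[of _ "\<lambda>h. inv g \<otimes> h" "\<lambda>h. g \<otimes> h"])
           (auto simp: m_assoc[symmetric] inv_mult_group m_assoc)
      also have "\<dots> / N = (\<Sum>l<e. intertwiner_kernel G \<rho> \<sigma> (i, l) (m, n) * \<sigma> g $$ (l, j))"
      proof -
        have "(\<Sum>l<e. intertwiner_kernel G \<rho> \<sigma> (i, l) (m, n) * \<sigma> g $$ (l, j))
          = (\<Sum>l<e. \<Sum>h\<in>carrier G. \<rho> h $$ (i, m) * (\<sigma> (inv h) $$ (n, l) * \<sigma> g $$ (l, j))) / N"
          by (simp add: intertwiner_kernel_def N_def sum_distrib_right sum_divide_distrib mult.assoc)
        also have "(\<Sum>l<e. \<Sum>h\<in>carrier G. \<rho> h $$ (i, m) * (\<sigma> (inv h) $$ (n, l) * \<sigma> g $$ (l, j)))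
          = (\<Sum>h\<in>carrier G. \<rho> h $$ (i, m) * \<sigma> (inv h \<otimes> g) $$ (n, j))"
          using g ij mn by (subst sum.swap) (simp add: mat_representation_entry[OF m\<sigma>] sum_distrib_left)
        finally show ?thesis by simp
      qed
      also have "\<dots> = (X * \<sigma> g) $$ (i, j)"
        using ij cg by (simp add: X_def scalar_prod_def lessThan_atLeast0)
      finally show "(\<rho> g * X) $$ (i, j) = (X * \<sigma> g) $$ (i, j)" .
    qed (use X mat_representationD(1)[OF m\<rho> g] mat_representationD(1)[OF m\<sigma> g] in auto)
    show ?thesis
      unfolding \<rho>(2) \<sigma>(2) by (rule restrict_ext) (rule schur_trace[OF G(1) \<rho>(1) \<sigma>(1) X X0 comm])
  qed
  moreover have "char_prod G \<chi> \<chi> \<noteq> 0"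
    unfolding char_prod_eq_kernel_trace[OF G(1) \<rho>(2) \<rho>(2)]
  proof -
    \<comment> \<open>The entry at \<open>(0, 0)\<close> of the image of the identity matrix.\<close>
    have "(\<Sum>k<d. intertwiner_kernel G \<rho> \<rho> (0, 0) (k, k)) = 1"
    proof -
      have "(\<Sum>k<d. intertwiner_kernel G \<rho> \<rho> (0, 0) (k, k))
         = (\<Sum>g\<in>carrier G. \<Sum>k<d. \<rho> g $$ (0, k) * \<rho> (inv g) $$ (k, 0)) / N"
        by (subst sum.swap) (simp add: intertwiner_kernel_def N_def sum_divide_distrib)
      also have "(\<Sum>g\<in>carrier G. \<Sum>k<d. \<rho> g $$ (0, k) * \<rho> (inv g) $$ (k, 0)) = (\<Sum>g\<in>carrier G. 1)"
      proof (rule sum.cong[OF refl])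
        fix g assume g: "g \<in> carrier G"
        have "(\<Sum>k<d. \<rho> g $$ (0, k) * \<rho> (inv g) $$ (k, 0)) = \<rho> (g \<otimes> inv g) $$ (0, 0)"
          by (rule mat_representation_entry[OF m\<rho> g inv_closed[OF g] d d, symmetric])
        then show "(\<Sum>k<d. \<rho> g $$ (0, k) * \<rho> (inv g) $$ (k, 0)) = 1"
          using g d mat_representationD(2)[OF m\<rho>] by simp
      qed
      finally show ?thesis using N by (simp add: N_def)
    qed
    then obtain k where k: "k < d" "intertwiner_kernel G \<rho> \<rho> (0, 0) (k, k) \<noteq> 0"
      by (metis (no_types, lifting) lessThan_iff sum.neutral zero_neq_one)
    show "(\<Sum>x\<in>{..<d} \<times> {..<d}. intertwiner_kernel G \<rho> \<rho> x x) \<noteq> 0"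
      by (rule trace_idempotent_kernel(2)[where i = "(0, 0)" and j = "(k, k)"])
         (use intertwiner_kernel_idempotent[OF G m\<rho> m\<rho>] k d in auto)
  qed
  ultimately show "char_prod G \<chi> \<psi> \<noteq> 0 \<longleftrightarrow> \<chi> = \<psi>" by blast
qed

text \<open>Multiplicities of irreducible characters can be read off from inner products, so for an integral
  combination of characters it suffices to know that these inner products are nonnegative.\<close>

lemma integral_nonneg_combination_in_characters:
  assumes G: "group G" "finite (carrier G)"
    and \<psi>: "finite K" "\<And>k. k \<in> K \<Longrightarrow> \<psi> k \<in> characters G"
    and \<phi>: "finite I" "\<And>i. i \<in> I \<Longrightarrow> \<phi> i \<in> characters G" "\<And>i. i \<in> I \<Longrightarrow> 0 \<le> t i"
    and eq: "\<And>g. g \<in> carrier G \<Longrightarrow> (\<Sum>k\<in>K. of_int (m k) * \<psi> k g) = (\<Sum>i\<in>I. of_real (t i) * \<phi> i g)"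
  shows "(\<lambda>g\<in>carrier G. \<Sum>k\<in>K. of_int (m k) * \<psi> k g) \<in> characters G"
proof -
  have "\<exists>X c. finite X \<and> X \<subseteq> irreducible_characters G \<and> (\<forall>g\<in>carrier G. \<psi> k g = (\<Sum>\<chi>\<in>X. of_nat (c \<chi>) * \<chi> g))"
    if k: "k \<in> K" for k
  proof -
    obtain X m where "finite X" "X \<subseteq> irreducible_characters G"
        "\<psi> k = (\<lambda>g\<in>carrier G. \<Sum>\<chi>\<in>X. of_nat (m \<chi>) * \<chi> g)"
      using \<psi>(2)[OF k] unfolding characters_def by blast
    then show ?thesis by (intro exI[of _ X] exI[of _ m]) simp
  qed
  then have "\<forall>k\<in>K. \<exists>X c. finite X \<and> X \<subseteq> irreducible_characters G \<and> (\<forall>g\<in>carrier G. \<psi> k g = (\<Sum>\<chi>\<in>X. of_nat (c \<chi>) * \<chi> g))"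
    by blast
  from bchoice[OF this] obtain X where "\<forall>k\<in>K. \<exists>c. finite (X k) \<and> X k \<subseteq> irreducible_characters G \<and>
      (\<forall>g\<in>carrier G. \<psi> k g = (\<Sum>\<chi>\<in>X k. of_nat (c \<chi>) * \<chi> g))" ..
  from bchoice[OF this] obtain c where "\<forall>k\<in>K. finite (X k) \<and> X k \<subseteq> irreducible_characters G \<and>
      (\<forall>g\<in>carrier G. \<psi> k g = (\<Sum>\<chi>\<in>X k. of_nat (c k \<chi>) * \<chi> g))" ..
  then have X: "\<And>k. k \<in> K \<Longrightarrow> finite (X k) \<and> X k \<subseteq> irreducible_characters G"
      and c: "\<And>k g. k \<in> K \<Longrightarrow> g \<in> carrier G \<Longrightarrow> \<psi> k g = (\<Sum>\<chi>\<in>X k. of_nat (c k \<chi>) * \<chi> g)"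
    by simp_all
  define Z where "Z = (\<Union>k\<in>K. X k)"
  have Z: "finite Z" "Z \<subseteq> irreducible_characters G" using \<psi>(1) X by (auto simp: Z_def)
  define a where "a \<chi> = (\<Sum>k\<in>K. m k * (if \<chi> \<in> X k then int (c k \<chi>) else 0))" for \<chi>
  have expand: "(\<Sum>k\<in>K. of_int (m k) * \<psi> k g) = (\<Sum>\<chi>\<in>Z. of_int (a \<chi>) * \<chi> g)" if g: "g \<in> carrier G" for g
  proof -
    have "\<psi> k g = (\<Sum>\<chi>\<in>Z. of_int (if \<chi> \<in> X k then int (c k \<chi>) else 0) * \<chi> g)" if k: "k \<in> K" for k
    proof -
      have "(\<Sum>\<chi>\<in>Z. of_int (if \<chi> \<in> X k then int (c k \<chi>) else 0) * \<chi> g)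
          = (\<Sum>\<chi>\<in>Z. if \<chi> \<in> X k then of_nat (c k \<chi>) * \<chi> g else 0)"
        by (intro sum.cong) auto
      also have "\<dots> = (\<Sum>\<chi>\<in>X k. of_nat (c k \<chi>) * \<chi> g)"
        using Z(1) k by (subst sum.inter_restrict[symmetric]) (auto simp: Z_def intro!: sum.cong)
      finally show ?thesis using c[OF k g] by simp
    qed
    then have "(\<Sum>k\<in>K. of_int (m k) * \<psi> k g)
       = (\<Sum>k\<in>K. \<Sum>\<chi>\<in>Z. of_int (m k * (if \<chi> \<in> X k then int (c k \<chi>) else 0)) * \<chi> g)"
      by (intro sum.cong) (auto simp: sum_distrib_left mult.assoc)
    also have "\<dots> = (\<Sum>\<chi>\<in>Z. of_int (a \<chi>) * \<chi> g)"
      by (subst sum.swap) (simp add: a_def sum_distrib_right of_int_sum)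
    finally show ?thesis .
  qed
  have pos: "0 \<le> a \<chi>0" if \<chi>0: "\<chi>0 \<in> Z" for \<chi>0
  proof -
    have nonneg: "\<exists>r\<ge>0. char_prod G (\<phi> i) \<chi>0 = of_real r" if i: "i \<in> I" for i
    proof -
      obtain Y l where Y: "finite Y" "Y \<subseteq> irreducible_characters G"
          "\<phi> i = (\<lambda>g\<in>carrier G. \<Sum>\<chi>\<in>Y. of_nat (l \<chi>) * \<chi> g)"
        using \<phi>(2)[OF i] by (auto simp: characters_def)
      have "char_prod G (\<phi> i) \<chi>0 = (\<Sum>\<chi>\<in>Y. of_nat (l \<chi>) * char_prod G \<chi> \<chi>0)"
        by (rule char_prod_sum_left) (simp add: Y(3))
      also have "\<dots> \<in> \<nat>"
        using Y(2) \<chi>0 Z(2) char_prod_irreducible(1)[OF G] by (intro Nats_sum_closed Nats_mult) auto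
      finally obtain q where "char_prod G (\<phi> i) \<chi>0 = of_nat q" by (auto elim: Nats_cases)
      then show ?thesis by (intro exI[of _ "real q"]) auto
    qed
    then obtain r where r: "\<And>i. i \<in> I \<Longrightarrow> r i \<ge> 0 \<and> char_prod G (\<phi> i) \<chi>0 = of_real (r i)" by metis
    obtain q where q: "char_prod G \<chi>0 \<chi>0 = of_nat q" "q > 0"
    proof -
      have "\<chi>0 \<in> irreducible_characters G" using \<chi>0 Z(2) by blast
      then have "char_prod G \<chi>0 \<chi>0 \<in> \<nat>" "char_prod G \<chi>0 \<chi>0 \<noteq> 0"
        using char_prod_irreducible[OF G] by blast+
      then show thesis using that by (auto elim!: Nats_cases)
    qed
    let ?f = "\<lambda>g. \<Sum>k\<in>K. of_int (m k) * \<psi> k g"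
    have "char_prod G ?f \<chi>0 = (\<Sum>\<chi>\<in>Z. of_int (a \<chi>) * char_prod G \<chi> \<chi>0)"
      by (rule char_prod_sum_left) (rule expand)
    also have "\<dots> = (\<Sum>\<chi>\<in>Z. if \<chi> = \<chi>0 then of_int (a \<chi>) * of_nat q else 0)"
      using char_prod_irreducible(2)[OF G, of _ \<chi>0] \<chi>0 Z(2) q(1) by (intro sum.cong) auto
    also have "\<dots> = of_int (a \<chi>0) * of_nat q" using \<chi>0 Z(1) by simp
    finally have 1: "char_prod G ?f \<chi>0 = of_real (of_int (a \<chi>0) * of_nat q)" by simp
    have "char_prod G ?f \<chi>0 = (\<Sum>i\<in>I. of_real (t i) * char_prod G (\<phi> i) \<chi>0)"
      by (rule char_prod_sum_left) (rule eq)
    also have "\<dots> = of_real (\<Sum>i\<in>I. t i * r i)" using r by simp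
    finally have "of_int (a \<chi>0) * of_nat q = (\<Sum>i\<in>I. t i * r i)"
      using 1 by (metis of_real_eq_iff)
    moreover have "(\<Sum>i\<in>I. t i * r i) \<ge> 0" using r \<phi>(3) by (intro sum_nonneg mult_nonneg_nonneg) auto
    ultimately have "of_int (a \<chi>0) * real q \<ge> 0" by simp
    then show ?thesis using q(2) by (simp add: zero_le_mult_iff)
  qed
  have "(\<lambda>g\<in>carrier G. \<Sum>k\<in>K. of_int (m k) * \<psi> k g) = (\<lambda>g\<in>carrier G. \<Sum>\<chi>\<in>Z. of_nat (nat (a \<chi>)) * \<chi> g)"
    using expand pos by (intro restrict_ext) (auto intro!: sum.cong)
  then show ?thesis
    using Z unfolding characters_def by (intro CollectI exI[of _ Z] exI[of _ "\<lambda>\<chi>. nat (a \<chi>)"] conjI)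
qed

text \<open>A linear character \<open>\<epsilon>\<close> of a subgroup occurs in a character with integral multiplicity: this
  multiplicity is the trace of the projection \<open>1/|H| \<Sum>\<^sub>h \<epsilon>(h) \<rho>(h)\<close>.\<close>

lemma linear_character_multiplicity:
  fixes G (structure)
  assumes G: "group G" "finite (carrier G)" and \<chi>: "\<chi> \<in> characters G" and H: "subgroup H G"
    and \<epsilon>: "\<And>g h. g \<in> H \<Longrightarrow> h \<in> H \<Longrightarrow> \<epsilon> (g \<otimes> h) = \<epsilon> g * \<epsilon> h"
  shows "(\<Sum>h\<in>H. \<epsilon> h * \<chi> h) / of_nat (card H) \<in> \<nat>"
proof -
  interpret group G by (rule G(1))
  interpret H: subgroup H G by (rule H)
  have fin: "finite H" using G(2) H.subset finite_subset by blast
  define N :: complex where "N = of_nat (card H)"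
  have N: "N \<noteq> 0" by (metis H.one_closed N_def card_0_eq empty_iff fin of_nat_eq_0_iff)
  have irr: "(\<Sum>h\<in>H. \<epsilon> h * \<chi> h) / N \<in> \<nat>" if \<chi>: "\<chi> \<in> irreducible_characters G" for \<chi>
  proof -
    obtain d \<rho> where \<rho>: "irreducible_representation G d \<rho>" "\<chi> = (\<lambda>g\<in>carrier G. \<Sum>k<d. \<rho> g $$ (k, k))"
      using \<chi> by (auto simp: irreducible_characters_def)
    have m\<rho>: "mat_representation G d \<rho>" using \<rho>(1) by (auto simp: irreducible_representation_def)
    define a where "a i j = (\<Sum>h\<in>H. \<epsilon> h * \<rho> h $$ (i, j)) / N" for i j
    have idem: "(\<Sum>k<d. a i k * a k j) = a i j" if ij: "i < d" "j < d" for i j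
    proof -
      have "(\<Sum>k<d. a i k * a k j)
          = (\<Sum>k<d. \<Sum>g\<in>H. \<Sum>h\<in>H. (\<epsilon> g * \<rho> g $$ (i, k)) * (\<epsilon> h * \<rho> h $$ (k, j))) / (N * N)"
        by (simp add: a_def sum_product sum_divide_distrib)
      also have "(\<Sum>k<d. \<Sum>g\<in>H. \<Sum>h\<in>H. (\<epsilon> g * \<rho> g $$ (i, k)) * (\<epsilon> h * \<rho> h $$ (k, j)))
          = (\<Sum>g\<in>H. \<Sum>h\<in>H. \<Sum>k<d. (\<epsilon> g * \<rho> g $$ (i, k)) * (\<epsilon> h * \<rho> h $$ (k, j)))"
        by (subst sum.swap) (intro sum.cong refl sum.swap)
      also have "\<dots> = (\<Sum>g\<in>H. \<Sum>h\<in>H. \<epsilon> (g \<otimes> h) * \<rho> (g \<otimes> h) $$ (i, j))"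
        using ij by (intro sum.cong refl) (simp add: \<epsilon> mat_representation_entry[OF m\<rho>] sum_distrib_left mult_ac)
      also have "\<dots> = (\<Sum>g\<in>H. \<Sum>h\<in>H. \<epsilon> h * \<rho> h $$ (i, j))"
      proof (rule sum.cong[OF refl])
        fix g assume "g \<in> H"
        then show "(\<Sum>h\<in>H. \<epsilon> (g \<otimes> h) * \<rho> (g \<otimes> h) $$ (i, j)) = (\<Sum>h\<in>H. \<epsilon> h * \<rho> h $$ (i, j))"
          by (intro sum.reindex_bij_witness[of _ "\<lambda>h. inv g \<otimes> h" "\<lambda>h. g \<otimes> h"]) (auto simp: m_assoc[symmetric])
      qed
      also have "\<dots> / (N * N) = a i j" using N by (simp add: a_def N_def)
      finally show ?thesis .
    qed
    have "(\<Sum>h\<in>H. \<epsilon> h * \<chi> h) / N = (\<Sum>i<d. a i i)"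
    proof -
      have "(\<Sum>i<d. a i i) = (\<Sum>h\<in>H. \<Sum>i<d. \<epsilon> h * \<rho> h $$ (i, i)) / N"
        by (subst sum.swap) (simp add: a_def sum_divide_distrib)
      also have "(\<Sum>h\<in>H. \<Sum>i<d. \<epsilon> h * \<rho> h $$ (i, i)) = (\<Sum>h\<in>H. \<epsilon> h * \<chi> h)"
        using H.subset by (intro sum.cong) (auto simp: \<rho>(2) sum_distrib_left)
      finally show ?thesis by simp
    qed
    also have "\<dots> \<in> \<nat>" by (rule trace_idempotent_kernel) (use idem in auto)
    finally show ?thesis .
  qed
  obtain X m where X: "finite X" "X \<subseteq> irreducible_characters G"
      "\<chi> = (\<lambda>g\<in>carrier G. \<Sum>\<chi>\<in>X. of_nat (m \<chi>) * \<chi> g)"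
    using \<chi> by (auto simp: characters_def)
  have "(\<Sum>h\<in>H. \<epsilon> h * \<chi> h) / N = (\<Sum>\<chi>\<in>X. of_nat (m \<chi>) * ((\<Sum>h\<in>H. \<epsilon> h * \<chi> h) / N))"
  proof -
    have "(\<Sum>h\<in>H. \<epsilon> h * \<chi> h) = (\<Sum>h\<in>H. \<Sum>\<chi>\<in>X. of_nat (m \<chi>) * (\<epsilon> h * \<chi> h))"
      using H.subset by (intro sum.cong) (auto simp: X(3) sum_distrib_left mult_ac)
    then show ?thesis by (subst (asm) sum.swap) (simp add: sum_distrib_left sum_divide_distrib)
  qed
  also have "\<dots> \<in> \<nat>" using irr X(2) by (intro Nats_sum_closed Nats_mult) auto
  finally show ?thesis by (simp add: N_def)
qed

section \<open>Words fixed by a permutation\<close>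

lemma orbit_invariant:
  assumes "y \<in> orbit \<pi> i" "\<pi> permutes {1..n}" "i \<in> {1..n}" "\<And>i. i \<in> {1..n} \<Longrightarrow> w (\<pi> i) = w i"
  shows "y \<in> {1..n} \<and> w y = w i"
  using assms(1) by induction (use assms(3,4) permutes_in_image[OF assms(2)] in \<open>auto simp del: atLeastAtMost_iff\<close>)

text \<open>A word is fixed exactly if it is constant on the cycles.\<close>

lemma card_fixed_words:
  assumes \<pi>: "\<pi> permutes {1..n}" and X: "finite X"
  shows "card {w \<in> {1..n} \<rightarrow>\<^sub>E X. \<forall>i\<in>{1..n}. w (\<pi> i) = w i} = card X ^ num_cycles n \<pi>"
proof -
  let ?O = "orbit \<pi> ` {1..n}"
  define \<Phi> where "\<Phi> u = (\<lambda>i\<in>{1..n}. u (orbit \<pi> i))" for u :: "nat set \<Rightarrow> 'a"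
  have perm: "permutation \<pi>" using \<pi> permutation_permutes by blast
  have step: "orbit \<pi> (\<pi> i) = orbit \<pi> i" for i by (rule permutation_orbit_step[OF perm])
  have "bij_betw \<Phi> (?O \<rightarrow>\<^sub>E X) {w \<in> {1..n} \<rightarrow>\<^sub>E X. \<forall>i\<in>{1..n}. w (\<pi> i) = w i}"
    unfolding bij_betw_def
  proof
    show "inj_on \<Phi> (?O \<rightarrow>\<^sub>E X)"
    proof (rule inj_onI)
      fix u v assume u: "u \<in> ?O \<rightarrow>\<^sub>E X" and v: "v \<in> ?O \<rightarrow>\<^sub>E X" and eq: "\<Phi> u = \<Phi> v"
      show "u = v"
      proof (rule PiE_ext[OF u v])
        fix A assume "A \<in> ?O"
        then obtain i where "i \<in> {1..n}" "A = orbit \<pi> i" by blast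
        then show "u A = v A" using fun_cong[OF eq, of i] by (simp add: \<Phi>_def)
      qed
    qed
    show "\<Phi> ` (?O \<rightarrow>\<^sub>E X) = {w \<in> {1..n} \<rightarrow>\<^sub>E X. \<forall>i\<in>{1..n}. w (\<pi> i) = w i}"
    proof (intro equalityI subsetI)
      fix w assume "w \<in> \<Phi> ` (?O \<rightarrow>\<^sub>E X)"
      then obtain u where u: "u \<in> ?O \<rightarrow>\<^sub>E X" "w = \<Phi> u" by blast
      then show "w \<in> {w \<in> {1..n} \<rightarrow>\<^sub>E X. \<forall>i\<in>{1..n}. w (\<pi> i) = w i}"
        using permutes_in_image[OF \<pi>] step by (auto simp: \<Phi>_def PiE_iff simp del: atLeastAtMost_iff)
    next
      fix w assume w: "w \<in> {w \<in> {1..n} \<rightarrow>\<^sub>E X. \<forall>i\<in>{1..n}. w (\<pi> i) = w i}"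
      define r where "r A = (SOME i. i \<in> {1..n} \<and> orbit \<pi> i = A)" for A
      have r: "r A \<in> {1..n} \<and> orbit \<pi> (r A) = A" if "A \<in> ?O" for A
        unfolding r_def by (rule someI_ex) (use that in auto)
      define u where "u = (\<lambda>A\<in>?O. w (r A))"
      have "u \<in> ?O \<rightarrow>\<^sub>E X" using w r by (auto simp: u_def PiE_iff)
      moreover have "\<Phi> u = w"
      proof
        fix i show "\<Phi> u i = w i"
        proof (cases "i \<in> {1..n}")
          case True
          have A: "orbit \<pi> i \<in> ?O" using True by blast
          have "r (orbit \<pi> i) \<in> orbit \<pi> (r (orbit \<pi> i))" by (rule permutation_self_in_orbit[OF perm])
          then have "r (orbit \<pi> i) \<in> orbit \<pi> i" using r[OF A] by simp
          then have "w (r (orbit \<pi> i)) = w i" using orbit_invariant[OF _ \<pi> True, of _ w] w by auto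
          then show ?thesis using True A by (simp add: \<Phi>_def u_def)
        next
          case False
          then show ?thesis using w by (auto simp: \<Phi>_def PiE_iff extensional_def)
        qed
      qed
      ultimately show "w \<in> \<Phi> ` (?O \<rightarrow>\<^sub>E X)" by blast
    qed
  qed
  then have "card {w \<in> {1..n} \<rightarrow>\<^sub>E X. \<forall>i\<in>{1..n}. w (\<pi> i) = w i} = card (?O \<rightarrow>\<^sub>E X)"
    by (rule bij_betw_same_card[symmetric])
  also have "\<dots> = card X ^ card ?O" by (rule card_funcsetE) simp
  finally show ?thesis by (simp add: num_cycles_def)
qed

section \<open>Sign multiplicities on Young subgroups\<close>

definition block_size :: "nat \<Rightarrow> (nat \<Rightarrow> nat) \<Rightarrow> nat \<Rightarrow> nat" where
  "block_size n \<beta> b = card {i \<in> {1..n}. \<beta> i = b}"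

definition young_subgroup :: "nat \<Rightarrow> (nat \<Rightarrow> nat) \<Rightarrow> (nat \<Rightarrow> nat) set" where
  "young_subgroup n \<beta> = {h. h permutes {1..n} \<and> (\<forall>i\<in>{1..n}. \<beta> (h i) = \<beta> i)}"

lemma prod_diff_eq_binomial: "(\<Prod>k = 0..<m. t - k) = (t choose m) * fact m"
proof (induction m)
  case (Suc m)
  have "Suc m * (t choose Suc m) = (t - m) * (t choose m)"
    by (simp only: binomial_absorption binomial_absorb_comp)
  then have "(t choose Suc m) * fact (Suc m) = (t - m) * (t choose m) * fact m"
    by (metis (no_types, lifting) fact_Suc mult.assoc mult.commute of_nat_id)
  then show ?case using Suc by simp
qed simp

text \<open>The restrictions to the blocks can be chosen independently of each other.\<close>

lemma card_blockwise_injective: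
  assumes T: "\<And>b. finite (T b)"
  shows "card {w \<in> extensional {1..n}. \<forall>i\<in>{1..n}. w i \<in> T (\<beta> i) \<and> (\<forall>j\<in>{1..n}. \<beta> i = \<beta> j \<longrightarrow> w i = w j \<longrightarrow> i = j)}
       = (\<Prod>b\<in>\<beta> ` {1..n}. (card (T b) choose block_size n \<beta> b) * fact (block_size n \<beta> b))"
proof -
  let ?B = "\<lambda>b. {i \<in> {1..n}. \<beta> i = b}"
  let ?F = "\<lambda>b. {f \<in> ?B b \<rightarrow>\<^sub>E T b. inj_on f (?B b)}"
  let ?W = "{w \<in> extensional {1..n}. \<forall>i\<in>{1..n}. w i \<in> T (\<beta> i) \<and> (\<forall>j\<in>{1..n}. \<beta> i = \<beta> j \<longrightarrow> w i = w j \<longrightarrow> i = j)}"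
  define \<Phi> where "\<Phi> F = (\<lambda>i\<in>{1..n}. F (\<beta> i) i)" for F :: "nat \<Rightarrow> nat \<Rightarrow> 'a"
  have "bij_betw \<Phi> (PiE (\<beta> ` {1..n}) ?F) ?W"
    unfolding bij_betw_def
  proof
    show "inj_on \<Phi> (PiE (\<beta> ` {1..n}) ?F)"
    proof (rule inj_onI)
      fix F G assume F: "F \<in> PiE (\<beta> ` {1..n}) ?F" and G: "G \<in> PiE (\<beta> ` {1..n}) ?F" and eq: "\<Phi> F = \<Phi> G"
      show "F = G"
      proof (rule PiE_ext[OF F G])
        fix b assume b: "b \<in> \<beta> ` {1..n}"
        have Fb: "F b \<in> ?B b \<rightarrow>\<^sub>E T b" and Gb: "G b \<in> ?B b \<rightarrow>\<^sub>E T b" using F G b by (auto simp: PiE_iff)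
        show "F b = G b"
        proof (rule PiE_ext[OF Fb Gb])
          fix i assume "i \<in> ?B b"
          then show "F b i = G b i" using fun_cong[OF eq, of i] by (auto simp: \<Phi>_def)
        qed
      qed
    qed
    show "\<Phi> ` (PiE (\<beta> ` {1..n}) ?F) = ?W"
    proof (intro equalityI subsetI)
      fix w assume "w \<in> \<Phi> ` (PiE (\<beta> ` {1..n}) ?F)"
      then obtain F where F: "F \<in> PiE (\<beta> ` {1..n}) ?F" "w = \<Phi> F" by blast
      have "w i \<in> T (\<beta> i) \<and> (\<forall>j\<in>{1..n}. \<beta> i = \<beta> j \<longrightarrow> w i = w j \<longrightarrow> i = j)" if i: "i \<in> {1..n}" for i
      proof -
        have "F (\<beta> i) \<in> ?F (\<beta> i)" using F(1) i by (auto simp: PiE_iff)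
        then have "F (\<beta> i) i \<in> T (\<beta> i)" "inj_on (F (\<beta> i)) (?B (\<beta> i))" using i by (auto simp: PiE_iff)
        then show ?thesis using i by (auto simp: F(2) \<Phi>_def inj_on_def)
      qed
      then show "w \<in> ?W" by (auto simp: F(2) \<Phi>_def)
    next
      fix w assume w: "w \<in> ?W"
      define F where "F = (\<lambda>b\<in>\<beta> ` {1..n}. \<lambda>i\<in>?B b. w i)"
      have wT: "w i \<in> T (\<beta> i)" if "i \<in> {1..n}" for i using w that by blast
      have winj: "i = j" if "i \<in> {1..n}" "j \<in> {1..n}" "\<beta> i = \<beta> j" "w i = w j" for i j using w that by blast
      have wext: "w \<in> extensional {1..n}" using w by blast
      have "F \<in> PiE (\<beta> ` {1..n}) ?F"
      proof (rule PiE_I)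
        fix b assume "b \<in> \<beta> ` {1..n}"
        then have Fb: "F b = restrict w (?B b)" by (simp add: F_def)
        have "restrict w (?B b) \<in> ?B b \<rightarrow>\<^sub>E T b" using wT by auto
        moreover have "inj_on (restrict w (?B b)) (?B b)" using winj by (intro inj_onI) simp
        ultimately show "F b \<in> ?F b" by (simp add: Fb)
      qed (simp add: F_def)
      moreover have "\<Phi> F = w"
      proof
        fix i show "\<Phi> F i = w i"
          using extensional_arb[OF wext, of i] by (cases "i \<in> {1..n}") (simp_all add: F_def \<Phi>_def)
      qed
      ultimately show "w \<in> \<Phi> ` (PiE (\<beta> ` {1..n}) ?F)" by blast
    qed
  qed
  then have "card ?W = card (PiE (\<beta> ` {1..n}) ?F)" by (rule bij_betw_same_card[symmetric])
  also have "\<dots> = (\<Prod>b\<in>\<beta> ` {1..n}. card (?F b))" by (rule card_PiE) simp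
  also have "\<dots> = (\<Prod>b\<in>\<beta> ` {1..n}. (card (T b) choose block_size n \<beta> b) * fact (block_size n \<beta> b))"
  proof (rule prod.cong[OF refl])
    fix b
    have "finite (?B b)" by simp
    from card_inj_on_subset_funcset[OF this T subset_refl]
    show "card (?F b) = (card (T b) choose block_size n \<beta> b) * fact (block_size n \<beta> b)"
      unfolding block_size_def prod_diff_eq_binomial[symmetric] by simp
  qed
  finally show ?thesis .
qed

text \<open>Permutations that preserve the blocks are the words that are injective on each block and
  draw their letters there from the block itself.\<close>

lemma card_young_subgroup:
  "card (young_subgroup n \<beta>) = (\<Prod>b\<in>\<beta> ` {1..n}. fact (block_size n \<beta> b))"
proof -
  let ?B = "\<lambda>b. {i \<in> {1..n}. \<beta> i = b}"
  let ?W = "{w \<in> extensional {1..n}. \<forall>i\<in>{1..n}. w i \<in> ?B (\<beta> i) \<and> (\<forall>j\<in>{1..n}. \<beta> i = \<beta> j \<longrightarrow> w i = w j \<longrightarrow> i = j)}"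
  have "bij_betw (\<lambda>h. restrict h {1..n}) (young_subgroup n \<beta>) ?W"
    unfolding bij_betw_def
  proof
    show "inj_on (\<lambda>h. restrict h {1..n}) (young_subgroup n \<beta>)"
    proof (rule inj_onI)
      fix g h assume g: "g \<in> young_subgroup n \<beta>" and h: "h \<in> young_subgroup n \<beta>"
        and eq: "restrict g {1..n} = restrict h {1..n}"
      show "g = h"
      proof
        fix i show "g i = h i"
          using g h fun_cong[OF eq, of i] permutes_not_in[of g "{1..n}" i] permutes_not_in[of h "{1..n}" i]
          by (cases "i \<in> {1..n}") (auto simp: young_subgroup_def)
      qed
    qed
    show "(\<lambda>h. restrict h {1..n}) ` young_subgroup n \<beta> = ?W"
    proof (intro equalityI subsetI)
      fix w assume "w \<in> (\<lambda>h. restrict h {1..n}) ` young_subgroup n \<beta>"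
      then obtain h where h: "h permutes {1..n}" "\<forall>i\<in>{1..n}. \<beta> (h i) = \<beta> i" "w = restrict h {1..n}"
        by (auto simp: young_subgroup_def)
      then show "w \<in> ?W" using permutes_in_image[OF h(1)] permutes_inj[OF h(1)] by (auto dest: injD simp del: atLeastAtMost_iff)
    next
      fix w assume w: "w \<in> ?W"
      define h where "h i = (if i \<in> {1..n} then w i else i)" for i
      have wT: "w i \<in> {1..n}" "\<beta> (w i) = \<beta> i" if "i \<in> {1..n}" for i using w that by blast+
      have winj: "i = j" if "i \<in> {1..n}" "j \<in> {1..n}" "\<beta> i = \<beta> j" "w i = w j" for i j using w that by blast
      have wext: "w \<in> extensional {1..n}" using w by blast
      have inj: "inj_on h {1..n}"
      proof (rule inj_onI)
        fix i j assume i: "i \<in> {1..n}" and j: "j \<in> {1..n}" and eq: "h i = h j"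
        have eq: "w i = w j" using eq i j by (simp add: h_def)
        then have "\<beta> i = \<beta> j" using wT(2)[OF i] wT(2)[OF j] by simp
        then show "i = j" using winj[OF i j] eq by simp
      qed
      have "h ` {1..n} \<subseteq> {1..n}" using wT(1) by (auto simp: h_def simp del: atLeastAtMost_iff)
      then have "bij_betw h {1..n} {1..n}"
        using inj by (simp add: bij_betw_def endo_inj_surj)
      then have "h permutes {1..n}" by (rule bij_imp_permutes) (simp only: h_def if_False)
      then have "h \<in> young_subgroup n \<beta>" using wT(2) by (simp add: young_subgroup_def h_def)
      moreover have "restrict h {1..n} = w"
      proof
        fix i show "restrict h {1..n} i = w i"
          using extensional_arb[OF wext, of i] by (cases "i \<in> {1..n}") (simp_all add: h_def)
      qed
      ultimately show "w \<in> (\<lambda>h. restrict h {1..n}) ` young_subgroup n \<beta>" by blast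
    qed
  qed
  then have "card (young_subgroup n \<beta>) = card ?W" by (rule bij_betw_same_card)
  also have "\<dots> = (\<Prod>b\<in>\<beta> ` {1..n}. (card (?B b) choose block_size n \<beta> b) * fact (block_size n \<beta> b))"
    by (rule card_blockwise_injective) simp
  finally show ?thesis by (simp add: block_size_def)
qed

lemma finite_young_subgroup: "finite (young_subgroup n \<beta>)"
  by (rule finite_subset[of _ "{p. p permutes {1..n}}"]) (auto simp: young_subgroup_def finite_permutations)

lemma subgroup_young_subgroup: "subgroup (young_subgroup n \<beta>) (sym_group n)"
proof
  show "young_subgroup n \<beta> \<subseteq> carrier (sym_group n)"
    by (auto simp: young_subgroup_def sym_group_carrier)
  show "\<one>\<^bsub>sym_group n\<^esub> \<in> young_subgroup n \<beta>"
    by (auto simp: young_subgroup_def sym_group_one permutes_id)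
  show "x \<otimes>\<^bsub>sym_group n\<^esub> y \<in> young_subgroup n \<beta>"
    if "x \<in> young_subgroup n \<beta>" "y \<in> young_subgroup n \<beta>" for x y
    using that permutes_in_image[of y "{1..n}"]
    by (auto simp: young_subgroup_def sym_group_mult permutes_compose simp del: atLeastAtMost_iff)
  show "inv\<^bsub>sym_group n\<^esub> x \<in> young_subgroup n \<beta>" if x: "x \<in> young_subgroup n \<beta>" for x
  proof -
    have p: "x permutes {1..n}" using x by (simp add: young_subgroup_def)
    have "\<beta> (Hilbert_Choice.inv x i) = \<beta> i" if "i \<in> {1..n}" for i
    proof -
      have "Hilbert_Choice.inv x i \<in> {1..n}" using permutes_in_image[OF permutes_inv[OF p]] that by blast
      then have "\<beta> (x (Hilbert_Choice.inv x i)) = \<beta> (Hilbert_Choice.inv x i)" using x by (auto simp: young_subgroup_def)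
      then show ?thesis using permutes_inverses(1)[OF p] by simp
    qed
    then show ?thesis
      using p permutes_inv[OF p] by (simp add: sym_group_inv_equality sym_group_carrier young_subgroup_def)
  qed
qed

text \<open>Expanding \<open>x ^ \<ell>(h)\<close> as the number of words fixed by \<open>h\<close> and exchanging the sums, the words
  with a repeated letter inside a block cancel, because the corresponding transposition reverses signs
  in their stabilizer; all other words have a trivial stabilizer.\<close>

lemma sign_sum_young_subgroup:
  "(\<Sum>h\<in>young_subgroup n \<beta>. sign h * int x ^ num_cycles n h)
   = int (\<Prod>b\<in>\<beta> ` {1..n}. (x choose block_size n \<beta> b) * fact (block_size n \<beta> b))"
proof -
  let ?W = "{1..n} \<rightarrow>\<^sub>E {..<x}"
  let ?H = "young_subgroup n \<beta>"
  let ?fix = "\<lambda>h w. \<forall>i\<in>{1..n}. w (h i) = w i"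
  let ?inj = "\<lambda>w. \<forall>i\<in>{1..n}. \<forall>j\<in>{1..n}. \<beta> i = \<beta> j \<longrightarrow> w i = w j \<longrightarrow> i = (j :: nat)"
  have finW: "finite ?W" by (intro finite_PiE) auto
  have "(\<Sum>h\<in>?H. sign h * int x ^ num_cycles n h) = (\<Sum>h\<in>?H. \<Sum>w\<in>?W. if ?fix h w then sign h else 0)"
  proof (rule sum.cong[OF refl])
    fix h assume h: "h \<in> ?H"
    then have "int x ^ num_cycles n h = int (card {w \<in> ?W. ?fix h w})"
      using card_fixed_words[of h n "{..<x}"] by (simp add: young_subgroup_def)
    also have "\<dots> = (\<Sum>w\<in>?W. if ?fix h w then 1 else 0)"
      using finW by (simp add: sum.inter_filter[symmetric])
    finally show "sign h * int x ^ num_cycles n h = (\<Sum>w\<in>?W. if ?fix h w then sign h else 0)"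
      by (simp add: sum_distrib_left if_distrib cong: if_cong)
  qed
  also have "\<dots> = (\<Sum>w\<in>?W. \<Sum>h\<in>?H. if ?fix h w then sign h else 0)" by (rule sum.swap)
  also have "\<dots> = (\<Sum>w\<in>?W. if ?inj w then 1 else 0)"
  proof (rule sum.cong[OF refl])
    fix w assume w: "w \<in> ?W"
    have "(\<Sum>h\<in>?H. if ?fix h w then sign h else 0) = (\<Sum>h\<in>{h\<in>?H. ?fix h w}. sign h)"
      by (rule sum.inter_filter[symmetric, OF finite_young_subgroup])
    also have "\<dots> = (if ?inj w then 1 else 0)"
    proof (cases "?inj w")
      case True
      have "{h\<in>?H. ?fix h w} = {id}"
      proof (intro equalityI subsetI)
        fix h assume h: "h \<in> {h\<in>?H. ?fix h w}"
        then have p: "h permutes {1..n}" by (simp add: young_subgroup_def)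
        have "h i = i" for i
        proof (cases "i \<in> {1..n}")
          case i: True
          have "\<beta> (h i) = \<beta> i" "w (h i) = w i" "h i \<in> {1..n}"
            using h i permutes_in_image[OF p] by (auto simp: young_subgroup_def simp del: atLeastAtMost_iff)
          then show ?thesis using True i by blast
        qed (use permutes_not_in[OF p] in auto)
        then show "h \<in> {id}" by (simp add: fun_eq_iff)
      qed (simp add: young_subgroup_def permutes_id)
      then show ?thesis unfolding if_P[OF True] by simp
    next
      case False
      then obtain i j where ij: "i \<in> {1..n}" "j \<in> {1..n}" "\<beta> i = \<beta> j" "w i = w j" "i \<noteq> j" by blast
      define \<tau> where "\<tau> = transpose i j"
      have \<tau>p: "\<tau> permutes {1..n}" unfolding \<tau>_def using ij by (intro permutes_swap_id) auto
      have \<tau>\<tau>: "\<tau> \<circ> (\<tau> \<circ> h) = h" for h by (simp add: \<tau>_def o_assoc[symmetric] fun_eq_iff)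
      have \<tau>w: "w (\<tau> k) = w k" "\<beta> (\<tau> k) = \<beta> k" for k using ij by (auto simp: \<tau>_def transpose_def)
      have closed: "\<tau> \<circ> h \<in> {h\<in>?H. ?fix h w}" if "h \<in> {h\<in>?H. ?fix h w}" for h
        using that \<tau>w permutes_compose[OF _ \<tau>p] by (auto simp: young_subgroup_def)
      have sgn: "sign (\<tau> \<circ> h) = - sign h" if "h \<in> {h\<in>?H. ?fix h w}" for h
      proof -
        have "permutation \<tau>" "permutation h"
          using that \<tau>p permutation_permutes by (auto simp: young_subgroup_def)
        then show ?thesis using ij(5) by (simp add: sign_compose \<tau>_def sign_swap_id)
      qed
      have "(\<Sum>h\<in>{h\<in>?H. ?fix h w}. sign h) = (\<Sum>h\<in>{h\<in>?H. ?fix h w}. - sign h)"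
        by (rule sum.reindex_bij_witness[of _ "\<lambda>h. \<tau> \<circ> h" "\<lambda>h. \<tau> \<circ> h"])
           (use closed sgn \<tau>\<tau> in \<open>auto simp: sgn\<close>)
      then show ?thesis unfolding if_not_P[OF False] by (simp add: sum_negf)
    qed
    finally show "(\<Sum>h\<in>?H. if ?fix h w then sign h else 0) = (if ?inj w then 1 else 0)" .
  qed
  also have "\<dots> = int (card {w \<in> ?W. ?inj w})"
    using finW by (simp add: sum.inter_filter[symmetric])
  also have "{w \<in> ?W. ?inj w} = {w \<in> extensional {1..n}. \<forall>i\<in>{1..n}. w i \<in> {..<x} \<and> (\<forall>j\<in>{1..n}. \<beta> i = \<beta> j \<longrightarrow> w i = w j \<longrightarrow> i = j)}"
    by (auto simp: PiE_iff)
  also have "card \<dots> = (\<Prod>b\<in>\<beta> ` {1..n}. (card {..<x} choose block_size n \<beta> b) * fact (block_size n \<beta> b))"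
    by (rule card_blockwise_injective) simp
  finally show ?thesis by simp
qed

lemma finite_sym_group: "finite (carrier (sym_group n))"
  by (simp add: sym_group_def finite_permutations)

text \<open>The multiplicity of the sign character of a Young subgroup in \<open>x ^ \<ell>\<close> is the product of
  binomial coefficients, whereas in a character it is an integer.\<close>

lemma sign_multiplicity_integral:
  assumes \<theta>: "\<theta> \<in> characters (sym_group n)"
    and eq: "\<And>\<pi>. \<pi> \<in> carrier (sym_group n) \<Longrightarrow> \<theta> \<pi> = (\<Sum>x\<in>X. of_real (s x) * of_nat x ^ num_cycles n \<pi>)"
  shows "(\<Sum>x\<in>X. s x * real (\<Prod>b\<in>\<beta> ` {1..n}. x choose block_size n \<beta> b)) \<in> \<int>"
proof -
  let ?H = "young_subgroup n \<beta>"
  let ?N = "real (card ?H)"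
  let ?S = "\<Sum>x\<in>X. s x * real (\<Prod>b\<in>\<beta> ` {1..n}. x choose block_size n \<beta> b)"
  have N: "?N = (\<Prod>b\<in>\<beta> ` {1..n}. fact (block_size n \<beta> b))" "?N \<noteq> 0"
    by (simp_all add: card_young_subgroup)
  have sum: "(\<Sum>h\<in>?H. real_of_int (sign h) * real x ^ num_cycles n h)
      = real (\<Prod>b\<in>\<beta> ` {1..n}. x choose block_size n \<beta> b) * ?N" for x
  proof -
    have "(\<Sum>h\<in>?H. real_of_int (sign h) * real x ^ num_cycles n h)
        = real_of_int (\<Sum>h\<in>?H. sign h * int x ^ num_cycles n h)" by simp
    also have "\<dots> = real (\<Prod>b\<in>\<beta> ` {1..n}. x choose block_size n \<beta> b) * ?N"
      by (simp add: sign_sum_young_subgroup N(1) prod.distrib)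
    finally show ?thesis .
  qed
  have "(\<Sum>h\<in>?H. of_int (sign h) * \<theta> h) / of_nat (card ?H) \<in> \<nat>"
  proof (rule linear_character_multiplicity[OF sym_group_is_group finite_sym_group \<theta> subgroup_young_subgroup])
    fix g h assume "g \<in> ?H" "h \<in> ?H"
    then have "permutation g" "permutation h"
      using permutation_permutes by (auto simp: young_subgroup_def)
    then show "complex_of_int (sign (g \<otimes>\<^bsub>sym_group n\<^esub> h)) = of_int (sign g) * of_int (sign h)"
      by (simp add: sym_group_mult sign_compose)
  qed
  also have "(\<Sum>h\<in>?H. of_int (sign h) * \<theta> h)
     = of_real (\<Sum>h\<in>?H. \<Sum>x\<in>X. s x * (real_of_int (sign h) * real x ^ num_cycles n h))"
    unfolding of_real_sum using eq
    by (intro sum.cong refl) (auto simp: young_subgroup_def sym_group_carrier sum_distrib_left mult_ac)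
  also have "(\<Sum>h\<in>?H. \<Sum>x\<in>X. s x * (real_of_int (sign h) * real x ^ num_cycles n h))
     = (\<Sum>x\<in>X. s x * real (\<Prod>b\<in>\<beta> ` {1..n}. x choose block_size n \<beta> b)) * ?N"
    by (subst sum.swap) (simp add: sum sum_distrib_left[symmetric] sum_distrib_right mult.assoc)
  finally have N': "complex_of_real ?S \<in> \<nat>"
    using N(2) by simp
  obtain q where "complex_of_real ?S = of_nat q" using N' by (rule Nats_cases)
  then have "complex_of_real ?S = of_real (real q)" by simp
  then have "?S = real q" by (simp only: of_real_eq_iff)
  then show ?thesis by simp
qed

section \<open>Permutation characters that depend only on the number of cycles\<close>

text \<open>The composition law of \<open>op\<close> is that of a right action, because permuting the positions of a
  word acts on the right; on functions of words it becomes a left action.\<close>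

lemma permutation_character:
  fixes G (structure) and I :: "'a set"
  assumes G: "group G" "finite (carrier G)" and I: "finite I"
    and op: "\<And>g w. g \<in> carrier G \<Longrightarrow> w \<in> I \<Longrightarrow> op g w \<in> I"
      "\<And>w. w \<in> I \<Longrightarrow> op \<one> w = w"
      "\<And>g h w. g \<in> carrier G \<Longrightarrow> h \<in> carrier G \<Longrightarrow> w \<in> I \<Longrightarrow> op (g \<otimes> h) w = op h (op g w)"
  shows "(\<lambda>g\<in>carrier G. of_nat (card {w \<in> I. op g w = w})) \<in> characters G"
proof -
  define act where "act g v = (\<lambda>w. if w \<in> I then v (op g w) else 0)" for g and v :: "'a \<Rightarrow> complex"
  have lin: "linear_map (act g)" for g by (auto simp: linear_map_def act_def fun_eq_iff)
  have supp: "act g v \<in> supported_on I" for g v by (auto simp: act_def supported_on_def)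
  have "fun_rep G (supported_on I) act"
    unfolding fun_rep_def
  proof (intro conjI ballI)
    show "finite_dim (supported_on I)" by (rule finite_dim_supported_on[OF I])
    show "act \<one> v = v" if "v \<in> supported_on I" for v
      using that op(2) by (auto simp: act_def supported_on_def fun_eq_iff)
    show "act (g \<otimes> h) v = act g (act h v)" if "g \<in> carrier G" "h \<in> carrier G" for g h v
      using that op(1,3) by (auto simp: act_def fun_eq_iff)
  qed (simp_all add: lin supp)
  then have "(\<lambda>g\<in>carrier G. trace_on (supported_on I) (act g)) \<in> characters G"
    using G by (rule fun_rep_trace_in_characters)
  moreover have "trace_on (supported_on I) (act g) = of_nat (card {w \<in> I. op g w = w})" for g
  proof -
    have "trace_on (supported_on I) (act g) = (\<Sum>w\<in>I. if op g w = w then 1 else 0)"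
      by (subst trace_on_supported_on[OF I lin supp]) (auto simp: act_def point_mass_def intro!: sum.cong)
    also have "\<dots> = of_nat (card {w \<in> I. op g w = w})"
      using I by (simp add: sum.inter_filter[symmetric])
    finally show ?thesis .
  qed
  ultimately show ?thesis by simp
qed

text \<open>The letters are residues modulo \<open>k\<close>. The bound on the letter sum selects one residue from
  each coset of the multiples of \<open>gcd k n\<close>, and it is preserved by permuting positions.\<close>

definition residue_words :: "nat \<Rightarrow> nat \<Rightarrow> (nat \<Rightarrow> nat) set" where
  "residue_words n k = {w \<in> {1..n} \<rightarrow>\<^sub>E {..<k}. (\<Sum>i\<in>{1..n}. w i) mod k < gcd k n}"

text \<open>Adding a constant to all letters of a word shifts the sum of its letters by a multiple of \<open>n\<close>.
  Hence among the words fixed by \<open>\<pi>\<close> the letter sums are distributed over the residues modulo \<open>k\<close>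
  with period \<open>gcd k n\<close>.\<close>

lemma card_fixed_residue_words:
  assumes \<pi>: "\<pi> permutes {1..n}" and n: "n \<ge> 1" and k: "k \<ge> 1"
  shows "k * card {w \<in> residue_words n k. \<forall>i\<in>{1..n}. w (\<pi> i) = w i} = gcd k n * k ^ num_cycles n \<pi>"
proof -
  define F where "F = {w \<in> {1..n} \<rightarrow>\<^sub>E {..<k}. \<forall>i\<in>{1..n}. w (\<pi> i) = w i}"
  define g where "g = gcd k n"
  define S where "S w = (\<Sum>i\<in>{1..n}. w i) mod k" for w :: "nat \<Rightarrow> nat"
  define N where "N r = card {w \<in> F. S w = r}" for r
  define sh where "sh c w = (\<lambda>i\<in>{1..n}. (w i + c) mod k)" for c and w :: "nat \<Rightarrow> nat"
  have finF: "finite F"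
    by (rule finite_subset[of _ "{1..n} \<rightarrow>\<^sub>E {..<k}"]) (auto simp: F_def intro!: finite_PiE)
  have g: "g > 0" "g dvd k" using k by (auto simp: g_def)
  have shF: "sh c w \<in> F" if "w \<in> F" for c w
    using that k permutes_in_image[OF \<pi>] by (auto simp: F_def sh_def PiE_iff simp del: atLeastAtMost_iff)
  have shS: "S (sh c w) = (S w + n * c) mod k" for c w
  proof -
    have "S (sh c w) = (\<Sum>i\<in>{1..n}. (w i + c) mod k) mod k"
      unfolding S_def sh_def by (intro arg_cong[of _ _ "\<lambda>x. x mod k"] sum.cong) auto
    also have "\<dots> = (\<Sum>i\<in>{1..n}. w i + c) mod k" by (rule mod_sum_eq)
    also have "\<dots> = (S w + n * c) mod k" by (simp add: sum.distrib S_def mod_add_left_eq)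
    finally show ?thesis .
  qed
  have shsh: "sh d (sh c w) = w" if "w \<in> F" "(c + d) mod k = 0" for c d w
  proof
    fix i show "sh d (sh c w) i = w i"
    proof (cases "i \<in> {1..n}")
      case True
      then have "w i < k" using that(1) by (auto simp: F_def PiE_iff)
      have "sh d (sh c w) i = (w i + (c + d)) mod k"
        using True by (simp add: sh_def mod_add_left_eq add.assoc)
      also have "\<dots> = (w i + (c + d) mod k) mod k" by (simp add: mod_add_right_eq)
      finally show ?thesis using that(2) \<open>w i < k\<close> by simp
    next
      case False
      then show ?thesis using that(1) by (auto simp: F_def sh_def PiE_iff extensional_def)
    qed
  qed
  have period: "N (r + g) = N r" if r: "r + g < k" for r
  proof -
    \<comment> \<open>Shifting by \<open>c\<close> increases the letter sum by \<open>g\<close> modulo \<open>k\<close>; shifting by \<open>d\<close> undoes this.\<close>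
    obtain c0 where c0: "[n * c0 = gcd n k] (mod k)" using cong_solve_nat[of n k] n by auto
    define c where "c = c0 mod k"
    define d where "d = k - c"
    have ck: "c < k" using k by (simp add: c_def)
    have c: "(n * c) mod k = g mod k"
      using c0 by (simp add: c_def g_def cong_def gcd.commute mod_mult_right_eq)
    have cd: "(c + d) mod k = 0" "(d + c) mod k = 0" using ck by (auto simp: d_def)
    have nd: "(g + n * d) mod k = 0"
    proof -
      have "(g + n * d) mod k = (n * c + n * d) mod k" using c by (metis mod_add_left_eq)
      also have "\<dots> = (n * k) mod k" using ck by (simp add: d_def flip: distrib_left)
      finally show ?thesis by simp
    qed
    have "card {w \<in> F. S w = r} = card {w \<in> F. S w = r + g}"
    proof (rule bij_betw_same_card, rule bij_betw_byWitness[where f = "sh c" and f' = "sh d"])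
      show "\<forall>w\<in>{w \<in> F. S w = r}. sh d (sh c w) = w" using shsh cd by auto
      show "\<forall>w\<in>{w \<in> F. S w = r + g}. sh c (sh d w) = w" using shsh cd by auto
      show "sh c ` {w \<in> F. S w = r} \<subseteq> {w \<in> F. S w = r + g}"
      proof -
        have "(r + n * c) mod k = r + g" using c r by (metis mod_add_right_eq mod_less)
        then show ?thesis using shF shS by auto
      qed
      show "sh d ` {w \<in> F. S w = r + g} \<subseteq> {w \<in> F. S w = r}"
      proof -
        have "(r + g + n * d) mod k = (r + (g + n * d) mod k) mod k" by (simp add: mod_add_right_eq add.assoc)
        then have "(r + g + n * d) mod k = r" using nd r by simp
        then show ?thesis using shF shS by auto
      qed
    qed
    then show ?thesis by (simp add: N_def)
  qed
  have period': "N (q * g + r) = N r" if "q * g + r < k" for q r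
    using that
  proof (induction q)
    case (Suc q)
    then have "N (q * g + r + g) = N (q * g + r)" by (intro period) (simp add: add_ac)
    then show ?case using Suc by (simp add: add_ac)
  qed simp
  have sumN: "(\<Sum>r\<in>A. N r) = card {w \<in> F. S w \<in> A}" if "finite A" for A
  proof -
    have "{w \<in> F. S w \<in> A} = (\<Union>r\<in>A. {w \<in> F. S w = r})" by blast
    then have "card {w \<in> F. S w \<in> A} = card (\<Union>r\<in>A. {w \<in> F. S w = r})" by (rule arg_cong)
    also have "\<dots> = (\<Sum>r\<in>A. N r)"
      unfolding N_def using that finF by (intro card_UN_disjoint) auto
    finally show ?thesis by simp
  qed
  define q where "q = k div g"
  have kq: "k = q * g" using g by (simp add: q_def)
  have "k ^ num_cycles n \<pi> = card F"
    using card_fixed_words[OF \<pi>, of "{..<k}"] by (simp add: F_def)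
  also have "F = {w \<in> F. S w \<in> {..<k}}" using k by (auto simp: S_def)
  also have "card \<dots> = (\<Sum>r<k. N r)" by (rule sumN[symmetric]) simp
  also have "\<dots> = (\<Sum>m<q. \<Sum>r\<in>{m * g..<m * g + g}. N r)"
    using sum.nat_group[of N g q] kq by simp
  also have "\<dots> = (\<Sum>m<q. \<Sum>r<g. N r)"
  proof (rule sum.cong[OF refl])
    fix m assume m: "m \<in> {..<q}"
    have "(\<Sum>r\<in>{m * g..<m * g + g}. N r) = (\<Sum>r<g. N (m * g + r))"
      by (rule sum.reindex_bij_witness[of _ "\<lambda>r. m * g + r" "\<lambda>r. r - m * g"]) auto
    also have "\<dots> = (\<Sum>r<g. N r)"
    proof (rule sum.cong[OF refl])
      fix r assume "r \<in> {..<g}"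
      then have "m * g + r < Suc m * g" by simp
      also have "\<dots> \<le> k" unfolding kq using m by (intro mult_le_mono1) auto
      finally show "N (m * g + r) = N r" by (rule period')
    qed
    finally show "(\<Sum>r\<in>{m * g..<m * g + g}. N r) = (\<Sum>r<g. N r)" .
  qed
  also have "\<dots> = q * (\<Sum>r<g. N r)" by simp
  also have "(\<Sum>r<g. N r) = card {w \<in> F. S w \<in> {..<g}}" by (rule sumN) simp
  also have "{w \<in> F. S w \<in> {..<g}} = {w \<in> residue_words n k. \<forall>i\<in>{1..n}. w (\<pi> i) = w i}"
    by (auto simp: F_def S_def g_def residue_words_def)
  finally have "g * k ^ num_cycles n \<pi> = (q * g) * card {w \<in> residue_words n k. \<forall>i\<in>{1..n}. w (\<pi> i) = w i}"
    by simp
  then have "g * k ^ num_cycles n \<pi> = k * card {w \<in> residue_words n k. \<forall>i\<in>{1..n}. w (\<pi> i) = w i}"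
    unfolding kq[symmetric] .
  then show ?thesis unfolding g_def by (rule sym)
qed

text \<open>By the previous count, this is the permutation character on residue words.\<close>

lemma scaled_power_num_cycles_character:
  assumes n: "n \<ge> 1" and k: "k \<ge> 1"
  shows "(\<lambda>\<pi>\<in>carrier (sym_group n). of_nat (gcd k n) / of_nat k * of_nat k ^ num_cycles n \<pi>)
         \<in> characters (sym_group n)"
proof -
  let ?op = "\<lambda>\<pi> w. \<lambda>i\<in>{1..n}. w (\<pi> i)"
  have "(\<lambda>\<pi>\<in>carrier (sym_group n). of_nat (card {w \<in> residue_words n k. ?op \<pi> w = w})) \<in> characters (sym_group n)"
  proof (rule permutation_character[OF sym_group_is_group finite_sym_group])
    show "finite (residue_words n k)"
      by (rule finite_subset[of _ "{1..n} \<rightarrow>\<^sub>E {..<k}"]) (auto simp: residue_words_def intro!: finite_PiE)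
    fix \<pi> w assume \<pi>: "\<pi> \<in> carrier (sym_group n)" and w: "w \<in> residue_words n k"
    then have p: "\<pi> permutes {1..n}" by (simp add: sym_group_carrier)
    have "(\<Sum>i\<in>{1..n}. ?op \<pi> w i) = (\<Sum>i\<in>{1..n}. w (\<pi> i))" by (intro sum.cong) auto
    also have "\<dots> = (\<Sum>i\<in>{1..n}. w i)" using sum.permute[OF p, of w] by (simp add: o_def)
    finally show "?op \<pi> w \<in> residue_words n k"
      using w permutes_in_image[OF p] unfolding residue_words_def
      by (auto simp: PiE_iff simp del: atLeastAtMost_iff)
  next
    fix w assume "w \<in> residue_words n k"
    then show "?op \<one>\<^bsub>sym_group n\<^esub> w = w"
      by (auto simp: residue_words_def sym_group_one PiE_iff extensional_def fun_eq_iff)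
  next
    fix \<pi> \<sigma> w assume "\<sigma> \<in> carrier (sym_group n)"
    then show "?op (\<pi> \<otimes>\<^bsub>sym_group n\<^esub> \<sigma>) w = ?op \<sigma> (?op \<pi> w)"
      using permutes_in_image[of \<sigma> "{1..n}"]
      by (auto simp: sym_group_mult sym_group_carrier fun_eq_iff simp del: atLeastAtMost_iff)
  qed
  moreover have "of_nat (card {w \<in> residue_words n k. ?op \<pi> w = w})
      = (of_nat (gcd k n) / of_nat k * of_nat k ^ num_cycles n \<pi> :: complex)"
    if "\<pi> \<in> carrier (sym_group n)" for \<pi>
  proof -
    have p: "\<pi> permutes {1..n}" using that by (simp add: sym_group_carrier)
    have "{w \<in> residue_words n k. ?op \<pi> w = w} = {w \<in> residue_words n k. \<forall>i\<in>{1..n}. w (\<pi> i) = w i}"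
      by (auto simp: residue_words_def PiE_iff extensional_def fun_eq_iff)
    then have "k * card {w \<in> residue_words n k. ?op \<pi> w = w} = gcd k n * k ^ num_cycles n \<pi>"
      using card_fixed_residue_words[OF p n k] by simp
    from arg_cong[OF this, of "of_nat :: nat \<Rightarrow> complex"]
    have "of_nat k * of_nat (card {w \<in> residue_words n k. ?op \<pi> w = w})
        = (of_nat (gcd k n) * of_nat k ^ num_cycles n \<pi> :: complex)"
      by (simp only: of_nat_mult of_nat_power)
    then show ?thesis using k by (simp add: field_simps)
  qed
  ultimately show ?thesis by (simp cong: restrict_cong)
qed

section \<open>Divisibility of products of binomial coefficients\<close>

lemma sum_block_size: "(\<Sum>b\<in>\<beta> ` {1..n}. block_size n \<beta> b) = n"
  using sum.image_gen[of "{1..n}" "\<lambda>_. 1 :: nat" \<beta>] by (simp add: block_size_def)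

lemma dvd_times_binomial: "x dvd m * (x choose m)"
proof (cases m)
  case (Suc k)
  then show ?thesis by (metis binomial_absorption dvd_triv_left)
qed simp

text \<open>With \<open>P\<close> the product and \<open>m\<close> ranging over the block sizes, \<open>x\<close> divides each
  \<open>m * (x choose m)\<close> and hence each \<open>m * P\<close>. The sizes add up to \<open>n\<close>, so \<open>x\<close> divides \<open>n * P\<close>; it
  also divides \<open>x * P\<close>, hence \<open>gcd x n * P\<close>.\<close>

lemma dvd_prod_binomial:
  assumes x: "x > 0"
  shows "x div gcd x n dvd (\<Prod>b\<in>\<beta> ` {1..n}. x choose block_size n \<beta> b)"
proof -
  let ?P = "\<Prod>b\<in>\<beta> ` {1..n}. x choose block_size n \<beta> b"
  have "x dvd (\<Sum>b\<in>\<beta> ` {1..n}. block_size n \<beta> b * ?P)"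
  proof (rule dvd_sum)
    fix b assume b: "b \<in> \<beta> ` {1..n}"
    have "x dvd block_size n \<beta> b * (x choose block_size n \<beta> b)" by (rule dvd_times_binomial)
    also have "(x choose block_size n \<beta> b) dvd ?P" using b by (intro dvd_prodI) auto
    then have "block_size n \<beta> b * (x choose block_size n \<beta> b) dvd block_size n \<beta> b * ?P"
      by (rule mult_dvd_mono[OF dvd_refl])
    finally show "x dvd block_size n \<beta> b * ?P" .
  qed
  then have "x dvd n * ?P" unfolding sum_distrib_right[symmetric] sum_block_size .
  moreover have "x dvd x * ?P" by simp
  ultimately have "x dvd gcd (x * ?P) (n * ?P)" by simp
  also have "gcd (x * ?P) (n * ?P) = gcd x n * ?P"
    using gcd_mult_distrib_nat[of ?P x n] by (simp add: mult.commute)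
  finally have "gcd x n * (x div gcd x n) dvd gcd x n * ?P" by simp
  then show ?thesis using x by (simp only: nat_mult_dvd_cancel_disj) simp
qed

text \<open>By Pascal's rule, as \<open>p\<close> divides \<open>k choose i\<close> for \<open>0 < i < p ^ a\<close>.\<close>

lemma prime_not_dvd_binomial_pred:
  assumes p: "prime (p :: nat)" and k: "k > 0" "p ^ a dvd k" and i: "i < p ^ a"
  shows "\<not> p dvd ((k - 1) choose i)"
  using i
proof (induction i)
  case 0
  then show ?case using p by (simp add: prime_nat_iff)
next
  case (Suc i)
  have "p dvd (k choose Suc i)"
  proof (rule ccontr)
    assume "\<not> p dvd (k choose Suc i)"
    then have "coprime (p ^ a) (k choose Suc i)" using p by (simp add: prime_imp_coprime)
    moreover have "p ^ a dvd Suc i * (k choose Suc i)"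
      using k(2) dvd_times_binomial dvd_trans by blast
    ultimately have "p ^ a dvd Suc i" using coprime_dvd_mult_left_iff by blast
    then show False using Suc.prems dvd_imp_le by fastforce
  qed
  moreover have "(k choose Suc i) = ((k - 1) choose i) + ((k - 1) choose Suc i)"
    using k(1) by (cases k) auto
  moreover have "\<not> p dvd ((k - 1) choose i)" using Suc by simp
  ultimately show ?case by (metis dvd_add_left_iff)
qed

text \<open>The blocks for a prime \<open>p\<close>: one block of size \<open>k\<close>, which kills all \<open>x < k\<close>; as many blocks as
  possible whose size is the full \<open>p\<close>-part \<open>P\<close> of \<open>k\<close>, which contribute factors prime to \<open>p\<close>; and
  one block for the remainder modulo \<open>P\<close>.\<close>

definition prime_blocks :: "nat \<Rightarrow> nat \<Rightarrow> nat \<Rightarrow> nat" where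
  "prime_blocks k P i = (if i \<le> k then 0 else Suc ((i - k - 1) div P))"

lemma prod_prime_blocks:
  assumes k: "k \<le> n" and P: "P > 0"
  shows "(\<Prod>b\<in>prime_blocks k P ` {1..n}. x choose block_size n (prime_blocks k P) b)
       = (x choose k) * (x choose P) ^ ((n - k) div P) * (x choose ((n - k) mod P))"
proof -
  let ?\<beta> = "prime_blocks k P"
  define q where "q = (n - k) div P"
  define j where "j = (n - k) mod P"
  have n: "n = k + q * P + j" using k by (simp add: q_def j_def)
  have j: "j < P" using P by (simp add: j_def)
  have size0: "block_size n ?\<beta> 0 = k"
  proof -
    have "{i \<in> {1..n}. ?\<beta> i = 0} = {1..k}" using k by (auto simp: prime_blocks_def split: if_splits)
    then show ?thesis by (simp add: block_size_def)
  qed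
  have eq: "{i \<in> {1..n}. ?\<beta> i = Suc b} = {i \<in> {1..n}. k + b * P < i \<and> i \<le> k + Suc b * P}" for b
  proof -
    have "?\<beta> i = Suc b \<longleftrightarrow> k + b * P < i \<and> i \<le> k + Suc b * P" for i
    proof (cases "i \<le> k")
      case False
      then obtain m where m: "i = k + Suc m" by (metis add_Suc_right less_imp_Suc_add not_le)
      have "m div P = b \<longleftrightarrow> b * P \<le> m \<and> m < Suc b * P"
        using P by (metis div_le_mono div_less_iff_less_mult le_less_Suc_eq less_Suc_eq_le
            less_eq_div_iff_mult_less_eq order_refl)
      then show ?thesis by (simp add: m prime_blocks_def Suc_le_eq less_Suc_eq_le)
    qed (auto simp: prime_blocks_def)
    then show ?thesis by simp
  qed
  have size: "block_size n ?\<beta> (Suc b) = (if b < q then P else if b = q then j else 0)" for b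
  proof (cases "b < q")
    case True
    then have "Suc b * P \<le> q * P" by (intro mult_le_mono1) simp
    then have "{i \<in> {1..n}. k + b * P < i \<and> i \<le> k + Suc b * P} = {k + b * P<..k + Suc b * P}"
      using n by auto
    then have "block_size n ?\<beta> (Suc b) = card {k + b * P<..k + Suc b * P}"
      unfolding block_size_def eq by (rule arg_cong)
    then show ?thesis using True by simp
  next
    case b: False
    show ?thesis
    proof (cases "b = q")
      case True
      have "{i \<in> {1..n}. k + b * P < i \<and> i \<le> k + Suc b * P} = {k + q * P<..n}"
        using n j True by auto
      then have "block_size n ?\<beta> (Suc b) = card {k + q * P<..n}"
        unfolding block_size_def eq by (rule arg_cong)
      then show ?thesis using True n by simp
    next
      case False
      with b have "Suc q * P \<le> b * P" by (intro mult_le_mono1) simp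
      then have "{i \<in> {1..n}. k + b * P < i \<and> i \<le> k + Suc b * P} = {}"
        using n j by auto
      then have "block_size n ?\<beta> (Suc b) = card ({} :: nat set)"
        unfolding block_size_def eq by (rule arg_cong)
      then show ?thesis using False b by simp
    qed
  qed
  have sub: "?\<beta> ` {1..n} \<subseteq> {..Suc q}"
  proof
    fix b assume "b \<in> ?\<beta> ` {1..n}"
    then have "block_size n ?\<beta> b \<noteq> 0" by (auto simp: block_size_def)
    then show "b \<in> {..Suc q}" by (cases b) (auto simp: size split: if_splits)
  qed
  have "(\<Prod>b\<in>?\<beta> ` {1..n}. x choose block_size n ?\<beta> b) = (\<Prod>b\<le>Suc q. x choose block_size n ?\<beta> b)"
  proof (rule prod.mono_neutral_left[OF _ sub])
    show "\<forall>b\<in>{..Suc q} - ?\<beta> ` {1..n}. (x choose block_size n ?\<beta> b) = 1"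
    proof
      fix b assume "b \<in> {..Suc q} - ?\<beta> ` {1..n}"
      then have "{i \<in> {1..n}. ?\<beta> i = b} = {}" by auto
      then have "block_size n ?\<beta> b = 0" by (simp only: block_size_def card.empty)
      then show "(x choose block_size n ?\<beta> b) = 1" by simp
    qed
  qed simp
  also have "\<dots> = (x choose k) * (\<Prod>b\<le>q. x choose block_size n ?\<beta> (Suc b))"
    by (subst prod.atMost_Suc_shift) (simp add: size0)
  also have "(\<Prod>b\<le>q. x choose block_size n ?\<beta> (Suc b)) = (\<Prod>b<q. x choose P) * (x choose j)"
    by (simp add: size lessThan_Suc_atMost[symmetric])
  finally show ?thesis by (simp add: q_def j_def mult.assoc)
qed

text \<open>The factor \<open>k choose P\<close> is prime to \<open>p\<close>. With \<open>j\<close> the remainder of \<open>n - k\<close> modulo \<open>P\<close>, and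
  for \<open>j > 0\<close>, absorption gives \<open>j * (k choose j) = k * ((k - 1) choose (j - 1))\<close> with a last factor prime to
  \<open>p\<close>, so the \<open>p\<close>-part of \<open>k choose j\<close> is that of \<open>k\<close> divided by that of \<open>j\<close>. The latter is a
  multiple of the \<open>p\<close>-part of \<open>gcd k n\<close>, since \<open>j \<equiv> n - k\<close> modulo \<open>P\<close>.\<close>

lemma prime_power_dvd_prod_prime_blocks:
  assumes p: "prime (p :: nat)" and k: "1 \<le> k" "k \<le> n" and P: "P = p ^ multiplicity p k"
    and dvd: "p ^ e dvd (k choose P) ^ ((n - k) div P) * (k choose ((n - k) mod P))"
  shows "p ^ e dvd k div gcd k n"
proof -
  define j where "j = (n - k) mod P"
  have Pk: "P dvd k" using P by (simp add: multiplicity_dvd)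
  then obtain u where u: "k = P * u" by blast
  have P0: "P > 0" using p P by (simp add: prime_gt_0_nat)
  have "\<not> p dvd u"
  proof
    assume "p dvd u"
    then have "p * P dvd k" using mult_dvd_mono[of p u P P] u by (simp add: mult.commute)
    then have "p ^ Suc (multiplicity p k) dvd k" by (simp add: P)
    then have "Suc (multiplicity p k) \<le> multiplicity p k" using p k by (intro multiplicity_geI) auto
    then show False by simp
  qed
  have "P * (k choose P) = k * ((k - 1) choose (P - 1))"
    using binomial_absorption[of "P - 1" k] P0 by simp
  then have "(k choose P) = u * ((k - 1) choose (P - 1))" using P0 by (simp add: u mult.assoc)
  moreover have "\<not> p dvd ((k - 1) choose (P - 1))"
    using prime_not_dvd_binomial_pred[OF p, of k "multiplicity p k" "P - 1"] Pk P0 P k(1) by simp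
  ultimately have "\<not> p dvd (k choose P)" using \<open>\<not> p dvd u\<close> p by (simp add: prime_dvd_mult_iff)
  then have "coprime (p ^ e) ((k choose P) ^ ((n - k) div P))" using p by (simp add: prime_imp_coprime)
  then have dvd: "p ^ e dvd (k choose j)" using dvd by (simp add: coprime_dvd_mult_right_iff j_def)
  show ?thesis
  proof (cases "j = 0")
    case True
    then show ?thesis using dvd prime_gt_1_nat[OF p] by auto
  next
    case False
    have "j < P" using P0 by (simp add: j_def)
    have C: "j * (k choose j) = k * ((k - 1) choose (j - 1))"
      using binomial_absorption[of "j - 1" k] False by simp
    have unit: "\<not> p dvd ((k - 1) choose (j - 1))"
      using prime_not_dvd_binomial_pred[OF p, of k "multiplicity p k" "j - 1"] Pk \<open>j < P\<close> P k(1) by simp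
    have pe: "prime_elem p" using p by blast
    have "P \<le> k" using Pk k by (intro dvd_imp_le) auto
    then have C0: "(k choose j) \<noteq> 0" using \<open>j < P\<close> by simp
    have "multiplicity p j + multiplicity p (k choose j) = multiplicity p (j * (k choose j))"
      using False C0 by (simp add: prime_elem_multiplicity_mult_distrib[OF pe])
    also have "\<dots> = multiplicity p k + multiplicity p ((k - 1) choose (j - 1))"
      unfolding C
    proof (rule prime_elem_multiplicity_mult_distrib[OF pe])
      show "((k - 1) choose (j - 1)) \<noteq> 0" using unit by (metis dvd_0_right)
    qed (use k in simp)
    also have "multiplicity p ((k - 1) choose (j - 1)) = 0" using unit by (rule not_dvd_imp_multiplicity_0)
    finally have 1: "multiplicity p j + multiplicity p (k choose j) = multiplicity p k" by simp
    define g where "g = gcd k n"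
    have g: "g dvd k" "g dvd n" "g > 0" using k by (auto simp: g_def)
    have d0: "k div g > 0" using g k by (simp add: div_greater_zero_iff dvd_imp_le)
    have "multiplicity p k = multiplicity p (g * (k div g))" using g by simp
    also have "\<dots> = multiplicity p g + multiplicity p (k div g)"
      using g d0 by (intro prime_elem_multiplicity_mult_distrib[OF pe]) auto
    finally have 2: "multiplicity p k = multiplicity p g + multiplicity p (k div g)" .
    have "multiplicity p g \<le> multiplicity p j"
    proof -
      let ?G = "p ^ multiplicity p g"
      have Gg: "?G dvd g" by (rule multiplicity_dvd)
      have "?G dvd P" unfolding P using 2 by (intro le_imp_power_dvd) simp
      moreover have "n = k + (n - k) div P * P + j" using k by (simp add: j_def)
      moreover have "?G dvd k" "?G dvd n" using Gg g dvd_trans by blast+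
      ultimately have "?G dvd j" by (metis dvd_add_right_iff dvd_mult)
      then show ?thesis using False p by (intro multiplicity_geI) auto
    qed
    then have "multiplicity p (k choose j) \<le> multiplicity p (k div g)" using 1 2 by simp
    moreover have "e \<le> multiplicity p (k choose j)"
      using dvd C0 p by (intro multiplicity_geI) auto
    ultimately show ?thesis unfolding g_def by (intro multiplicity_dvd') simp
  qed
qed

text \<open>The multipliers that make \<open>r\<close> integral are the multiples of the denominator of \<open>r\<close>.\<close>

lemma Ints_multiplier_dvd:
  fixes r :: real
  assumes c0: "c0 > 0" "r * real c0 \<in> \<int>"
  obtains g where "g > 0" "r * real g \<in> \<int>" "\<And>c. r * real c \<in> \<int> \<Longrightarrow> g dvd c"
proof -
  define g where "g = (LEAST c. c > 0 \<and> r * real c \<in> \<int>)"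
  have g: "g > 0 \<and> r * real g \<in> \<int>" unfolding g_def by (rule LeastI[of _ c0]) (use c0 in auto)
  have "g dvd c" if c: "r * real c \<in> \<int>" for c
  proof -
    have "r * real (c mod g) = r * real c - (r * real g) * real (c div g)"
    proof -
      have "real c = real (c div g) * real g + real (c mod g)"
        by (metis div_mult_mod_eq of_nat_add of_nat_mult)
      then have "r * real c = r * (real (c div g) * real g + real (c mod g))" by simp
      then show ?thesis by (simp add: algebra_simps)
    qed
    also have "\<dots> \<in> \<int>" by (rule Ints_diff[OF c Ints_mult]) (use g in auto)
    finally have "r * real (c mod g) \<in> \<int>" .
    then have "\<not> c mod g > 0"
      using not_less_Least[of "c mod g" "\<lambda>c. c > 0 \<and> r * real c \<in> \<int>"] g by (auto simp: g_def[symmetric])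
    then show ?thesis by (simp add: dvd_eq_mod_eq_0)
  qed
  then show thesis using g that by blast
qed

text \<open>Descending induction on \<open>k\<close>: the summands for \<open>x > k\<close> are already known to be integral, those
  for \<open>x < k\<close> vanish for the blocks chosen above, and letting \<open>p\<close> vary determines the denominator
  of \<open>s k\<close> one prime at a time.\<close>

lemma integral_binomial_sums:
  assumes int: "\<And>\<beta>. (\<Sum>x\<in>{1..n}. s x * real (\<Prod>b\<in>\<beta> ` {1..n}. x choose block_size n \<beta> b)) \<in> \<int>"
    and k: "k \<in> {1..n}"
  shows "s k * real (k div gcd k n) \<in> \<int>"
  using k
proof (induction "n - k" arbitrary: k rule: less_induct)
  case less
  then have k: "1 \<le> k" "k \<le> n" by auto
  have key: "s k * real ((k choose P) ^ ((n - k) div P) * (k choose ((n - k) mod P))) \<in> \<int>" if P: "P > 0" for P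
  proof -
    define c where "c x = (\<Prod>b\<in>prime_blocks k P ` {1..n}. x choose block_size n (prime_blocks k P) b)" for x
    have c_eq: "c x = (x choose k) * (x choose P) ^ ((n - k) div P) * (x choose ((n - k) mod P))" for x
      unfolding c_def by (rule prod_prime_blocks[OF k(2) P])
    have low: "s x * real (c x) = 0" if "x \<in> {1..<k}" for x
      using that by (simp add: c_eq)
    have high: "s x * real (c x) \<in> \<int>" if x: "x \<in> {Suc k..n}" for x
    proof -
      have "s x * real (x div gcd x n) \<in> \<int>" using x k by (intro less.hyps) auto
      moreover have "x div gcd x n dvd c x" unfolding c_def using x by (intro dvd_prod_binomial) auto
      then obtain m where m: "c x = (x div gcd x n) * m" by (rule dvdE)
      ultimately have "s x * real (x div gcd x n) * real m \<in> \<int>" using Ints_mult[OF _ Ints_of_nat] by blast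
      then show ?thesis unfolding m of_nat_mult mult.assoc .
    qed
    have "{1..n} = {1..<k} \<union> ({k} \<union> {Suc k..n})" using k by auto
    then have "(\<Sum>x\<in>{1..n}. s x * real (c x)) = (\<Sum>x\<in>{1..<k} \<union> ({k} \<union> {Suc k..n}). s x * real (c x))"
      by (rule arg_cong)
    also have "\<dots> = (\<Sum>x\<in>{1..<k}. s x * real (c x)) + (s k * real (c k) + (\<Sum>x\<in>{Suc k..n}. s x * real (c x)))"
      by (subst sum.union_disjoint; (subst sum.union_disjoint)?) auto
    also have "(\<Sum>x\<in>{1..<k}. s x * real (c x)) = 0" using low by (rule sum.neutral[OF ballI])
    finally have "s k * real (c k) = (\<Sum>x\<in>{1..n}. s x * real (c x)) - (\<Sum>x\<in>{Suc k..n}. s x * real (c x))"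
      by simp
    also have "\<dots> \<in> \<int>" by (rule Ints_diff[OF int[of "prime_blocks k P", folded c_def] Ints_sum[OF high]])
    finally show ?thesis by (simp add: c_eq)
  qed
  \<comment> \<open>The choice \<open>P = 1\<close> shows that \<open>s k\<close> is rational.\<close>
  have "s k * real ((k choose 1) ^ (n - k)) \<in> \<int>" using key[of 1] by simp
  moreover have "(k choose 1) ^ (n - k) > 0" using k by simp
  ultimately obtain g where g: "g > 0" "s k * real g \<in> \<int>" "\<And>c. s k * real c \<in> \<int> \<Longrightarrow> g dvd c"
    using Ints_multiplier_dvd by blast
  have "g dvd k div gcd k n"
  proof (rule multiplicity_le_imp_dvd)
    show "g \<noteq> 0" using g(1) by simp
    fix p :: nat assume p: "prime p"
    define P where "P = p ^ multiplicity p k"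
    have "P > 0" using p by (simp add: P_def prime_gt_0_nat)
    have "p ^ multiplicity p g dvd (k choose P) ^ ((n - k) div P) * (k choose ((n - k) mod P))"
      using g(3)[OF key[OF \<open>P > 0\<close>]] multiplicity_dvd dvd_trans by blast
    then have "p ^ multiplicity p g dvd k div gcd k n"
      by (rule prime_power_dvd_prod_prime_blocks[OF p k P_def])
    moreover have "k div gcd k n > 0" using k by (simp add: div_greater_zero_iff dvd_imp_le)
    ultimately show "multiplicity p g \<le> multiplicity p (k div gcd k n)"
      using p by (intro multiplicity_geI) auto
  qed
  then obtain m where m: "k div gcd k n = g * m" by blast
  have "s k * real g * real m \<in> \<int>" by (rule Ints_mult[OF g(2) Ints_of_nat])
  then show ?case unfolding m of_nat_mult mult.assoc .
qed

section \<open>Row subgroups and descents\<close>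

text \<open>A set \<open>T \<subseteq> {1..<n}\<close> cuts the positions \<open>1, \<dots>, n\<close> into rows, with a cut after each \<open>t \<in> T\<close>.
  Cutting at the complement gives the columns: a ribbon is read from its top right end to its
  bottom left end, stepping down after the positions in \<open>T\<close> and left after all others.\<close>

definition row_index :: "nat set \<Rightarrow> nat \<Rightarrow> nat" where
  "row_index T i = card {t \<in> T. t < i}"

abbreviation row_group :: "nat \<Rightarrow> nat set \<Rightarrow> (nat \<Rightarrow> nat) set" where
  "row_group n T \<equiv> young_subgroup n (row_index T)"

definition descents :: "nat \<Rightarrow> (nat \<Rightarrow> nat) \<Rightarrow> nat set" where
  "descents n w = {i \<in> {1..<n}. w (Suc i) < w i}"

text \<open>By the rearrangement inequality the weight measures how well \<open>f\<close> is sorted; it orders the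
  permutations in such a way that the vectors attached to them below are triangular.\<close>

definition weight :: "nat \<Rightarrow> (nat \<Rightarrow> nat) \<Rightarrow> nat" where
  "weight n f = (\<Sum>i\<in>{1..n}. i * f i)"

lemma row_index_Suc: "row_index T (Suc i) = row_index T i + (if i \<in> T then 1 else 0)"
proof -
  have "{t \<in> T. t < Suc i} = {t \<in> T. t < i} \<union> (if i \<in> T then {i} else {})" by (auto simp: less_Suc_eq)
  then show ?thesis by (simp add: row_index_def)
qed

lemma row_index_mono: "i \<le> j \<Longrightarrow> row_index T i \<le> row_index T j"
  unfolding row_index_def by (rule card_mono) auto

lemma row_index_less: "t \<in> T \<Longrightarrow> i \<le> t \<Longrightarrow> t < j \<Longrightarrow> row_index T i < row_index T j"
  using row_index_mono[of i t T] row_index_mono[of "Suc t" j T] row_index_Suc[of T t] by simp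

lemma row_index_mono_set: "finite S \<Longrightarrow> T \<subseteq> S \<Longrightarrow> row_index S i = row_index S j \<Longrightarrow> row_index T i = row_index T j"
proof (induction i j rule: linorder_wlog)
  case (le i j)
  show ?case
  proof (rule ccontr)
    assume ne: "row_index T i \<noteq> row_index T j"
    have "\<exists>t\<in>T. i \<le> t \<and> t < j"
    proof (rule ccontr)
      assume "\<not> ?thesis"
      then have "t < i \<longleftrightarrow> t < j" if "t \<in> T" for t
        using le(1) that by (meson less_le_trans not_le)
      then have "{t \<in> T. t < i} = {t \<in> T. t < j}" by blast
      then show False using ne unfolding row_index_def by metis
    qed
    then obtain t where "t \<in> T" "i \<le> t" "t < j" by blast
    then show False using row_index_less[of t S i j] le by auto
  qed
qed auto

lemma young_id: "id \<in> young_subgroup n \<beta>"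
  by (simp add: young_subgroup_def permutes_id)

lemma young_permutes: "h \<in> young_subgroup n \<beta> \<Longrightarrow> h permutes {1..n}"
  by (simp add: young_subgroup_def)

lemma young_comp: "g \<in> young_subgroup n \<beta> \<Longrightarrow> h \<in> young_subgroup n \<beta> \<Longrightarrow> g \<circ> h \<in> young_subgroup n \<beta>"
  using subgroup.m_closed[OF subgroup_young_subgroup[of n \<beta>], of g h] by (simp add: sym_group_mult)

lemma young_inv: "g \<in> young_subgroup n \<beta> \<Longrightarrow> inv' g \<in> young_subgroup n \<beta>"
  using subgroup.m_inv_closed[OF subgroup_young_subgroup[of n \<beta>], of g] young_permutes[of g n \<beta>]
  by (simp add: sym_group_carrier)

lemma young_mono:
  assumes "\<And>i j. i \<in> {1..n} \<Longrightarrow> j \<in> {1..n} \<Longrightarrow> \<beta> i = \<beta> j \<Longrightarrow> \<gamma> i = \<gamma> j"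
  shows "young_subgroup n \<beta> \<subseteq> young_subgroup n \<gamma>"
proof
  fix h assume h: "h \<in> young_subgroup n \<beta>"
  note p = young_permutes[OF h]
  have "\<gamma> (h i) = \<gamma> i" if "i \<in> {1..n}" for i
    by (rule assms) (use h that permutes_in_image[OF p] in \<open>auto simp: young_subgroup_def simp del: atLeastAtMost_iff\<close>)
  then show "h \<in> young_subgroup n \<gamma>" using p by (simp add: young_subgroup_def)
qed

lemma row_group_antimono: "finite S \<Longrightarrow> T \<subseteq> S \<Longrightarrow> row_group n S \<subseteq> row_group n T"
  by (rule young_mono) (rule row_index_mono_set)

lemma adjacent_transpose_in_row_group:
  assumes "j \<in> {1..<n}" "j \<notin> T"
  shows "transpose j (Suc j) \<in> row_group n T"
proof -
  have "transpose j (Suc j) permutes {1..n}" using assms(1) by (intro permutes_swap_id) auto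
  moreover have "row_index T (transpose j (Suc j) i) = row_index T i" for i
    using row_index_Suc[of T j] assms(2) by (auto simp: transpose_def)
  ultimately show ?thesis by (simp add: young_subgroup_def)
qed

text \<open>A cell of a ribbon is determined by its row and its column.\<close>

lemma row_group_Int_column_group:
  assumes y: "y \<in> row_group n T" "y \<in> row_group n ({1..<n} - T)"
  shows "y = id"
proof -
  note p = young_permutes[OF y(1)]
  have no: False if "i \<in> {1..n}" "j \<in> {1..n}" "i < j" "row_index T i = row_index T j"
      "row_index ({1..<n} - T) i = row_index ({1..<n} - T) j" for i j
  proof (cases "i \<in> T")
    case True
    then show False using row_index_less[of i T i j] that by simp
  next
    case False
    then have "i \<in> {1..<n} - T" using that by auto
    then show False using row_index_less[of i "{1..<n} - T" i j] that by simp
  qed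
  have "y i = i" for i
  proof (cases "i \<in> {1..n}")
    case True
    then have "y i \<in> {1..n}" using permutes_in_image[OF p] by blast
    then show ?thesis
      using no[of i "y i"] no[of "y i" i] True y by (cases i "y i" rule: linorder_cases) (auto simp: young_subgroup_def)
  qed (rule permutes_not_in[OF p])
  then show ?thesis by auto
qed

text \<open>The difference is \<open>f i - f (Suc i)\<close>.\<close>

lemma weight_swap_less:
  assumes i: "i \<in> {1..<n}" and f: "f (Suc i) < f i"
  shows "weight n f < weight n (f \<circ> transpose i (Suc i))"
proof -
  let ?R = "{1..n} - {i, Suc i}"
  have split: "weight n g = i * g i + (Suc i * g (Suc i) + (\<Sum>k\<in>?R. k * g k))" for g
  proof -
    have "weight n g = i * g i + (\<Sum>k\<in>{1..n} - {i}. k * g k)"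
      unfolding weight_def using i by (intro sum.remove) auto
    also have "(\<Sum>k\<in>{1..n} - {i}. k * g k) = Suc i * g (Suc i) + (\<Sum>k\<in>{1..n} - {i} - {Suc i}. k * g k)"
      using i by (intro sum.remove) auto
    also have "{1..n} - {i} - {Suc i} = ?R" by auto
    finally show ?thesis .
  qed
  have "(\<Sum>k\<in>?R. k * (f \<circ> transpose i (Suc i)) k) = (\<Sum>k\<in>?R. k * f k)"
    by (intro sum.cong) (auto simp: transpose_def)
  then show ?thesis using f unfolding split[of f] split[of "f \<circ> _"] by simp
qed

lemma maximal_weight_sorted:
  assumes "y \<in> row_group n T" "\<And>z. z \<in> row_group n T \<Longrightarrow> weight n (f \<circ> z) \<le> weight n (f \<circ> y)"
    and "i \<in> {1..<n}" "i \<notin> T"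
  shows "(f \<circ> y) i \<le> (f \<circ> y) (Suc i)"
proof (rule ccontr)
  assume "\<not> ?thesis"
  then have "weight n (f \<circ> y) < weight n (f \<circ> y \<circ> transpose i (Suc i))"
    using assms(3) by (intro weight_swap_less) auto
  moreover have "y \<circ> transpose i (Suc i) \<in> row_group n T"
    using assms by (intro young_comp adjacent_transpose_in_row_group)
  ultimately show False using assms(2)[of "y \<circ> transpose i (Suc i)"] by (simp add: o_assoc)
qed

lemma maximal_weight_exists:
  obtains y where "y \<in> row_group n T" "\<And>z. z \<in> row_group n T \<Longrightarrow> weight n (f \<circ> z) \<le> weight n (f \<circ> y)"
proof -
  let ?W = "(\<lambda>z. weight n (f \<circ> z)) ` row_group n T"
  have fin: "finite ?W" by (intro finite_imageI finite_young_subgroup)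
  have "?W \<noteq> {}" using young_id by blast
  then have "Max ?W \<in> ?W" using fin by (intro Max_in)
  then obtain y where "y \<in> row_group n T" "Max ?W = weight n (f \<circ> y)" by blast
  then show thesis using that fin Max_ge by (metis image_eqI)
qed

lemma increasing_on_rows:
  assumes w: "w permutes {1..n}" "descents n w \<subseteq> T"
    and ij: "i < j" "1 \<le> i" "j \<le> n" "row_index T i = row_index T j"
  shows "w i < w j"
  using ij
proof (induction j)
  case (Suc j)
  have "j \<notin> T" using row_index_less[of j T i "Suc j"] Suc.prems by fastforce
  then have "j \<notin> descents n w" using w(2) by blast
  then have "\<not> w (Suc j) < w j" using Suc.prems by (simp add: descents_def)
  moreover have "w (Suc j) \<noteq> w j" using permutes_inj[OF w(1)] by (metis injD n_not_Suc_n)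
  ultimately have "w j < w (Suc j)" by simp
  moreover have "i = j \<or> w i < w j"
    using Suc \<open>j \<notin> T\<close> by (auto simp: row_index_Suc less_Suc_eq)
  ultimately show ?case by auto
qed simp

text \<open>At the first position \<open>i\<close> moved by \<open>y\<close>, the entry \<open>w (y i)\<close> exceeds \<open>w i\<close>, which is moved to
  a later position of the same row. So \<open>w \<circ> y\<close> does not increase along this row.\<close>

lemma sorted_coset_representative_unique:
  assumes w: "w permutes {1..n}" "descents n w \<subseteq> T"
    and y: "y \<in> row_group n T" "descents n (w \<circ> y) \<subseteq> T"
  shows "y = id"
proof (rule ccontr)
  assume "y \<noteq> id"
  note p = young_permutes[OF y(1)]
  have wy: "w \<circ> y permutes {1..n}" by (rule permutes_compose[OF p w(1)])
  define i where "i = (LEAST i. y i \<noteq> i)"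
  have "\<exists>i. y i \<noteq> i" using \<open>y \<noteq> id\<close> by auto
  then have i: "y i \<noteq> i" unfolding i_def by (rule LeastI_ex)
  have less: "y k = k" if "k < i" for k using not_less_Least that unfolding i_def by blast
  have iI: "i \<in> {1..n}" using permutes_not_in[OF p] i by blast
  obtain j where j: "y j = i" using permutes_surj[OF p] by (metis surjD)
  have "i < y i" using less i permutes_inj[OF p] by (metis injD nat_neq_iff)
  have "i < j" using less i j by (metis nat_neq_iff)
  have jI: "j \<in> {1..n}" using permutes_not_in[OF p] j i by metis
  have yi: "y i \<in> {1..n}" using permutes_in_image[OF p] iI by blast
  have rij: "row_index T i = row_index T j" using y(1) jI j by (auto simp: young_subgroup_def)
  have ry: "row_index T (y i) = row_index T i" using y(1) iI by (auto simp: young_subgroup_def)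
  have "(w \<circ> y) i < (w \<circ> y) j"
    using increasing_on_rows[OF wy y(2) \<open>i < j\<close> _ _ rij] iI jI by auto
  moreover have "w i < w (y i)"
    using increasing_on_rows[OF w \<open>i < y i\<close> _ _ ry[symmetric]] iI yi by auto
  ultimately show False using j by simp
qed

text \<open>An element of largest weight in a coset has no descents within rows, because swapping the two
  entries of a descent would increase the weight; and only one element of a coset is sorted.\<close>

lemma weight_less_sorted:
  assumes w: "w permutes {1..n}" "descents n w \<subseteq> T" and y: "y \<in> row_group n T" "y \<noteq> id"
  shows "weight n (w \<circ> y) < weight n w"
proof -
  have max_id: "z = id" if z: "z \<in> row_group n T" "\<And>x. x \<in> row_group n T \<Longrightarrow> weight n (w \<circ> x) \<le> weight n (w \<circ> z)" for z
  proof (rule sorted_coset_representative_unique[OF w z(1)])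
    show "descents n (w \<circ> z) \<subseteq> T"
    proof
      fix i assume i: "i \<in> descents n (w \<circ> z)"
      show "i \<in> T"
      proof (rule ccontr)
        assume "i \<notin> T"
        then have "(w \<circ> z) i \<le> (w \<circ> z) (Suc i)"
          using i by (intro maximal_weight_sorted[OF z]) (auto simp: descents_def)
        then show False using i by (simp add: descents_def)
      qed
    qed
  qed
  obtain z where z: "z \<in> row_group n T" "\<And>x. x \<in> row_group n T \<Longrightarrow> weight n (w \<circ> x) \<le> weight n (w \<circ> z)"
    using maximal_weight_exists by blast
  have "z = id" using max_id z by blast
  then have le: "weight n (w \<circ> x) \<le> weight n w" if "x \<in> row_group n T" for x using z(2)[OF that] by simp
  have "weight n (w \<circ> y) \<noteq> weight n w"
  proof
    assume "weight n (w \<circ> y) = weight n w"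
    then have "y = id" using le by (intro max_id y(1)) simp
    then show False using y(2) by simp
  qed
  then show ?thesis using le[OF y(1)] by simp
qed

text \<open>Reversing the values exchanges descents and ascents, hence the roles of rows and columns.\<close>

definition reversal :: "nat \<Rightarrow> nat \<Rightarrow> nat" where
  "reversal n i = (if i \<in> {1..n} then n + 1 - i else i)"

lemma reversal_permutes: "reversal n permutes {1..n}"
proof (rule bij_imp_permutes)
  show "bij_betw (reversal n) {1..n} {1..n}"
    by (rule bij_betw_byWitness[where f' = "reversal n"]) (auto simp: reversal_def)
qed (auto simp: reversal_def)

lemma weight_reversal:
  assumes "w permutes {1..n}"
  shows "weight n (reversal n \<circ> w) + weight n w = (\<Sum>i\<in>{1..n}. i * (n + 1))"
  unfolding weight_def sum.distrib[symmetric]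
proof (rule sum.cong[OF refl])
  fix i assume "i \<in> {1..n}"
  then have "w i \<in> {1..n}" using permutes_in_image[OF assms] by blast
  then show "i * (reversal n \<circ> w) i + i * w i = i * (n + 1)"
    by (simp add: reversal_def flip: distrib_left)
qed

lemma descents_reversal:
  assumes "w permutes {1..n}"
  shows "descents n (reversal n \<circ> w) = {1..<n} - descents n w"
proof -
  have "reversal n (w (Suc i)) < reversal n (w i) \<longleftrightarrow> \<not> w (Suc i) < w i" if "i \<in> {1..<n}" for i
  proof -
    have "i \<in> {1..n}" "Suc i \<in> {1..n}" using that by auto
    then have "w i \<in> {1..n}" "w (Suc i) \<in> {1..n}" using permutes_in_image[OF assms] by blast+
    moreover have "w (Suc i) \<noteq> w i" using permutes_inj[OF assms] by (metis injD n_not_Suc_n)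
    ultimately show ?thesis by (auto simp: reversal_def)
  qed
  then show ?thesis by (auto simp: descents_def)
qed

text \<open>Along its columns \<open>w\<close> decreases, so it has the smallest weight there; this is the statement
  on sorted words, applied to the reversed values.\<close>

lemma weight_less_column:
  assumes w: "w permutes {1..n}" and c: "c \<in> row_group n ({1..<n} - descents n w)" "c \<noteq> id"
  shows "weight n w < weight n (w \<circ> c)"
proof -
  have rw: "reversal n \<circ> w permutes {1..n}" by (rule permutes_compose[OF w reversal_permutes])
  have wc: "w \<circ> c permutes {1..n}" by (rule permutes_compose[OF young_permutes[OF c(1)] w])
  have "weight n (reversal n \<circ> w \<circ> c) < weight n (reversal n \<circ> w)"
    by (rule weight_less_sorted[OF rw _ c]) (simp add: descents_reversal[OF w])
  then show ?thesis
    using weight_reversal[OF w] weight_reversal[OF wc] by (simp add: o_assoc)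
qed

lemma sorted_coset_representative:
  assumes w: "w permutes {1..n}"
  obtains y where "y \<in> row_group n T" "descents n (w \<circ> y) \<subseteq> T"
proof -
  obtain y where y: "y \<in> row_group n T" "\<And>z. z \<in> row_group n T \<Longrightarrow> weight n (w \<circ> z) \<le> weight n (w \<circ> y)"
    using maximal_weight_exists by blast
  have "descents n (w \<circ> y) \<subseteq> T"
  proof
    fix i assume i: "i \<in> descents n (w \<circ> y)"
    show "i \<in> T"
    proof (rule ccontr)
      assume "i \<notin> T"
      then have "(w \<circ> y) i \<le> (w \<circ> y) (Suc i)"
        using i by (intro maximal_weight_sorted[OF y]) (auto simp: descents_def)
      then show False using i by (simp add: descents_def)
    qed
  qed
  then show thesis using that y(1) by blast
qed

section \<open>A decomposition of the regular representation by descents\<close>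

abbreviation perms :: "nat \<Rightarrow> (nat \<Rightarrow> nat) set" where
  "perms n \<equiv> {w. w permutes {1..n}}"

text \<open>Functions on permutations form the regular representation. The group acts on it on the left,
  and right multiplications commute with this action.\<close>

definition right_op ::
    "(nat \<Rightarrow> nat) set \<Rightarrow> ((nat \<Rightarrow> nat) \<Rightarrow> int) \<Rightarrow> ((nat \<Rightarrow> nat) \<Rightarrow> complex) \<Rightarrow> (nat \<Rightarrow> nat) \<Rightarrow> complex" where
  "right_op H \<epsilon> g = (\<lambda>u. \<Sum>h\<in>H. of_int (\<epsilon> h) * g (u \<circ> h))"

abbreviation row_sum :: "nat \<Rightarrow> nat set \<Rightarrow> ((nat \<Rightarrow> nat) \<Rightarrow> complex) \<Rightarrow> (nat \<Rightarrow> nat) \<Rightarrow> complex" where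
  "row_sum n T \<equiv> right_op (row_group n T) (\<lambda>_. 1)"

abbreviation column_antisum :: "nat \<Rightarrow> nat set \<Rightarrow> ((nat \<Rightarrow> nat) \<Rightarrow> complex) \<Rightarrow> (nat \<Rightarrow> nat) \<Rightarrow> complex" where
  "column_antisum n T \<equiv> right_op (row_group n ({1..<n} - T)) sign"

text \<open>The right multiple of the regular representation by a column antisymmetrizer followed by a
  row symmetrizer, as in the construction of Specht modules by Young symmetrizers.\<close>

definition ribbon_module :: "nat \<Rightarrow> nat set \<Rightarrow> ((nat \<Rightarrow> nat) \<Rightarrow> complex) set" where
  "ribbon_module n T = (\<lambda>g. row_sum n T (column_antisum n T g)) ` supported_on (perms n)"

text \<open>The copy of a polytabloid: the signed sum of the row cosets of \<open>w \<circ> c\<close> over the column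
  permutations \<open>c\<close>.\<close>

definition ribbon_vector :: "nat \<Rightarrow> nat set \<Rightarrow> (nat \<Rightarrow> nat) \<Rightarrow> (nat \<Rightarrow> nat) \<Rightarrow> complex" where
  "ribbon_vector n T w = row_sum n T (column_antisum n T (point_mass w))"

text \<open>The permutation module on the cosets of \<open>row_group n S\<close>.\<close>

definition row_invariant :: "nat \<Rightarrow> nat set \<Rightarrow> ((nat \<Rightarrow> nat) \<Rightarrow> complex) set" where
  "row_invariant n S = {g \<in> supported_on (perms n). \<forall>u. \<forall>y\<in>row_group n S. g (u \<circ> y) = g u}"

lemma linear_map_right_op: "linear_map (right_op H \<epsilon>)"
  by (auto simp: linear_map_def right_op_def fun_eq_iff distrib_left sum.distrib sum_distrib_left mult.left_commute)

lemma linear_map_compose: "linear_map f \<Longrightarrow> linear_map g \<Longrightarrow> linear_map (\<lambda>v. f (g v))"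
  by (simp add: linear_map_def)

lemma comp_permutes_iff:
  assumes "h permutes A"
  shows "u \<circ> h permutes A \<longleftrightarrow> u permutes A"
proof
  assume "u \<circ> h permutes A"
  then have "(u \<circ> h) \<circ> inv' h permutes A" by (rule permutes_compose[OF permutes_inv[OF assms]])
  then show "u permutes A" using permutes_inv_o(1)[OF assms] by (simp add: o_assoc[symmetric])
qed (rule permutes_compose[OF assms])

lemma right_op_supported:
  assumes "g \<in> supported_on (perms n)"
  shows "right_op (young_subgroup n \<beta>) \<epsilon> g \<in> supported_on (perms n)"
  using assms comp_permutes_iff[OF young_permutes]
  by (auto simp: supported_on_def right_op_def intro!: sum.neutral)

lemma young_right_translate:
  assumes "y \<in> young_subgroup n \<beta>"
  shows "(\<Sum>h\<in>young_subgroup n \<beta>. f (y \<circ> h)) = (\<Sum>h\<in>young_subgroup n \<beta>. f h)"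
    and "(\<Sum>h\<in>young_subgroup n \<beta>. f (h \<circ> y)) = (\<Sum>h\<in>young_subgroup n \<beta>. f h)"
proof -
  note p = young_permutes[OF assms]
  have i: "inv' y \<circ> (y \<circ> h) = h" "y \<circ> (inv' y \<circ> h) = h" "(h \<circ> y) \<circ> inv' y = h" "(h \<circ> inv' y) \<circ> y = h" for h
    using permutes_inv_o[OF p] by (simp_all add: o_assoc) (simp_all add: o_assoc[symmetric])
  show "(\<Sum>h\<in>young_subgroup n \<beta>. f (y \<circ> h)) = (\<Sum>h\<in>young_subgroup n \<beta>. f h)"
    by (rule sum.reindex_bij_witness[of _ "\<lambda>h. inv' y \<circ> h" "\<lambda>h. y \<circ> h"])
       (use i young_comp young_inv assms in auto)
  show "(\<Sum>h\<in>young_subgroup n \<beta>. f (h \<circ> y)) = (\<Sum>h\<in>young_subgroup n \<beta>. f h)"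
    by (rule sum.reindex_bij_witness[of _ "\<lambda>h. h \<circ> inv' y" "\<lambda>h. h \<circ> y"])
       (use i young_comp young_inv assms in auto)
qed

lemma row_sum_invariant:
  assumes "y \<in> row_group n T"
  shows "row_sum n T g (u \<circ> y) = row_sum n T g u"
  using young_right_translate(1)[OF assms, of "\<lambda>h. g (u \<circ> h)"] by (simp add: right_op_def o_assoc)

lemma sign_young: "g \<in> young_subgroup n \<beta> \<Longrightarrow> h \<in> young_subgroup n \<gamma> \<Longrightarrow> sign (g \<circ> h) = sign g * sign h"
  using young_permutes permutation_permutes by (intro sign_compose) blast+

text \<open>Translating the sum by the odd \<open>s\<close> changes its sign.\<close>

lemma column_antisum_eq_0:
  assumes s: "s \<in> row_group n ({1..<n} - T)" "sign s = -1" and rinv: "\<And>u. g (u \<circ> s) = g u"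
  shows "column_antisum n T g = 0"
proof
  fix u
  let ?C = "row_group n ({1..<n} - T)"
  have "column_antisum n T g u = (\<Sum>h\<in>?C. of_int (sign (h \<circ> s)) * g (u \<circ> (h \<circ> s)))"
    unfolding right_op_def by (rule young_right_translate(2)[OF s(1), symmetric])
  also have "\<dots> = (\<Sum>h\<in>?C. - (of_int (sign h) * g (u \<circ> h)))"
    using s sign_young rinv by (intro sum.cong refl) (simp add: o_assoc)
  also have "\<dots> = - column_antisum n T g u" by (simp add: right_op_def sum_negf)
  finally show "column_antisum n T g u = 0 u" by (simp add: eq_neg_iff_add_eq_0)
qed

lemma right_op_adjoint:
  assumes \<epsilon>: "\<And>h. h \<in> young_subgroup n \<beta> \<Longrightarrow> \<epsilon> (inv' h) = \<epsilon> h"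
  shows "(\<Sum>u\<in>perms n. right_op (young_subgroup n \<beta>) \<epsilon> f u * cnj (g u))
       = (\<Sum>u\<in>perms n. f u * cnj (right_op (young_subgroup n \<beta>) \<epsilon> g u))"
proof -
  let ?H = "young_subgroup n \<beta>"
  have "(\<Sum>u\<in>perms n. right_op ?H \<epsilon> f u * cnj (g u))
      = (\<Sum>h\<in>?H. \<Sum>u\<in>perms n. of_int (\<epsilon> h) * (f (u \<circ> h) * cnj (g u)))"
    by (subst sum.swap) (simp add: right_op_def sum_distrib_right mult.assoc)
  also have "\<dots> = (\<Sum>h\<in>?H. \<Sum>u\<in>perms n. of_int (\<epsilon> h) * (f u * cnj (g (u \<circ> inv' h))))"
  proof (rule sum.cong[OF refl])
    fix h assume h: "h \<in> ?H"
    note p = young_permutes[OF h]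
    show "(\<Sum>u\<in>perms n. of_int (\<epsilon> h) * (f (u \<circ> h) * cnj (g u)))
        = (\<Sum>u\<in>perms n. of_int (\<epsilon> h) * (f u * cnj (g (u \<circ> inv' h))))"
      by (rule sum.reindex_bij_witness[of _ "\<lambda>u. u \<circ> inv' h" "\<lambda>u. u \<circ> h"])
         (use permutes_inv_o[OF p] permutes_compose[OF p] permutes_compose[OF permutes_inv[OF p]]
          in \<open>auto simp: o_assoc[symmetric]\<close>)
  qed
  also have "\<dots> = (\<Sum>h\<in>?H. \<Sum>u\<in>perms n. of_int (\<epsilon> h) * (f u * cnj (g (u \<circ> h))))"
    by (rule sum.reindex_bij_witness[of _ inv' inv'])
       (use young_inv \<epsilon> in \<open>auto simp: permutes_inv_inv[OF young_permutes]\<close>)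
  also have "\<dots> = (\<Sum>u\<in>perms n. f u * cnj (right_op ?H \<epsilon> g u))"
    by (subst sum.swap) (simp add: right_op_def sum_distrib_left mult.left_commute)
  finally show ?thesis .
qed

lemma row_sum_row_sum:
  "row_sum n T (row_sum n T g) = (\<lambda>u. of_nat (card (row_group n T)) * row_sum n T g u)"
proof
  fix u
  have "row_sum n T (row_sum n T g) u = (\<Sum>h\<in>row_group n T. row_sum n T g (u \<circ> h))"
    by (simp add: right_op_def)
  also have "\<dots> = (\<Sum>h\<in>row_group n T. row_sum n T g u)"
    by (intro sum.cong refl row_sum_invariant)
  finally show "row_sum n T (row_sum n T g) u = of_nat (card (row_group n T)) * row_sum n T g u" by simp
qed

text \<open>Row and column operators are self-adjoint, so the squared norm of an element
  \<open>g = row_sum (column_antisum x)\<close> is a multiple of \<open>\<langle>column_antisum g, x\<rangle>\<close>.\<close>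

lemma ribbon_module_antisum_injective:
  assumes g: "g \<in> ribbon_module n T" and 0: "column_antisum n T g = 0"
  shows "g = 0"
proof -
  obtain x where x: "x \<in> supported_on (perms n)" "g = row_sum n T (column_antisum n T x)"
    using g by (auto simp: ribbon_module_def)
  define y where "y = column_antisum n T x"
  have gs: "g \<in> supported_on (perms n)" unfolding x(2) by (intro right_op_supported x(1))
  have sgn: "sign (inv' h) = sign h" if "h \<in> young_subgroup n \<beta>" for h and \<beta> :: "nat \<Rightarrow> nat"
    using young_permutes[OF that] permutation_permutes by (intro sign_inverse) blast
  have "(\<Sum>u\<in>perms n. g u * cnj (g u)) = (\<Sum>u\<in>perms n. row_sum n T y u * cnj (g u))"
    by (simp add: x(2) y_def)
  also have "\<dots> = (\<Sum>u\<in>perms n. y u * cnj (row_sum n T g u))" by (rule right_op_adjoint) simp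
  also have "row_sum n T g = (\<lambda>u. of_nat (card (row_group n T)) * g u)"
    unfolding x(2) by (rule row_sum_row_sum)
  also have "(\<Sum>u\<in>perms n. y u * cnj (of_nat (card (row_group n T)) * g u))
      = of_nat (card (row_group n T)) * (\<Sum>u\<in>perms n. y u * cnj (g u))"
    by (simp add: sum_distrib_left mult.left_commute)
  also have "(\<Sum>u\<in>perms n. y u * cnj (g u)) = (\<Sum>u\<in>perms n. x u * cnj (column_antisum n T g u))"
    unfolding y_def by (rule right_op_adjoint) (rule sgn)
  also have "\<dots> = 0" unfolding 0 by simp
  finally have "(\<Sum>u\<in>perms n. of_real ((cmod (g u))\<^sup>2)) = (0 :: complex)"
    by (simp only: complex_norm_square mult_zero_right)
  then have "(\<Sum>u\<in>perms n. (cmod (g u))\<^sup>2) = 0" by (metis of_real_eq_0_iff of_real_sum)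
  then have "g u = 0" if "u \<in> perms n" for u
    using that by (subst (asm) sum_nonneg_eq_0_iff) (auto simp: finite_permutations)
  then show ?thesis using gs by (auto simp: supported_on_def fun_eq_iff)
qed

lemma ribbon_module_subset: "ribbon_module n T \<subseteq> row_invariant n T"
  unfolding ribbon_module_def row_invariant_def
  using right_op_supported row_sum_invariant by (auto simp: image_iff)

lemma row_invariant_mono:
  assumes "finite S" "T \<subseteq> S"
  shows "row_invariant n T \<subseteq> row_invariant n S"
  using row_group_antimono[OF assms] unfolding row_invariant_def by blast

text \<open>The operator \<open>column_antisum n T\<close> kills every \<open>ribbon_module n U\<close> with
  \<open>T \<not>\<subseteq> U\<close>, so in a vanishing sum the components vanish one by one, starting with the
  largest sets.\<close>

lemma ribbon_modules_independent:
  assumes g: "\<And>T. T \<subseteq> {1..<n} \<Longrightarrow> g T \<in> ribbon_module n T" and sum: "(\<Sum>T\<in>Pow {1..<n}. g T) = 0"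
    and T: "T \<subseteq> {1..<n}"
  shows "g T = 0"
  using T
proof (induction "n - card T" arbitrary: T rule: less_induct)
  case less
  have "column_antisum n T (g U) = 0" if U: "U \<in> Pow {1..<n} - {T}" for U
  proof (cases "T \<subseteq> U")
    case True
    then have "T \<subset> U" using U by auto
    then have "card T < card U" using U by (intro psubset_card_mono) (auto intro: finite_subset)
    moreover have "card U \<le> n - 1" using card_mono[of "{1..<n}" U] U by auto
    ultimately have "g U = 0" using U by (intro less.hyps) auto
    then show ?thesis using linear_map_0[OF linear_map_right_op] by simp
  next
    case False
    then obtain j where j: "j \<in> T" "j \<notin> U" by blast
    then have jn: "j \<in> {1..<n}" using less.prems by blast
    show ?thesis
    proof (rule column_antisum_eq_0)
      show "transpose j (Suc j) \<in> row_group n ({1..<n} - T)"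
        using j jn by (intro adjacent_transpose_in_row_group) auto
      show "sign (transpose j (Suc j)) = -1" by (simp add: sign_swap_id)
      have "g U \<in> row_invariant n U" using g U ribbon_module_subset by blast
      then show "g U (u \<circ> transpose j (Suc j)) = g U u" for u
        using adjacent_transpose_in_row_group[OF jn j(2)] by (auto simp: row_invariant_def)
    qed
  qed
  then have "(\<Sum>U\<in>Pow {1..<n} - {T}. column_antisum n T (g U)) = 0" by (rule sum.neutral[OF ballI])
  moreover have "column_antisum n T (\<Sum>U\<in>Pow {1..<n}. g U)
      = column_antisum n T (g T) + (\<Sum>U\<in>Pow {1..<n} - {T}. column_antisum n T (g U))"
    unfolding linear_map_sum[OF linear_map_right_op] using less.prems by (intro sum.remove) auto
  ultimately have "column_antisum n T (g T) = 0"
    using sum linear_map_0[OF linear_map_right_op] by simp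
  then show ?case using g[OF less.prems] by (rule ribbon_module_antisum_injective[rotated])
qed

definition left_op :: "(nat \<Rightarrow> nat) \<Rightarrow> ((nat \<Rightarrow> nat) \<Rightarrow> complex) \<Rightarrow> (nat \<Rightarrow> nat) \<Rightarrow> complex" where
  "left_op \<pi> g = (\<lambda>u. g (inv' \<pi> \<circ> u))"

lemma linear_map_left_op: "linear_map (left_op \<pi>)"
  by (auto simp: linear_map_def left_op_def)

lemma left_op_supported:
  assumes "\<pi> permutes {1..n}" "g \<in> supported_on (perms n)"
  shows "left_op \<pi> g \<in> supported_on (perms n)"
proof -
  have "u permutes {1..n}" if "inv' \<pi> \<circ> u permutes {1..n}" for u
  proof -
    have "\<pi> \<circ> (inv' \<pi> \<circ> u) permutes {1..n}" by (rule permutes_compose[OF that assms(1)])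
    then show ?thesis using permutes_inv_o(1)[OF assms(1)] by (simp add: o_assoc)
  qed
  then show ?thesis using assms(2) by (auto simp: supported_on_def left_op_def)
qed

lemma right_op_left_op: "right_op H \<epsilon> (left_op \<pi> g) = left_op \<pi> (right_op H \<epsilon> g)"
  by (simp add: right_op_def left_op_def o_assoc)

lemma ribbon_module_left_op:
  assumes "\<pi> permutes {1..n}" "g \<in> ribbon_module n T"
  shows "left_op \<pi> g \<in> ribbon_module n T"
proof -
  obtain x where x: "x \<in> supported_on (perms n)" "g = row_sum n T (column_antisum n T x)"
    using assms(2) by (auto simp: ribbon_module_def)
  have "left_op \<pi> g = row_sum n T (column_antisum n T (left_op \<pi> x))"
    by (simp add: x(2) right_op_left_op)
  then show ?thesis using left_op_supported[OF assms(1) x(1)] by (auto simp: ribbon_module_def)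
qed

lemma ribbon_module_eq_span: "ribbon_module n T = fun_space.span (ribbon_vector n T ` perms n)"
proof -
  have "finite (perms n)" by (rule finite_permutations) simp
  then have "ribbon_module n T
      = (\<lambda>g. row_sum n T (column_antisum n T g)) ` fun_space.span (point_mass ` perms n)"
    by (simp add: ribbon_module_def point_mass_basis(2))
  also have "\<dots> = fun_space.span ((\<lambda>g. row_sum n T (column_antisum n T g)) ` point_mass ` perms n)"
    by (intro linear_map_image_span linear_map_compose[OF linear_map_right_op linear_map_right_op])
  finally show ?thesis by (simp add: image_image ribbon_vector_def)
qed

lemma finite_perms: "finite (perms n)"
  by (rule finite_permutations) simp

lemma finite_dim_ribbon_module: "finite_dim (ribbon_module n T)"
  unfolding ribbon_module_eq_span by (intro finite_dim_span finite_imageI finite_perms)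

lemma fun_rep_ribbon_module: "fun_rep (sym_group n) (ribbon_module n T) left_op"
  unfolding fun_rep_def
proof (intro conjI ballI)
  show "finite_dim (ribbon_module n T)" by (rule finite_dim_ribbon_module)
  show "linear_map (left_op \<pi>)" for \<pi> by (rule linear_map_left_op)
  show "left_op \<pi> v \<in> ribbon_module n T" if "\<pi> \<in> carrier (sym_group n)" "v \<in> ribbon_module n T" for \<pi> v
    using that ribbon_module_left_op by (simp add: sym_group_carrier)
  show "left_op \<one>\<^bsub>sym_group n\<^esub> v = v" for v by (simp add: left_op_def sym_group_one)
  show "left_op (\<pi> \<otimes>\<^bsub>sym_group n\<^esub> \<sigma>) v = left_op \<pi> (left_op \<sigma> v)"
    if "\<pi> \<in> carrier (sym_group n)" "\<sigma> \<in> carrier (sym_group n)" for \<pi> \<sigma> v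
  proof -
    have "bij \<pi>" "bij \<sigma>" using that permutes_bij by (auto simp: sym_group_carrier)
    then have "inv' (\<pi> \<circ> \<sigma>) = inv' \<sigma> \<circ> inv' \<pi>" by (rule o_inv_distrib)
    then show ?thesis by (simp add: left_op_def sym_group_mult o_assoc)
  qed
qed

lemma ribbon_vector_apply:
  assumes w: "w permutes {1..n}"
  shows "ribbon_vector n T w u
    = (\<Sum>c\<in>row_group n ({1..<n} - T). of_int (sign c) * (if \<exists>y\<in>row_group n T. u = w \<circ> c \<circ> y then 1 else 0))"
proof -
  let ?Y = "row_group n T" and ?C = "row_group n ({1..<n} - T)"
  have one: "(\<Sum>y\<in>?Y. if u \<circ> y \<circ> inv' c = w then 1 else 0) = (if \<exists>y\<in>?Y. u = w \<circ> c \<circ> y then 1 else (0::complex))"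
    if c: "c \<in> ?C" for c
  proof -
    note pc = young_permutes[OF c]
    have iff: "u \<circ> y \<circ> inv' c = w \<longleftrightarrow> u = w \<circ> c \<circ> inv' y" if "y \<in> ?Y" for y
    proof -
      note py = young_permutes[OF that]
      have "u \<circ> y \<circ> inv' c = w \<longleftrightarrow> u \<circ> y = w \<circ> c"
        using permutes_inv_o[OF pc] by (metis comp_id o_assoc)
      also have "\<dots> \<longleftrightarrow> u = w \<circ> c \<circ> inv' y"
        using permutes_inv_o[OF py] by (metis comp_id o_assoc)
      finally show ?thesis .
    qed
    show ?thesis
    proof (cases "\<exists>y\<in>?Y. u = w \<circ> c \<circ> y")
      case True
      then obtain y0 where y0: "y0 \<in> ?Y" "u = w \<circ> c \<circ> y0" by blast
      have wc: "inj (w \<circ> c)" using permutes_inj[OF permutes_compose[OF pc w]] .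
      have "(if u \<circ> y \<circ> inv' c = w then 1 else 0) = (if y = inv' y0 then 1 else (0::complex))" if y: "y \<in> ?Y" for y
      proof -
        have "u = w \<circ> c \<circ> inv' y \<longleftrightarrow> y0 = inv' y"
          unfolding y0(2) by (auto simp: fun_eq_iff inj_eq[OF wc, unfolded o_def])
        also have "\<dots> \<longleftrightarrow> y = inv' y0"
          using permutes_inv_inv[OF young_permutes[OF y]] permutes_inv_inv[OF young_permutes[OF y0(1)]] by auto
        finally show ?thesis using iff[OF y] by simp
      qed
      then have "(\<Sum>y\<in>?Y. if u \<circ> y \<circ> inv' c = w then 1 else 0) = (\<Sum>y\<in>?Y. if y = inv' y0 then 1 else (0::complex))"
        by (rule sum.cong[OF refl])
      then show ?thesis using True young_inv[OF y0(1)] finite_young_subgroup by simp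
    next
      case False
      then have "\<not> (u \<circ> y \<circ> inv' c = w)" if "y \<in> ?Y" for y using iff[OF that] young_inv[OF that] by blast
      then show ?thesis unfolding if_not_P[OF False] by (intro sum.neutral) auto
    qed
  qed
  have "ribbon_vector n T w u = (\<Sum>y\<in>?Y. \<Sum>c\<in>?C. of_int (sign c) * (if u \<circ> y \<circ> c = w then 1 else 0))"
    by (simp add: ribbon_vector_def right_op_def point_mass_def)
  also have "\<dots> = (\<Sum>c\<in>?C. of_int (sign c) * (\<Sum>y\<in>?Y. if u \<circ> y \<circ> c = w then 1 else 0))"
    by (subst sum.swap) (simp add: sum_distrib_left)
  also have "\<dots> = (\<Sum>c\<in>?C. of_int (sign c) * (\<Sum>y\<in>?Y. if u \<circ> y \<circ> inv' c = w then 1 else 0))"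
  proof (rule sum.reindex_bij_witness[of _ inv' inv'])
    fix c assume c: "c \<in> ?C"
    note pc = young_permutes[OF c]
    show "inv' (inv' c) = c" by (rule permutes_inv_inv[OF pc])
    then show "inv' (inv' c) = c" .
    show "inv' c \<in> ?C" by (rule young_inv[OF c])
    then show "inv' c \<in> ?C" .
    have "sign (inv' c) = sign c" using pc permutation_permutes by (intro sign_inverse) blast
    then show "of_int (sign (inv' c)) * (\<Sum>y\<in>?Y. if u \<circ> y \<circ> inv' (inv' c) = w then 1 else 0)
        = (of_int (sign c) * (\<Sum>y\<in>?Y. if u \<circ> y \<circ> c = w then 1 else 0) :: complex)"
      by (simp only: \<open>inv' (inv' c) = c\<close>)
  qed
  also have "\<dots> = (\<Sum>c\<in>?C. of_int (sign c) * (if \<exists>y\<in>?Y. u = w \<circ> c \<circ> y then 1 else 0))"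
    using one by (intro sum.cong refl) (simp only:)
  finally show ?thesis .
qed

text \<open>Rows and columns meet in single cells, so \<open>w\<close> lies in the row coset of \<open>w \<circ> c\<close> only for
  \<open>c = id\<close>.\<close>

lemma ribbon_vector_self:
  assumes w: "w permutes {1..n}"
  shows "ribbon_vector n T w w = 1"
proof -
  have iff: "(\<exists>y\<in>row_group n T. w = w \<circ> c \<circ> y) \<longleftrightarrow> c = id" if c: "c \<in> row_group n ({1..<n} - T)" for c
  proof
    assume "\<exists>y\<in>row_group n T. w = w \<circ> c \<circ> y"
    then obtain y where y: "y \<in> row_group n T" "w = w \<circ> c \<circ> y" by blast
    have "c (y i) = i" for i
    proof -
      have "w i = w (c (y i))" using fun_cong[OF y(2), of i] by (simp only: comp_apply)
      then show ?thesis using injD[OF permutes_inj[OF w]] by metis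
    qed
    then have cy: "c \<circ> y = id" by auto
    have "c = (c \<circ> y) \<circ> inv' y" using permutes_inv_o(1)[OF young_permutes[OF y(1)]] by (simp add: o_assoc[symmetric])
    then have "c = inv' y" using cy by simp
    then have "c \<in> row_group n T" using young_inv[OF y(1)] by simp
    then show "c = id" using row_group_Int_column_group c by blast
  next
    assume "c = id"
    then show "\<exists>y\<in>row_group n T. w = w \<circ> c \<circ> y" using young_id by (intro bexI[of _ id]) auto
  qed
  have "ribbon_vector n T w w = (\<Sum>c\<in>row_group n ({1..<n} - T). if c = id then 1 else 0)"
    unfolding ribbon_vector_apply[OF w] using iff by (intro sum.cong refl) auto
  then show ?thesis using young_id finite_young_subgroup by simp
qed

text \<open>A permutation \<open>v = w \<circ> c \<circ> y\<close> in the support arises from \<open>w\<close> in two steps. The column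
  permutation \<open>c\<close> increases the weight, because \<open>w\<close> decreases along columns, and so does the row
  permutation \<open>y\<close>, because \<open>v\<close> is sorted along rows.\<close>

lemma ribbon_vector_triangular:
  assumes w: "w permutes {1..n}" and v: "v permutes {1..n}" "descents n v = descents n w" "v \<noteq> w"
    and nz: "ribbon_vector n (descents n w) w v \<noteq> 0"
  shows "weight n w < weight n v"
proof -
  let ?T = "descents n w"
  obtain c y where cy: "c \<in> row_group n ({1..<n} - ?T)" "y \<in> row_group n ?T" "v = w \<circ> c \<circ> y"
  proof -
    have "\<exists>c\<in>row_group n ({1..<n} - ?T). \<exists>y\<in>row_group n ?T. v = w \<circ> c \<circ> y"
    proof (rule ccontr)
      assume "\<not> ?thesis"
      then have "ribbon_vector n ?T w v = 0"
        unfolding ribbon_vector_apply[OF w] by (intro sum.neutral) auto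
      then show False using nz by simp
    qed
    then show thesis using that by blast
  qed
  have wc: "w \<circ> c = v \<circ> inv' y"
    unfolding cy(3) using permutes_inv_o(1)[OF young_permutes[OF cy(2)]] by (simp add: o_assoc[symmetric])
  have le: "weight n (w \<circ> c) \<le> weight n v"
    using weight_less_sorted[OF v(1) _ young_inv[OF cy(2)]] v(2) wc by (cases "inv' y = id") auto
  show ?thesis
  proof (cases "c = id")
    case False
    then show ?thesis using weight_less_column[OF w cy(1)] le by simp
  next
    case True
    then have "inv' y \<noteq> id" using wc v(3) by auto
    then show ?thesis
      using weight_less_sorted[OF v(1) _ young_inv[OF cy(2)]] v(2) wc True by simp
  qed
qed

text \<open>The standard polytabloids: descents exactly where the path goes down mean that \<open>w\<close> increases
  along rows and decreases along columns.\<close>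

definition descent_vector :: "nat \<Rightarrow> (nat \<Rightarrow> nat) \<Rightarrow> (nat \<Rightarrow> nat) \<Rightarrow> complex" where
  "descent_vector n w = ribbon_vector n (descents n w) w"

lemma descent_vector_in_ribbon_module:
  "w permutes {1..n} \<Longrightarrow> descent_vector n w \<in> ribbon_module n (descents n w)"
  unfolding ribbon_module_eq_span descent_vector_def by (intro fun_space.span_base) blast

lemma sum_fun_apply: "(\<Sum>i\<in>I. f i) x = (\<Sum>i\<in>I. f i x)"
  by (induction I rule: infinite_finite_induct) auto

text \<open>Vectors with different descent sets lie in independent ribbon modules; those with the same
  descent set are triangular with respect to the weight.\<close>

lemma descent_vectors_independent:
  assumes sum: "(\<Sum>w\<in>perms n. (\<lambda>u. a w * descent_vector n w u)) = 0" and w: "w permutes {1..n}"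
  shows "a w = 0"
proof -
  define g where "g T = (\<Sum>w\<in>{w \<in> perms n. descents n w = T}. (\<lambda>u. a w * descent_vector n w u))" for T
  have "(\<Sum>T\<in>Pow {1..<n}. g T) = (\<Sum>w\<in>perms n. (\<lambda>u. a w * descent_vector n w u))"
    unfolding g_def
  proof (rule sum.group)
    show "finite (perms n)" by (rule finite_perms)
  qed (auto simp: descents_def)
  then have 0: "(\<Sum>T\<in>Pow {1..<n}. g T) = 0" using sum by simp
  have gT: "g T \<in> ribbon_module n T" for T
    unfolding g_def
    by (intro fun_space.subspace_sum fun_space.subspace_scale finite_dim_subspace finite_dim_ribbon_module)
       (use descent_vector_in_ribbon_module in auto)
  have zero: "a w = 0" if w: "w permutes {1..n}" and T: "descents n w = T" for w T
  proof (rule ccontr)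
    assume "a w \<noteq> 0"
    define B where "B = {w \<in> perms n. descents n w = T \<and> a w \<noteq> 0}"
    have "finite B" "B \<noteq> {}" using finite_perms w T \<open>a w \<noteq> 0\<close> by (auto simp: B_def)
    \<comment> \<open>By triangularity, the vector of \<open>v\<close> is the only one with a nonzero coefficient and a
      nonzero value at \<open>v\<close>.\<close>
    then obtain v where v: "v \<in> B" "\<And>x. x \<in> B \<Longrightarrow> weight n v \<le> weight n x"
      using finite_has_minimal2 by (metis (mono_tags, lifting) arg_min_if_finite(1) arg_min_least)
    have "T \<subseteq> {1..<n}" using T by (auto simp: descents_def)
    then have "g T = 0" using ribbon_modules_independent[OF gT 0] by blast
    then have "0 = (\<Sum>w\<in>{w \<in> perms n. descents n w = T}. a w * descent_vector n w v)"
      unfolding g_def by (metis (no_types, lifting) sum_fun_apply zero_fun_apply sum.cong)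
    also have "\<dots> = (\<Sum>w\<in>{w \<in> perms n. descents n w = T}. if w = v then a v else 0)"
    proof (rule sum.cong[OF refl])
      fix x assume x: "x \<in> {w \<in> perms n. descents n w = T}"
      show "a x * descent_vector n x v = (if x = v then a v else 0)"
      proof (cases "x = v")
        case True
        then show ?thesis using ribbon_vector_self x by (simp add: descent_vector_def)
      next
        case False
        have "descent_vector n x v = 0" if "a x \<noteq> 0"
        proof (rule ccontr)
          assume "descent_vector n x v \<noteq> 0"
          then have "weight n x < weight n v"
            using x v(1) False unfolding descent_vector_def B_def
            by (intro ribbon_vector_triangular) auto
          moreover have "weight n v \<le> weight n x" using x that by (intro v(2)) (auto simp: B_def)
          ultimately show False by simp
        qed
        then show ?thesis using False by auto
      qed
    qed
    also have "\<dots> = a v"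
      using v(1) by (subst sum.delta[OF finite_subset[OF _ finite_perms[of n]]]) (auto simp: B_def)
    finally show False using v(1) by (simp add: B_def)
  qed
  show ?thesis by (rule zero[OF w refl])
qed

lemma span_eqI_card:
  assumes "finite B" "fun_space.independent A" "A \<subseteq> fun_space.span B" "card B \<le> card A"
  shows "fun_space.span B \<subseteq> fun_space.span A"
proof -
  have finA: "finite A" using fun_space.independent_span_bound[OF assms(1-3)] by simp
  show ?thesis
  proof (rule subsetI, rule ccontr)
    fix b assume b: "b \<in> fun_space.span B" "b \<notin> fun_space.span A"
    have "fun_space.independent (insert b A)" by (rule fun_space.independent_insertI[OF b(2) assms(2)])
    then have "card (insert b A) \<le> card B"
      using fun_space.independent_span_bound[OF assms(1), of "insert b A"] b(1) assms(3) by simp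
    moreover have "b \<notin> A" using b(2) fun_space.span_base by blast
    ultimately show False using finA assms(4) by simp
  qed
qed

text \<open>A function that is constant on the cosets of \<open>row_group n S\<close> is determined by its values at
  the sorted representatives, and there are as many of these as linearly independent descent vectors.\<close>

lemma row_invariant_spanned:
  assumes S: "S \<subseteq> {1..<n}"
  shows "row_invariant n S \<subseteq> fun_space.span (descent_vector n ` {w \<in> perms n. descents n w \<subseteq> S})"
proof -
  let ?D = "{w \<in> perms n. descents n w \<subseteq> S}"
  \<comment> \<open>Indicator functions of the cosets.\<close>
  define b where "b w = (\<lambda>u. if \<exists>y\<in>row_group n S. u = w \<circ> y then 1 else 0 :: complex)" for w :: "nat \<Rightarrow> nat"
  have finD: "finite ?D" using finite_perms by simp
  have finS: "finite S" using S finite_subset by blast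
  have inB: "row_invariant n S \<subseteq> fun_space.span (b ` ?D)"
  proof
    fix g assume g: "g \<in> row_invariant n S"
    have "g = (\<Sum>w\<in>?D. (\<lambda>u. g w * b w u))"
    proof
      fix u
      show "g u = (\<Sum>w\<in>?D. (\<lambda>u. g w * b w u)) u"
      proof (cases "u permutes {1..n}")
        case True
        obtain y where y: "y \<in> row_group n S" "descents n (u \<circ> y) \<subseteq> S"
          using sorted_coset_representative[OF True] by blast
        have uy: "u \<circ> y permutes {1..n}" by (rule permutes_compose[OF young_permutes[OF y(1)] True])
        have "b w u = (if w = u \<circ> y then 1 else 0)" if w: "w \<in> ?D" for w
        proof -
          have "(\<exists>z\<in>row_group n S. u = w \<circ> z) \<longleftrightarrow> w = u \<circ> y"
          proof
            assume "\<exists>z\<in>row_group n S. u = w \<circ> z"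
            then obtain z where z: "z \<in> row_group n S" "u = w \<circ> z" by blast
            have "z \<circ> y = id"
              by (rule sorted_coset_representative_unique[of w n S])
                 (use w y z young_comp in \<open>auto simp: o_assoc\<close>)
            then show "w = u \<circ> y" using z(2) by (metis comp_id o_assoc)
          next
            assume w: "w = u \<circ> y"
            have "u = w \<circ> inv' y"
              unfolding w using permutes_inv_o(1)[OF young_permutes[OF y(1)]] by (simp add: o_assoc[symmetric])
            then show "\<exists>z\<in>row_group n S. u = w \<circ> z" using young_inv[OF y(1)] by blast
          qed
          then show ?thesis by (simp add: b_def)
        qed
        then have "(\<Sum>w\<in>?D. g w * b w u) = (\<Sum>w\<in>?D. if w = u \<circ> y then g w else 0)"
          by (intro sum.cong) auto
        also have "\<dots> = g (u \<circ> y)" using finD uy y(2) by simp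
        also have "\<dots> = g u" using g y(1) by (simp add: row_invariant_def)
        finally show ?thesis by (simp add: sum_fun_apply)
      next
        case False
        have "b w u = 0" if w: "w \<in> ?D" for w
        proof -
          have "u \<noteq> w \<circ> y" if "y \<in> row_group n S" for y
            using w False permutes_compose[OF young_permutes[OF that], of w] by blast
          then show ?thesis by (auto simp: b_def)
        qed
        moreover have "g u = 0" using g False by (simp add: row_invariant_def supported_on_def)
        ultimately show ?thesis by (simp add: sum_fun_apply)
      qed
    qed
    also have "\<dots> \<in> fun_space.span (b ` ?D)"
      by (intro fun_space.span_sum fun_space.span_scale fun_space.span_base) auto
    finally show "g \<in> fun_space.span (b ` ?D)" .
  qed
  have inj: "inj_on (descent_vector n) ?D"
  proof (rule inj_onI, rule ccontr)
    fix v w assume v: "v \<in> ?D" and w: "w \<in> ?D" and eq: "descent_vector n v = descent_vector n w" and ne: "v \<noteq> w"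
    define a where "a x = (if x = v then 1 else if x = w then -1 else 0 :: complex)" for x
    have "(\<Sum>x\<in>perms n. (\<lambda>u. a x * descent_vector n x u))
        = (\<Sum>x\<in>{v, w}. (\<lambda>u. a x * descent_vector n x u))"
      by (rule sum.mono_neutral_right) (use v w finite_perms in \<open>auto simp: a_def fun_eq_iff\<close>)
    also have "\<dots> = 0" using ne by (intro ext) (simp add: sum_fun_apply a_def eq)
    finally have 0: "(\<Sum>x\<in>perms n. (\<lambda>u. a x * descent_vector n x u)) = 0" .
    have "v permutes {1..n}" using v by blast
    then have "a v = 0" by (rule descent_vectors_independent[OF 0])
    then show False by (simp add: a_def)
  qed
  have ind: "fun_space.independent (descent_vector n ` ?D)"
  proof (rule fun_space.independent_if_scalars_zero)
    fix k x assume eq: "(\<Sum>x\<in>descent_vector n ` ?D. (\<lambda>u. k x * x u)) = 0" and x: "x \<in> descent_vector n ` ?D"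
    define a where "a w = (if w \<in> ?D then k (descent_vector n w) else 0)" for w
    have "(\<Sum>w\<in>perms n. (\<lambda>u. a w * descent_vector n w u)) = (\<Sum>w\<in>?D. (\<lambda>u. a w * descent_vector n w u))"
      by (rule sum.mono_neutral_right) (use finite_perms in \<open>auto simp: a_def fun_eq_iff\<close>)
    also have "\<dots> = (\<Sum>w\<in>?D. (\<lambda>u. k (descent_vector n w) * descent_vector n w u))"
      by (rule sum.cong[OF refl]) (simp only: a_def if_True)
    also have "\<dots> = 0" using eq inj by (simp add: sum.reindex)
    finally have 0: "(\<Sum>w\<in>perms n. (\<lambda>u. a w * descent_vector n w u)) = 0" .
    obtain w where w: "w \<in> ?D" "x = descent_vector n w" using x by blast
    then have "w permutes {1..n}" by blast
    then have "a w = 0" by (rule descent_vectors_independent[OF 0])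
    then show "k x = 0" using w by (simp only: a_def if_True)
  qed (use finD in simp)
  have sub: "descent_vector n ` ?D \<subseteq> row_invariant n S"
  proof
    fix x assume "x \<in> descent_vector n ` ?D"
    then obtain w where w: "w \<in> ?D" "x = descent_vector n w" by blast
    then have "x \<in> ribbon_module n (descents n w)" using descent_vector_in_ribbon_module by blast
    then show "x \<in> row_invariant n S"
      using ribbon_module_subset row_invariant_mono[OF finS] w by blast
  qed
  have "card (b ` ?D) \<le> card (descent_vector n ` ?D)"
    using card_image_le[OF finD, of b] card_image[OF inj] by simp
  then have "fun_space.span (b ` ?D) \<subseteq> fun_space.span (descent_vector n ` ?D)"
    using sub inB finD by (intro span_eqI_card ind) auto
  then show ?thesis using inB by blast
qed

definition family_sum :: "'i set \<Rightarrow> ('i \<Rightarrow> ('a \<Rightarrow> complex) set) \<Rightarrow> ('a \<Rightarrow> complex) set" where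
  "family_sum I V = {\<Sum>i\<in>I. g i | g. \<forall>i\<in>I. g i \<in> V i}"

lemma trace_on_family_sum:
  assumes I: "finite I" and fd: "\<And>i. i \<in> I \<Longrightarrow> finite_dim (V i)"
    and ind: "\<And>g i. (\<And>i. i \<in> I \<Longrightarrow> g i \<in> V i) \<Longrightarrow> (\<Sum>i\<in>I. g i) = 0 \<Longrightarrow> i \<in> I \<Longrightarrow> g i = 0"
    and f: "linear_map f" "\<And>i v. i \<in> I \<Longrightarrow> v \<in> V i \<Longrightarrow> f v \<in> V i"
  shows "finite_dim (family_sum I V) \<and> trace_on (family_sum I V) f = (\<Sum>i\<in>I. trace_on (V i) f)"
  using I fd ind f(2)
proof (induction I)
  case empty
  have "family_sum {} V = {0 :: 'b \<Rightarrow> complex}" by (auto simp: family_sum_def zero_fun_def)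
  moreover have "finite_dim {0 :: 'b \<Rightarrow> complex}" using finite_dim_span[of "{} :: ('b \<Rightarrow> complex) set"] by simp
  moreover have "trace_on {0 :: 'b \<Rightarrow> complex} f = 0"
  proof (rule trans[OF trace_on_eq[of "{}"]])
    show "f v \<in> {0}" if "v \<in> {0}" for v
      using that linear_map_0[OF f(1)] by (simp only: singleton_iff)
  qed (simp_all add: fun_space.independent_empty f(1))
  ultimately show ?case by simp
next
  case (insert i I)
  have zero: "0 \<in> V j" if "j \<in> insert i I" for j
    using insert.prems(1)[OF that] finite_dim_subspace fun_space.subspace_0 by blast
  have IH: "finite_dim (family_sum I V) \<and> trace_on (family_sum I V) f = (\<Sum>i\<in>I. trace_on (V i) f)"
  proof (rule insert.IH)
    fix g j assume g: "\<And>j. j \<in> I \<Longrightarrow> g j \<in> V j" and sum: "(\<Sum>j\<in>I. g j) = 0" and j: "j \<in> I"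
    \<comment> \<open>Padding the family with \<open>0\<close> at \<open>i\<close> makes the hypothesis on independence applicable.\<close>
    have "(g(i := 0)) j = 0"
    proof (rule insert.prems(2)[of "g(i := 0)" j])
      show "(g(i := 0)) k \<in> V k" if "k \<in> insert i I" for k
        using g[of k] zero[OF that] that by (cases "k = i") simp_all
      have "(\<Sum>j\<in>I. (g(i := 0)) j) = (\<Sum>j\<in>I. g j)"
        using insert.hyps by (intro sum.cong) auto
      then show "(\<Sum>j\<in>insert i I. (g(i := 0)) j) = 0"
        using insert.hyps sum by simp
    qed (use j in simp)
    then show "g j = 0" using insert.hyps j by (auto split: if_splits)
  qed (use insert.prems in auto)
  have eq: "family_sum (insert i I) V = {v + w | v w. v \<in> V i \<and> w \<in> family_sum I V}"
  proof (intro equalityI subsetI)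
    fix x assume "x \<in> family_sum (insert i I) V"
    then obtain g where g: "\<forall>j\<in>insert i I. g j \<in> V j" "x = (\<Sum>j\<in>insert i I. g j)" by (auto simp: family_sum_def)
    then have "x = g i + (\<Sum>j\<in>I. g j)" using insert.hyps by simp
    then show "x \<in> {v + w | v w. v \<in> V i \<and> w \<in> family_sum I V}" using g(1) by (auto simp: family_sum_def)
  next
    fix x assume "x \<in> {v + w | v w. v \<in> V i \<and> w \<in> family_sum I V}"
    then obtain v g where g: "v \<in> V i" "\<forall>j\<in>I. g j \<in> V j" "x = v + (\<Sum>j\<in>I. g j)" by (auto simp: family_sum_def)
    have "(\<Sum>j\<in>I. (g(i := v)) j) = (\<Sum>j\<in>I. g j)"
      using insert.hyps by (intro sum.cong) auto
    then have "x = (\<Sum>j\<in>insert i I. (g(i := v)) j)"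
      using insert.hyps g(3) by simp
    moreover have "\<forall>j\<in>insert i I. (g(i := v)) j \<in> V j" using g(1,2) by auto
    ultimately show "x \<in> family_sum (insert i I) V" unfolding family_sum_def by blast
  qed
  have int: "V i \<inter> family_sum I V = {0}"
  proof -
    have "v = 0" if v: "v \<in> V i" "v \<in> family_sum I V" for v
    proof -
      obtain g where g: "\<forall>j\<in>I. g j \<in> V j" "v = (\<Sum>j\<in>I. g j)" using v(2) by (auto simp: family_sum_def)
      have "(g(i := - v)) i = 0"
      proof (rule insert.prems(2)[of "g(i := - v)" i])
        have "(\<Sum>j\<in>I. (g(i := - v)) j) = (\<Sum>j\<in>I. g j)"
          using insert.hyps by (intro sum.cong) auto
        then show "(\<Sum>j\<in>insert i I. (g(i := - v)) j) = 0"
          using insert.hyps g(2) by simp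
        have "- v \<in> V i"
          by (rule fun_space.subspace_neg[OF finite_dim_subspace[OF insert.prems(1)] v(1)]) simp
        then show "(g(i := - v)) j \<in> V j" if "j \<in> insert i I" for j
          using that g(1) by (cases "j = i") simp_all
      qed simp
      then show ?thesis by simp
    qed
    moreover have "0 \<in> family_sum I V"
      using finite_dim_subspace fun_space.subspace_0 IH by blast
    ultimately show ?thesis using zero by auto
  qed
  have inv: "f w \<in> family_sum I V" if w: "w \<in> family_sum I V" for w
  proof -
    obtain g where g: "\<forall>j\<in>I. g j \<in> V j" "w = (\<Sum>j\<in>I. g j)" using w by (auto simp: family_sum_def)
    have "f w = (\<Sum>j\<in>I. f (g j))" unfolding g(2) by (rule linear_map_sum[OF f(1)])
    moreover have "\<forall>j\<in>I. f (g j) \<in> V j" using g(1) insert.prems(3) by simp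
    ultimately show ?thesis unfolding family_sum_def by blast
  qed
  have fdi: "finite_dim (V i)" by (rule insert.prems(1)) simp
  have inv_i: "f v \<in> V i" if "v \<in> V i" for v by (rule insert.prems(3)) (use that in simp_all)
  have "finite_dim (family_sum (insert i I) V)"
    unfolding eq by (rule trace_on_direct_sum(2)[OF fdi conjunct1[OF IH] int f(1) inv_i inv])
  moreover have "trace_on (family_sum (insert i I) V) f = trace_on (V i) f + trace_on (family_sum I V) f"
    unfolding eq by (rule trace_on_direct_sum(1)[OF fdi conjunct1[OF IH] int f(1) inv_i inv])
  ultimately show ?case using IH insert.hyps by simp
qed

text \<open>The module of row-invariant functions is the direct sum of the ribbon modules of all
  subsets: they are independent and contain the spanning descent vectors.\<close>

lemma trace_row_invariant_eq_sum:
  assumes S: "S \<subseteq> {1..<n}" and \<pi>: "\<pi> permutes {1..n}"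
  shows "trace_on (row_invariant n S) (left_op \<pi>) = (\<Sum>T\<in>Pow S. trace_on (ribbon_module n T) (left_op \<pi>))"
proof -
  have finS: "finite S" using S finite_subset by blast
  have zero: "0 \<in> ribbon_module n T" for T
    using fun_space.subspace_0[OF finite_dim_subspace[OF finite_dim_ribbon_module]] .
  have main: "finite_dim (family_sum (Pow S) (ribbon_module n)) \<and>
      trace_on (family_sum (Pow S) (ribbon_module n)) (left_op \<pi>) = (\<Sum>T\<in>Pow S. trace_on (ribbon_module n T) (left_op \<pi>))"
  proof (rule trace_on_family_sum)
    fix g T assume g: "\<And>T. T \<in> Pow S \<Longrightarrow> g T \<in> ribbon_module n T" and sum: "(\<Sum>T\<in>Pow S. g T) = 0" and T: "T \<in> Pow S"
    define h where "h T = (if T \<in> Pow S then g T else 0)" for T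
    have "h T = 0"
    proof (rule ribbon_modules_independent[of n h])
      show "h T \<in> ribbon_module n T" for T using g zero by (simp add: h_def)
      have "(\<Sum>T\<in>Pow {1..<n}. h T) = (\<Sum>T\<in>Pow S. h T)"
        by (rule sum.mono_neutral_right) (use S in \<open>auto simp: h_def\<close>)
      also have "\<dots> = (\<Sum>T\<in>Pow S. g T)" by (intro sum.cong) (auto simp: h_def)
      finally show "(\<Sum>T\<in>Pow {1..<n}. h T) = 0" using sum by simp
      show "T \<subseteq> {1..<n}" using S T by blast
    qed
    then show "g T = 0" using T by (simp add: h_def)
  qed (use finS finite_dim_ribbon_module linear_map_left_op ribbon_module_left_op[OF \<pi>] in auto)
  have "row_invariant n S = family_sum (Pow S) (ribbon_module n)"
  proof (intro equalityI subsetI)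
    fix g assume "g \<in> row_invariant n S"
    then have "g \<in> fun_space.span (descent_vector n ` {w \<in> perms n. descents n w \<subseteq> S})"
      using row_invariant_spanned[OF S] by blast
    moreover have "fun_space.span (descent_vector n ` {w \<in> perms n. descents n w \<subseteq> S}) \<subseteq> family_sum (Pow S) (ribbon_module n)"
    proof (rule fun_space.span_minimal)
      show "fun_space.subspace (family_sum (Pow S) (ribbon_module n))"
        using main finite_dim_subspace by blast
      show "descent_vector n ` {w \<in> perms n. descents n w \<subseteq> S} \<subseteq> family_sum (Pow S) (ribbon_module n)"
      proof
        fix x assume "x \<in> descent_vector n ` {w \<in> perms n. descents n w \<subseteq> S}"
        then obtain w where w: "w permutes {1..n}" "descents n w \<subseteq> S" "x = descent_vector n w" by blast
        define g where "g T = (if T = descents n w then x else 0)" for T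
        have "x = (\<Sum>T\<in>Pow S. g T)" using w(2) finS by (simp add: g_def)
        moreover have "\<forall>T\<in>Pow S. g T \<in> ribbon_module n T"
          using zero descent_vector_in_ribbon_module[OF w(1)] w(3) by (simp add: g_def)
        ultimately show "x \<in> family_sum (Pow S) (ribbon_module n)" unfolding family_sum_def by blast
      qed
    qed
    ultimately show "g \<in> family_sum (Pow S) (ribbon_module n)" by blast
  next
    fix g assume "g \<in> family_sum (Pow S) (ribbon_module n)"
    then obtain h where h: "\<forall>T\<in>Pow S. h T \<in> ribbon_module n T" "g = (\<Sum>T\<in>Pow S. h T)"
      by (auto simp: family_sum_def)
    have "h T \<in> row_invariant n S" if "T \<in> Pow S" for T
      using h(1) that ribbon_module_subset row_invariant_mono[OF finS] by blast
    moreover have "fun_space.subspace (row_invariant n S)"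
      by (auto simp: fun_space.subspace_def row_invariant_def supported_on_def)
    ultimately show "g \<in> row_invariant n S"
      unfolding h(2) by (intro fun_space.subspace_sum) auto
  qed
  then show ?thesis using main by simp
qed

section \<open>Counting words by descents\<close>

text \<open>The word that records for every entry \<open>m\<close> the row in which \<open>u\<close> puts it; two permutations
  have the same row word exactly if they lie in the same coset of the row group.\<close>

definition row_word :: "nat \<Rightarrow> nat set \<Rightarrow> (nat \<Rightarrow> nat) \<Rightarrow> nat \<Rightarrow> nat" where
  "row_word n S u = (\<lambda>m\<in>{1..n}. row_index S (inv' u m))"

lemma row_word_left:
  assumes \<pi>: "\<pi> permutes {1..n}" and u: "u permutes {1..n}"
  shows "row_word n S (inv' \<pi> \<circ> u) = (\<lambda>m\<in>{1..n}. row_word n S u (\<pi> m))"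
proof
  fix m
  have "inv' (inv' \<pi> \<circ> u) = inv' u \<circ> \<pi>"
    using o_inv_distrib[OF permutes_bij[OF permutes_inv[OF \<pi>]] permutes_bij[OF u]] permutes_inv_inv[OF \<pi>] by simp
  then show "row_word n S (inv' \<pi> \<circ> u) m = (\<lambda>m\<in>{1..n}. row_word n S u (\<pi> m)) m"
    using permutes_in_image[OF \<pi>, of m] by (simp add: row_word_def)
qed

text \<open>Row-invariant functions are functions of the row word, and \<open>\<pi>\<close> permutes the row words.\<close>

lemma trace_row_invariant_eq_card:
  assumes \<pi>: "\<pi> permutes {1..n}"
  shows "trace_on (row_invariant n S) (left_op \<pi>)
       = of_nat (card {r \<in> row_word n S ` perms n. \<forall>m\<in>{1..n}. r (\<pi> m) = r m})"
proof -
  let ?X = "row_word n S ` perms n"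
  define \<Psi> where "\<Psi> f = (\<lambda>u. if u \<in> perms n then f (row_word n S u) else 0)" for f :: "(nat \<Rightarrow> nat) \<Rightarrow> complex"
  define act where "act f = (\<lambda>r. if r \<in> ?X then f (\<lambda>m\<in>{1..n}. r (\<pi> m)) else 0)" for f :: "(nat \<Rightarrow> nat) \<Rightarrow> complex"
  have finX: "finite ?X" using finite_perms by (rule finite_imageI)
  have lin: "linear_map \<Psi>" "linear_map act" by (auto simp: linear_map_def \<Psi>_def act_def fun_eq_iff)
  have inj: "inj_on \<Psi> (supported_on ?X)"
  proof (rule inj_onI)
    fix f g assume f: "f \<in> supported_on ?X" and g: "g \<in> supported_on ?X" and eq: "\<Psi> f = \<Psi> g"
    show "f = g"
    proof
      fix r show "f r = g r"
      proof (cases "r \<in> ?X")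
        case True
        then obtain u where "u \<in> perms n" "r = row_word n S u" by blast
        then show ?thesis using fun_cong[OF eq, of u] by (simp add: \<Psi>_def)
      qed (use f g in \<open>simp add: supported_on_def\<close>)
    qed
  qed
  have act_supp: "act f \<in> supported_on ?X" for f by (simp add: act_def supported_on_def)
  have comm: "\<Psi> (act f) = left_op \<pi> (\<Psi> f)" for f
  proof
    fix u
    have iff: "inv' \<pi> \<circ> u permutes {1..n} \<longleftrightarrow> u permutes {1..n}"
    proof
      assume "inv' \<pi> \<circ> u permutes {1..n}"
      then have "\<pi> \<circ> (inv' \<pi> \<circ> u) permutes {1..n}" by (rule permutes_compose[OF _ \<pi>])
      then show "u permutes {1..n}" using permutes_inv_o(1)[OF \<pi>] by (simp add: o_assoc)
    qed (rule permutes_compose[OF _ permutes_inv[OF \<pi>]])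
    show "\<Psi> (act f) u = left_op \<pi> (\<Psi> f) u"
    proof (cases "u permutes {1..n}")
      case True
      then have "row_word n S u \<in> ?X" by blast
      then have "\<Psi> (act f) u = f (\<lambda>m\<in>{1..n}. row_word n S u (\<pi> m))"
        using True by (simp add: \<Psi>_def act_def)
      also have "\<dots> = left_op \<pi> (\<Psi> f) u"
        using True iff row_word_left[OF \<pi> True, of S] by (simp add: left_op_def \<Psi>_def)
      finally show ?thesis .
    next
      case False
      then show ?thesis using iff by (simp add: left_op_def \<Psi>_def)
    qed
  qed
  have img: "\<Psi> ` supported_on ?X = row_invariant n S"
  proof (intro equalityI subsetI)
    fix g assume "g \<in> \<Psi> ` supported_on ?X"
    then obtain f where f: "g = \<Psi> f" by blast
    have "g (u \<circ> y) = g u" if y: "y \<in> row_group n S" for u y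
    proof (cases "u permutes {1..n}")
      case True
      note py = young_permutes[OF y]
      have uy: "u \<circ> y permutes {1..n}" by (rule permutes_compose[OF py True])
      have "row_word n S (u \<circ> y) = row_word n S u"
      proof
        fix m show "row_word n S (u \<circ> y) m = row_word n S u m"
        proof (cases "m \<in> {1..n}")
          case m: True
          have "inv' (u \<circ> y) m = inv' y (inv' u m)"
            using o_inv_distrib[OF permutes_bij[OF True] permutes_bij[OF py]] by simp
          moreover have "inv' u m \<in> {1..n}" using permutes_in_image[OF permutes_inv[OF True]] m by blast
          moreover have "\<forall>i\<in>{1..n}. row_index S (inv' y i) = row_index S i"
            using young_inv[OF y] by (simp add: young_subgroup_def)
          ultimately show ?thesis using m by (simp add: row_word_def del: atLeastAtMost_iff)
        qed (simp add: row_word_def del: atLeastAtMost_iff)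
      qed
      then show ?thesis using True uy by (simp add: f \<Psi>_def)
    next
      case False
      then show ?thesis using comp_permutes_iff[OF young_permutes[OF y], of u] by (simp add: f \<Psi>_def)
    qed
    then show "g \<in> row_invariant n S" by (auto simp: row_invariant_def supported_on_def f \<Psi>_def)
  next
    fix g assume g: "g \<in> row_invariant n S"
    define e where "e r = (SOME u. u \<in> perms n \<and> row_word n S u = r)" for r
    have e: "e r \<in> perms n \<and> row_word n S (e r) = r" if "r \<in> ?X" for r
    proof -
      have "\<exists>u. u \<in> perms n \<and> row_word n S u = r" using that by blast
      from someI_ex[OF this] show ?thesis unfolding e_def .
    qed
    define f where "f r = (if r \<in> ?X then g (e r) else 0)" for r
    have "\<Psi> f = g"
    proof
      fix u show "\<Psi> f u = g u"
      proof (cases "u permutes {1..n}")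
        case True
        then have X: "row_word n S u \<in> ?X" by blast
        define v where "v = e (row_word n S u)"
        have v: "v permutes {1..n}" "row_word n S v = row_word n S u" using e[OF X] by (auto simp: v_def)
        define y where "y = inv' v \<circ> u"
        have py: "y permutes {1..n}" unfolding y_def by (rule permutes_compose[OF True permutes_inv[OF v(1)]])
        have "row_index S (y i) = row_index S i" if "i \<in> {1..n}" for i
        proof -
          have ui: "u i \<in> {1..n}" using permutes_in_image[OF True] that by blast
          then have "row_index S (inv' v (u i)) = row_index S (inv' u (u i))"
            using fun_cong[OF v(2), of "u i"] by (simp add: row_word_def)
          then show ?thesis using permutes_inverses(2)[OF True] by (simp add: y_def)
        qed
        then have y: "y \<in> row_group n S" using py by (simp add: young_subgroup_def)
        have "u = v \<circ> y" using permutes_inv_o(1)[OF v(1)] by (simp add: y_def o_assoc)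
        then have "g u = g v" using g y by (simp add: row_invariant_def)
        then show ?thesis using True X by (simp add: \<Psi>_def f_def v_def)
      next
        case False
        then show ?thesis using g by (simp add: \<Psi>_def row_invariant_def supported_on_def)
      qed
    qed
    moreover have "f \<in> supported_on ?X" by (simp add: f_def supported_on_def)
    ultimately show "g \<in> \<Psi> ` supported_on ?X" by blast
  qed
  have "trace_on (supported_on ?X) act = trace_on (\<Psi> ` supported_on ?X) (left_op \<pi>)"
  proof (rule trace_on_transfer(1))
    show "finite_dim (supported_on ?X)" by (rule finite_dim_supported_on[OF finX])
    show "linear_map (left_op \<pi>)" by (rule linear_map_left_op)
    show "\<Psi> (act v) = left_op \<pi> (\<Psi> v)" for v by (rule comm)
    show "act v \<in> supported_on ?X" for v by (rule act_supp)
  qed (rule lin inj)+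
  then have "trace_on (row_invariant n S) (left_op \<pi>) = trace_on (supported_on ?X) act"
    unfolding img by simp
  also have "\<dots> = (\<Sum>r\<in>?X. if \<forall>m\<in>{1..n}. r (\<pi> m) = r m then 1 else 0)"
  proof (subst trace_on_supported_on[OF finX lin(2) act_supp], rule sum.cong[OF refl])
    fix r assume r: "r \<in> ?X"
    have "((\<lambda>m\<in>{1..n}. r (\<pi> m)) = r) \<longleftrightarrow> (\<forall>m\<in>{1..n}. r (\<pi> m) = r m)"
    proof
      assume eq: "(\<lambda>m\<in>{1..n}. r (\<pi> m)) = r"
      show "\<forall>m\<in>{1..n}. r (\<pi> m) = r m" using fun_cong[OF eq] by (metis restrict_apply')
    next
      assume eq: "\<forall>m\<in>{1..n}. r (\<pi> m) = r m"
      show "(\<lambda>m\<in>{1..n}. r (\<pi> m)) = r"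
      proof
        fix m show "(\<lambda>m\<in>{1..n}. r (\<pi> m)) m = r m"
          using eq r by (cases "m \<in> {1..n}") (auto simp: row_word_def)
      qed
    qed
    then show "act (point_mass r) r = (if \<forall>m\<in>{1..n}. r (\<pi> m) = r m then 1 else 0)"
      using r by (simp add: act_def point_mass_def)
  qed
  also have "\<dots> = of_nat (card {r \<in> ?X. \<forall>m\<in>{1..n}. r (\<pi> m) = r m})"
    by (subst sum.inter_filter[OF finX, symmetric]) simp
  finally show ?thesis .
qed

definition onto_words :: "nat \<Rightarrow> nat \<Rightarrow> (nat \<Rightarrow> nat) set" where
  "onto_words n m = {r \<in> {1..n} \<rightarrow>\<^sub>E {..<m}. r ` {1..n} = {..<m}}"

lemma row_index_image:
  assumes S: "S \<subseteq> {1..<n}" and n: "n \<ge> 1"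
  shows "row_index S ` {1..n} = {..card S}"
proof -
  have "row_index S ` {1..Suc j} = {..row_index S (Suc j)}" for j
  proof (induction j)
    case 0
    have "{t \<in> S. t < Suc 0} = {}" using S by auto
    then have "row_index S (Suc 0) = 0" by (simp only: row_index_def card.empty)
    then show ?case by simp
  next
    case (Suc j)
    have "{1..Suc (Suc j)} = insert (Suc (Suc j)) {1..Suc j}" by auto
    then show ?case using Suc row_index_Suc[of S "Suc j"] by (auto simp: atMost_Suc)
  qed
  from this[of "n - 1"] have "row_index S ` {1..n} = {..row_index S n}" using n by simp
  moreover have "{t \<in> S. t < n} = S" using S by auto
  ultimately show ?thesis by (simp add: row_index_def)
qed

lemma row_word_onto:
  assumes S: "S \<subseteq> {1..<n}" and n: "n \<ge> 1" and u: "u permutes {1..n}"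
  shows "row_word n S u \<in> onto_words n (Suc (card S))"
proof -
  have "row_word n S u ` {1..n} = row_index S ` (inv' u ` {1..n})" by (simp add: row_word_def image_image)
  also have "inv' u ` {1..n} = {1..n}" by (rule permutes_image[OF permutes_inv[OF u]])
  also have "row_index S ` {1..n} = {..<Suc (card S)}" using row_index_image[OF S n] by auto
  finally have img: "row_word n S u ` {1..n} = {..<Suc (card S)}" .
  then have "row_word n S u \<in> {1..n} \<rightarrow>\<^sub>E {..<Suc (card S)}" by (auto simp: row_word_def PiE_iff)
  then show ?thesis using img by (simp add: onto_words_def)
qed

text \<open>A weakly increasing sequence is determined by how often each value occurs.\<close>

lemma mono_le_of_equidistributed:
  fixes f g :: "nat \<Rightarrow> nat"
  assumes f: "\<And>i j. i \<le> j \<Longrightarrow> f i \<le> f j" and g: "\<And>i j. i \<le> j \<Longrightarrow> g i \<le> g j"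
    and \<sigma>: "\<sigma> permutes {1..n}" and eq: "\<And>i. i \<in> {1..n} \<Longrightarrow> f i = g (\<sigma> i)" and i: "i \<in> {1..n}"
  shows "g i \<le> f i"
proof (rule ccontr)
  assume "\<not> g i \<le> f i"
  then have less: "f i < g i" by simp
  \<comment> \<open>The first \<open>i\<close> values of \<open>f\<close> are below \<open>g i\<close>, but only \<open>i - 1\<close> values of \<open>g\<close> can be.\<close>
  have "\<sigma> ` {1..i} \<subseteq> {1..<i}"
  proof
    fix k assume "k \<in> \<sigma> ` {1..i}"
    then obtain j where j: "j \<in> {1..i}" "k = \<sigma> j" by blast
    have "g k = f j" using eq[of j] j i by simp
    also have "\<dots> \<le> f i" using f j by simp
    finally have "g k < g i" using less by simp
    then have "k < i" using g by (meson not_le)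
    moreover have "k \<in> {1..n}" using permutes_in_image[OF \<sigma>, of j] j i by simp
    ultimately show "k \<in> {1..<i}" by simp
  qed
  then have "card (\<sigma> ` {1..i}) \<le> card {1..<i}" by (intro card_mono) auto
  moreover have "card (\<sigma> ` {1..i}) = i"
    using permutes_inj[OF \<sigma>] by (subst card_image) (auto intro: inj_on_subset)
  ultimately have "i \<le> i - 1" by simp
  moreover have "1 \<le> i" using i by simp
  ultimately show False by arith
qed

lemma row_words_disjoint:
  assumes S: "S \<subseteq> {1..<n}" and S': "S' \<subseteq> {1..<n}"
    and u: "u permutes {1..n}" "u' permutes {1..n}" and eq: "row_word n S u = row_word n S' u'"
  shows "S = S'"
proof -
  have main: "row_index B i \<le> row_index A i"
    if A: "row_word n A v = row_word n B v'" "v permutes {1..n}" "v' permutes {1..n}" and i: "i \<in> {1..n}" for A B v v' i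
  proof (rule mono_le_of_equidistributed[where f = "row_index A" and g = "row_index B" and \<sigma> = "inv' v' \<circ> v" and n = n])
    show "inv' v' \<circ> v permutes {1..n}" by (rule permutes_compose[OF A(2) permutes_inv[OF A(3)]])
    fix j assume j: "j \<in> {1..n}"
    have "v j \<in> {1..n}" using permutes_in_image[OF A(2)] j by blast
    then have "row_index A (inv' v (v j)) = row_index B (inv' v' (v j))"
      using fun_cong[OF A(1), of "v j"] by (simp add: row_word_def)
    then show "row_index A j = row_index B ((inv' v' \<circ> v) j)" using permutes_inverses(2)[OF A(2)] by simp
  qed (use row_index_mono i in auto)
  have ri: "row_index S i = row_index S' i" if "i \<in> {1..n}" for i
    using main[OF eq u that] main[OF eq[symmetric] u(2) u(1) that] by simp
  have "i \<in> S \<longleftrightarrow> i \<in> S'" if i: "i \<in> {1..<n}" for i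
  proof -
    have "row_index S i = row_index S' i" by (rule ri) (use i in auto)
    moreover have "row_index S (Suc i) = row_index S' (Suc i)" by (rule ri) (use i in auto)
    ultimately show ?thesis unfolding row_index_Suc by (cases "i \<in> S"; cases "i \<in> S'") simp_all
  qed
  then show ?thesis using S S' by blast
qed

text \<open>Sorting the positions of a word by their letters recovers the set of row ends.\<close>

lemma onto_word_is_row_word:
  assumes r: "r \<in> onto_words n m" and n: "n \<ge> 1"
  obtains S u where "S \<subseteq> {1..<n}" "Suc (card S) = m" "u permutes {1..n}" "r = row_word n S u"
proof -
  \<comment> \<open>With an empty set there is a single row, so \<open>y\<close> sorts the whole word.\<close>
  obtain y where y: "y \<in> row_group n {}" "\<And>z. z \<in> row_group n {} \<Longrightarrow> weight n (r \<circ> z) \<le> weight n (r \<circ> y)"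
    using maximal_weight_exists by blast
  note py = young_permutes[OF y(1)]
  define f where "f = r \<circ> y"
  have step: "f i \<le> f (Suc i)" if "i \<in> {1..<n}" for i
    unfolding f_def by (rule maximal_weight_sorted[OF y]) (use that in auto)
  have mono: "f i \<le> f j" if "i \<le> j" "1 \<le> i" "j \<le> n" for i j
    using that
  proof (induction j)
    case (Suc j)
    show ?case
    proof (cases "i = Suc j")
      case False
      then have "f i \<le> f j" using Suc by simp
      also have "f j \<le> f (Suc j)" using Suc.prems False by (intro step) auto
      finally show ?thesis .
    qed simp
  qed simp
  have img: "f ` {1..n} = {..<m}"
  proof -
    have "f ` {1..n} = r ` (y ` {1..n})" by (simp add: f_def image_comp)
    then show ?thesis using permutes_image[OF py] r by (simp add: onto_words_def)
  qed
  define S where "S = {i \<in> {1..<n}. f i < f (Suc i)}"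
  have S: "S \<subseteq> {1..<n}" by (auto simp: S_def)
  have fr: "f i = row_index S i" if "i \<in> {1..n}" for i
    using that
  proof (induction i)
    case (Suc i)
    show ?case
    proof (cases "i = 0")
      case True
      have "0 < m" using img n by fastforce
      then have "0 \<in> f ` {1..n}" using img by simp
      then obtain k where "k \<in> {1..n}" "f k = 0" by force
      then have "f 1 \<le> 0" using mono[of 1 k] by simp
      moreover have "{t \<in> S. t < Suc 0} = {}" using S by auto
      then have "row_index S (Suc 0) = 0" by (simp only: row_index_def card.empty)
      ultimately show ?thesis using True by simp
    next
      case False
      then have i: "i \<in> {1..<n}" using Suc.prems by auto
      then have IH: "f i = row_index S i" by (intro Suc.IH) auto
      have "f (Suc i) \<le> Suc (f i)"
      proof (rule ccontr)
        assume "\<not> ?thesis"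
        then have less: "Suc (f i) < f (Suc i)" by simp
        also have "f (Suc i) < m" using img Suc.prems by blast
        finally have "Suc (f i) \<in> f ` {1..n}" using img by simp
        then obtain k where k: "k \<in> {1..n}" "f k = Suc (f i)" by force
        then have "\<not> k \<le> i" using mono[of k i] i by auto
        then have "f (Suc i) \<le> f k" using k Suc.prems by (intro mono) auto
        then show False using k less by simp
      qed
      then have "f (Suc i) = f i + (if i \<in> S then 1 else 0)"
        using step[OF i] i by (auto simp: S_def)
      then show ?thesis by (simp add: row_index_Suc IH)
    qed
  qed simp
  have eq: "r = row_word n S y"
  proof
    fix k show "r k = row_word n S y k"
    proof (cases "k \<in> {1..n}")
      case True
      then have "inv' y k \<in> {1..n}" using permutes_in_image[OF permutes_inv[OF py]] by blast
      from fr[OF this] show ?thesis using True permutes_inverses(1)[OF py] by (simp add: row_word_def f_def)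
    next
      case False
      then show ?thesis using r by (auto simp: row_word_def onto_words_def PiE_iff extensional_def)
    qed
  qed
  have "r ` {1..n} = {..<Suc (card S)}"
    using row_word_onto[OF S n py] eq by (simp add: onto_words_def)
  moreover have "r ` {1..n} = {..<m}" using r by (simp add: onto_words_def)
  ultimately have "{..<Suc (card S)} = {..<m}" by simp
  then have "card {..<Suc (card S)} = card {..<m}" by simp
  then show thesis using that[OF S _ py eq] by simp
qed

lemma card_fixed_onto_words:
  assumes n: "n \<ge> 1"
  shows "card {r \<in> onto_words n (Suc m). \<forall>i\<in>{1..n}. r (\<pi> i) = r i}
       = (\<Sum>S\<in>{S \<in> Pow {1..<n}. card S = m}. card {r \<in> row_word n S ` perms n. \<forall>i\<in>{1..n}. r (\<pi> i) = r i})"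
proof -
  let ?Q = "\<lambda>r. \<forall>i\<in>{1..n}. r (\<pi> i) = r i"
  let ?I = "{S \<in> Pow {1..<n}. card S = m}"
  have "{r \<in> onto_words n (Suc m). ?Q r} = (\<Union>S\<in>?I. {r \<in> row_word n S ` perms n. ?Q r})"
  proof (intro equalityI subsetI)
    fix r assume r: "r \<in> {r \<in> onto_words n (Suc m). ?Q r}"
    then have "r \<in> onto_words n (Suc m)" by simp
    from onto_word_is_row_word[OF this n] obtain S u
      where "S \<subseteq> {1..<n}" "Suc (card S) = Suc m" "u permutes {1..n}" "r = row_word n S u" by metis
    then have "S \<in> ?I" "r \<in> row_word n S ` perms n" by auto
    then show "r \<in> (\<Union>S\<in>?I. {r \<in> row_word n S ` perms n. ?Q r})" using r by blast
  next
    fix r assume "r \<in> (\<Union>S\<in>?I. {r \<in> row_word n S ` perms n. ?Q r})"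
    then obtain S u where "S \<subseteq> {1..<n}" "card S = m" "u permutes {1..n}" "r = row_word n S u" "?Q r" by blast
    then show "r \<in> {r \<in> onto_words n (Suc m). ?Q r}" using row_word_onto[OF _ n] by blast
  qed
  then have "card {r \<in> onto_words n (Suc m). ?Q r} = card (\<Union>S\<in>?I. {r \<in> row_word n S ` perms n. ?Q r})"
    by (rule arg_cong)
  also have "\<dots> = (\<Sum>S\<in>?I. card {r \<in> row_word n S ` perms n. ?Q r})"
  proof (rule card_UN_disjoint)
    show "\<forall>S\<in>?I. finite {r \<in> row_word n S ` perms n. ?Q r}"
    proof
      fix S
      show "finite {r \<in> row_word n S ` perms n. ?Q r}"
        by (rule finite_subset[OF _ finite_imageI[OF finite_perms[of n], of "row_word n S"]]) blast
    qed
    show "\<forall>S\<in>?I. \<forall>S'\<in>?I. S \<noteq> S' \<longrightarrow> {r \<in> row_word n S ` perms n. ?Q r} \<inter> {r \<in> row_word n S' ` perms n. ?Q r} = {}"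
      using row_words_disjoint by blast
  qed simp
  finally show ?thesis .
qed

lemma sum_Pow_card: "finite A \<Longrightarrow> (\<Sum>I\<in>Pow A. f (card I)) = (\<Sum>m\<le>card A. (card A choose m) * f m)"
  for f :: "nat \<Rightarrow> nat"
proof -
  assume A: "finite A"
  have "(\<Sum>I\<in>Pow A. f (card I)) = (\<Sum>m\<in>{..card A}. \<Sum>I\<in>{I \<in> Pow A. card I = m}. f (card I))"
    by (rule sum.group[symmetric]) (use A card_mono in auto)
  also have "\<dots> = (\<Sum>m\<le>card A. (card A choose m) * f m)"
  proof (rule sum.cong[OF refl])
    fix m
    have "(\<Sum>I\<in>{I \<in> Pow A. card I = m}. f (card I)) = (\<Sum>I\<in>{I \<in> Pow A. card I = m}. f m)"
      by (intro sum.cong) auto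
    also have "\<dots> = (card A choose m) * f m" using n_subsets[OF A, of m] by simp
    finally show "(\<Sum>I\<in>{I \<in> Pow A. card I = m}. f (card I)) = (card A choose m) * f m" .
  qed
  finally show ?thesis .
qed

text \<open>A word amounts to the set of its \<open>m\<close> letters and a word onto \<open>m\<close> letters.\<close>

lemma card_fixed_words_by_image:
  assumes \<pi>: "\<pi> permutes {1..n}"
  shows "card {w \<in> {1..n} \<rightarrow>\<^sub>E {..<x}. \<forall>i\<in>{1..n}. w (\<pi> i) = w i}
       = (\<Sum>m\<le>x. (x choose m) * card {r \<in> onto_words n m. \<forall>i\<in>{1..n}. r (\<pi> i) = r i})"
proof -
  let ?Q = "\<lambda>w. \<forall>i\<in>{1..n}. w (\<pi> i) = w i"
  let ?W = "{w \<in> {1..n} \<rightarrow>\<^sub>E {..<x}. ?Q w}"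
  have finW: "finite ?W" by (rule finite_subset[of _ "{1..n} \<rightarrow>\<^sub>E {..<x}"]) (auto intro!: finite_PiE)
  have img: "card {w \<in> ?W. w ` {1..n} = I} = card {r \<in> onto_words n (card I). ?Q r}" if I: "I \<in> Pow {..<x}" for I
  proof -
    have finI: "finite I" using I finite_subset by blast
    obtain e where e: "bij_betw e {..<card I} I" using ex_bij_betw_nat_finite[OF finI] atLeast0LessThan by metis
    define d where "d = inv_into {..<card I} e"
    have d: "bij_betw d I {..<card I}" unfolding d_def by (rule bij_betw_inv_into[OF e])
    have de: "d (e k) = k" if "k < card I" for k
      using that e by (simp add: d_def bij_betw_def inv_into_f_f)
    have ed: "e (d v) = v" if "v \<in> I" for v
      using that e by (simp add: d_def bij_betw_def f_inv_into_f)
    define F where "F r = (\<lambda>i\<in>{1..n}. e (r i))" for r :: "nat \<Rightarrow> nat"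
    define D where "D w = (\<lambda>i\<in>{1..n}. d (w i))" for w :: "nat \<Rightarrow> nat"
    have pin: "\<pi> i \<in> {1..n}" if "i \<in> {1..n}" for i using permutes_in_image[OF \<pi>] that by blast
    have "bij_betw F {r \<in> onto_words n (card I). ?Q r} {w \<in> ?W. w ` {1..n} = I}"
    proof (rule bij_betw_byWitness[where f' = D])
      show "\<forall>r\<in>{r \<in> onto_words n (card I). ?Q r}. D (F r) = r"
      proof
        fix r assume r: "r \<in> {r \<in> onto_words n (card I). ?Q r}"
        then have rI: "r \<in> {1..n} \<rightarrow>\<^sub>E {..<card I}" by (simp add: onto_words_def)
        show "D (F r) = r"
        proof
          fix i show "D (F r) i = r i"
            using rI de[of "r i"] by (cases "i \<in> {1..n}") (auto simp: D_def F_def PiE_iff extensional_def)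
        qed
      qed
      show "\<forall>w\<in>{w \<in> ?W. w ` {1..n} = I}. F (D w) = w"
      proof
        fix w assume w: "w \<in> {w \<in> ?W. w ` {1..n} = I}"
        then have wI: "w \<in> extensional {1..n}" "w ` {1..n} = I" by (auto simp: PiE_iff)
        show "F (D w) = w"
        proof
          fix i show "F (D w) i = w i"
            using wI ed[of "w i"] by (cases "i \<in> {1..n}") (auto simp: D_def F_def extensional_def)
        qed
      qed
      show "F ` {r \<in> onto_words n (card I). ?Q r} \<subseteq> {w \<in> ?W. w ` {1..n} = I}"
      proof
        fix w assume "w \<in> F ` {r \<in> onto_words n (card I). ?Q r}"
        then obtain r where r: "r ` {1..n} = {..<card I}" "?Q r" "w = F r" by (auto simp: onto_words_def)
        have "w ` {1..n} = e ` (r ` {1..n})" by (simp add: r(3) F_def image_image)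
        then have wI: "w ` {1..n} = I" using r(1) e by (simp add: bij_betw_def)
        moreover have "?Q w" using r(2) pin by (simp add: r(3) F_def)
        moreover have "w \<in> {1..n} \<rightarrow>\<^sub>E {..<x}"
          using wI I by (auto simp: r(3) F_def PiE_iff)
        ultimately show "w \<in> {w \<in> ?W. w ` {1..n} = I}" by blast
      qed
      show "D ` {w \<in> ?W. w ` {1..n} = I} \<subseteq> {r \<in> onto_words n (card I). ?Q r}"
      proof
        fix r assume "r \<in> D ` {w \<in> ?W. w ` {1..n} = I}"
        then obtain w where w: "w ` {1..n} = I" "?Q w" "r = D w" by blast
        have "r ` {1..n} = d ` (w ` {1..n})" by (simp add: w(3) D_def image_image)
        then have rI: "r ` {1..n} = {..<card I}" using w(1) d by (simp add: bij_betw_def)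
        moreover have "?Q r" using w(2) pin by (simp add: w(3) D_def)
        moreover have "r \<in> {1..n} \<rightarrow>\<^sub>E {..<card I}"
          using rI by (auto simp: w(3) D_def PiE_iff)
        ultimately show "r \<in> {r \<in> onto_words n (card I). ?Q r}" by (simp add: onto_words_def)
      qed
    qed
    then show ?thesis by (rule bij_betw_same_card[symmetric])
  qed
  have "card ?W = (\<Sum>w\<in>?W. 1)" by simp
  also have "\<dots> = (\<Sum>I\<in>Pow {..<x}. \<Sum>w\<in>{w \<in> ?W. w ` {1..n} = I}. 1)"
    by (rule sum.group[symmetric, OF finW]) auto
  also have "\<dots> = (\<Sum>I\<in>Pow {..<x}. card {w \<in> ?W. w ` {1..n} = I})" by simp
  also have "\<dots> = (\<Sum>I\<in>Pow {..<x}. card {r \<in> onto_words n (card I). ?Q r})"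
    using img by (rule sum.cong[OF refl])
  also have "\<dots> = (\<Sum>m\<le>x. (x choose m) * card {r \<in> onto_words n m. ?Q r})"
    using sum_Pow_card[of "{..<x}" "\<lambda>m. card {r \<in> onto_words n m. ?Q r}"] by simp
  finally show ?thesis .
qed

text \<open>This is Vandermonde's identity: the supersets with \<open>m\<close> further elements are counted by a
  binomial coefficient.\<close>

lemma sum_supersets_binomial:
  assumes A: "finite A" and T: "T \<subseteq> A"
  shows "(\<Sum>S\<in>{S \<in> Pow A. T \<subseteq> S}. x choose Suc (card S)) = (x + card A - card T) choose Suc (card A)"
proof -
  define t where "t = card T"
  define N where "N = card (A - T)"
  have finT: "finite T" using T A finite_subset by blast
  have cA: "card A = t + N" using card_Un_disjoint[of T "A - T"] A T finT
    by (simp add: t_def N_def Un_absorb1)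
  have "(\<Sum>S\<in>{S \<in> Pow A. T \<subseteq> S}. x choose Suc (card S)) = (\<Sum>R\<in>Pow (A - T). x choose Suc (t + card R))"
  proof (rule sum.reindex_bij_witness[of _ "\<lambda>R. T \<union> R" "\<lambda>S. S - T"])
    fix S assume "S \<in> {S \<in> Pow A. T \<subseteq> S}"
    then have S: "S \<subseteq> A" "T \<subseteq> S" by auto
    then have "card S = card T + card (S - T)"
      using A finT by (metis card_Diff_subset card_mono finite_subset le_add_diff_inverse)
    then show "(x choose Suc (t + card (S - T))) = (x choose Suc (card S))" by (simp add: t_def)
  qed (use T in auto)
  also have "\<dots> = (\<Sum>m\<le>N. (N choose m) * (x choose Suc (t + m)))"
    using sum_Pow_card[of "A - T" "\<lambda>m. x choose Suc (t + m)"] A by (simp add: N_def)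
  also have "\<dots> = (\<Sum>k\<le>N. (N choose k) * (x choose (Suc (t + N) - k)))"
    by (rule sum.reindex_bij_witness[of _ "\<lambda>k. N - k" "\<lambda>k. N - k"])
       (auto simp: binomial_symmetric[symmetric] Suc_diff_le)
  also have "\<dots> = (\<Sum>k\<le>Suc (t + N). (N choose k) * (x choose (Suc (t + N) - k)))"
    by (rule sum.mono_neutral_left) auto
  also have "\<dots> = (N + x) choose Suc (t + N)" by (rule vandermonde)
  also have "\<dots> = (x + card A - card T) choose Suc (card A)" by (simp add: cA t_def add.commute)
  finally show ?thesis .
qed

text \<open>Both sides count words over \<open>x\<close> letters fixed by \<open>\<pi>\<close>. Grouped by letters used and by row
  type \<open>S\<close>, they contribute \<open>x choose (|S| + 1)\<close> times the trace on the row-invariant functions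
  for \<open>S\<close>, which is the sum of the traces on the ribbon modules of the subsets of \<open>S\<close>. Collecting
  the coefficient of each \<open>T\<close> gives the sum over its supersets.\<close>

theorem power_num_cycles_eq_sum_ribbons:
  assumes n: "n \<ge> 1" and \<pi>: "\<pi> permutes {1..n}"
  shows "of_nat x ^ num_cycles n \<pi>
       = (\<Sum>T\<in>Pow {1..<n}. of_nat ((x + n - 1 - card T) choose n) * trace_on (ribbon_module n T) (left_op \<pi>))"
proof -
  let ?A = "{1..<n}"
  define \<tau> where "\<tau> T = trace_on (ribbon_module n T) (left_op \<pi>)" for T
  define F where "F S = card {r \<in> row_word n S ` perms n. \<forall>i\<in>{1..n}. r (\<pi> i) = r i}" for S
  define K where "K m = card {r \<in> onto_words n m. \<forall>i\<in>{1..n}. r (\<pi> i) = r i}" for m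
  have F: "(of_nat (F S) :: complex) = (\<Sum>T\<in>Pow S. \<tau> T)" if "S \<subseteq> ?A" for S
    unfolding F_def \<tau>_def trace_row_invariant_eq_card[OF \<pi>, symmetric]
    by (rule trace_row_invariant_eq_sum[OF that \<pi>])
  have K0: "K 0 = 0"
    using n by (auto simp: K_def onto_words_def)
  have KS: "K (Suc m) = (\<Sum>S\<in>{S \<in> Pow ?A. card S = m}. F S)" for m
    unfolding K_def F_def by (rule card_fixed_onto_words[OF n])
  have "x ^ num_cycles n \<pi> = (\<Sum>m\<le>x. (x choose m) * K m)"
    using card_fixed_words[OF \<pi>, of "{..<x}"] card_fixed_words_by_image[OF \<pi>, of x] by (simp add: K_def)
  also have "\<dots> = (\<Sum>m\<le>x + n. (x choose m) * K m)" by (rule sum.mono_neutral_left) auto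
  also have "\<dots> = (\<Sum>m<x + n. (x choose Suc m) * K (Suc m))"
  proof -
    obtain q where q: "x + n = Suc q" using n by (cases "x + n") auto
    show ?thesis unfolding q by (subst sum.atMost_Suc_shift) (simp add: K0 lessThan_Suc_atMost)
  qed
  also have "\<dots> = (\<Sum>m\<in>{..<x + n}. \<Sum>S\<in>{S \<in> Pow ?A. card S = m}. (x choose Suc (card S)) * F S)"
    unfolding KS sum_distrib_left by (intro sum.cong refl) auto
  also have "\<dots> = (\<Sum>S\<in>Pow ?A. (x choose Suc (card S)) * F S)"
  proof (rule sum.group)
    show "card ` Pow ?A \<subseteq> {..<x + n}"
    proof
      fix k assume "k \<in> card ` Pow ?A"
      then have "k \<le> card ?A" using card_mono[of ?A] by auto
      then show "k \<in> {..<x + n}" using n by auto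
    qed
  qed auto
  finally have "of_nat x ^ num_cycles n \<pi> = (\<Sum>S\<in>Pow ?A. of_nat (x choose Suc (card S)) * (of_nat (F S) :: complex))"
    by (metis (no_types, lifting) of_nat_mult of_nat_power of_nat_sum sum.cong)
  also have "\<dots> = (\<Sum>S\<in>Pow ?A. \<Sum>T\<in>Pow ?A. if T \<subseteq> S then of_nat (x choose Suc (card S)) * \<tau> T else 0)"
  proof (rule sum.cong[OF refl])
    fix S assume S: "S \<in> Pow ?A"
    have "{T \<in> Pow ?A. T \<subseteq> S} = Pow S" using S by auto
    then have "(\<Sum>T\<in>Pow ?A. if T \<subseteq> S then of_nat (x choose Suc (card S)) * \<tau> T else 0)
        = (\<Sum>T\<in>Pow S. of_nat (x choose Suc (card S)) * \<tau> T)"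
      by (subst sum.inter_filter[symmetric]) simp_all
    then show "of_nat (x choose Suc (card S)) * of_nat (F S)
        = (\<Sum>T\<in>Pow ?A. if T \<subseteq> S then of_nat (x choose Suc (card S)) * \<tau> T else 0)"
      using F[of S] S by (simp add: sum_distrib_left)
  qed
  also have "\<dots> = (\<Sum>T\<in>Pow ?A. of_nat (\<Sum>S\<in>{S \<in> Pow ?A. T \<subseteq> S}. x choose Suc (card S)) * \<tau> T)"
  proof (rule trans[OF sum.swap sum.cong[OF refl]])
    fix T
    show "(\<Sum>S\<in>Pow ?A. if T \<subseteq> S then of_nat (x choose Suc (card S)) * \<tau> T else 0)
        = of_nat (\<Sum>S\<in>{S \<in> Pow ?A. T \<subseteq> S}. x choose Suc (card S)) * \<tau> T"
      by (subst sum.inter_filter[symmetric]) (simp_all add: sum_distrib_right)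
  qed
  also have "\<dots> = (\<Sum>T\<in>Pow ?A. of_nat ((x + n - 1 - card T) choose n) * \<tau> T)"
    using sum_supersets_binomial[of ?A _ x] n by (intro sum.cong refl) simp
  finally show ?thesis by (simp add: \<tau>_def)
qed

section \<open>Border shapes as lattice paths\<close>

text \<open>Columns are counted from the end of the path, so that its last cell lies in column \<open>0\<close>.\<close>

definition column_index :: "nat \<Rightarrow> nat set \<Rightarrow> nat \<Rightarrow> nat" where
  "column_index n T i = card ({i..<n} - T)"

definition ribbon_cell :: "nat \<Rightarrow> nat set \<Rightarrow> nat \<Rightarrow> cell" where
  "ribbon_cell n T i = (row_index T i, column_index n T i)"

definition ribbon :: "nat \<Rightarrow> nat set \<Rightarrow> cell set" where
  "ribbon n T = ribbon_cell n T ` {1..n}"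

lemma column_index_Suc:
  assumes "i < n"
  shows "column_index n T i = column_index n T (Suc i) + (if i \<in> T then 0 else 1)"
proof -
  have "{i..<n} - T = (if i \<in> T then {} else {i}) \<union> ({Suc i..<n} - T)" using assms by (auto simp: Suc_le_eq le_less)
  then show ?thesis by (simp add: column_index_def)
qed

lemma column_index_antimono: "i \<le> j \<Longrightarrow> column_index n T j \<le> column_index n T i"
  unfolding column_index_def by (rule card_mono) auto

lemma row_index_1: "T \<subseteq> {1..<n} \<Longrightarrow> row_index T (Suc 0) = 0"
proof -
  assume "T \<subseteq> {1..<n}"
  then have "{t \<in> T. t < Suc 0} = {}" by auto
  then show ?thesis by (simp only: row_index_def card.empty)
qed

lemma row_index_n: "T \<subseteq> {1..<n} \<Longrightarrow> row_index T n = card T"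
proof -
  assume "T \<subseteq> {1..<n}"
  then have "{t \<in> T. t < n} = T" by auto
  then show ?thesis by (simp only: row_index_def)
qed

lemma column_index_n: "column_index n T n = 0"
  by (simp add: column_index_def)

text \<open>Along the path, row minus column increases by one with each step.\<close>

lemma cell_content:
  assumes T: "T \<subseteq> {1..<n}" and i: "i \<in> {1..n}"
  shows "i + column_index n T i + card T = n + row_index T i"
proof -
  have "i \<le> n" using i by simp
  then show ?thesis
  proof (induction i rule: inc_induct)
    case base
    then show ?case by (simp add: column_index_n row_index_n[OF T])
  next
    case (step m)
    then show ?case using column_index_Suc[of m n T] row_index_Suc[of T m] by (auto split: if_splits)
  qed
qed

lemma inj_on_ribbon_cell:
  assumes "T \<subseteq> {1..<n}"
  shows "inj_on (ribbon_cell n T) {1..n}"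
proof (rule inj_onI)
  fix i j assume "i \<in> {1..n}" "j \<in> {1..n}" "ribbon_cell n T i = ribbon_cell n T j"
  then show "i = j" using cell_content[OF assms, of i] cell_content[OF assms, of j] by (simp add: ribbon_cell_def)
qed

text \<open>Both coordinates are monotone along the path, in opposite directions. The hypotheses
  therefore force the cells \<open>i\<close> and \<open>j\<close> into a common column or row, and the path between them
  stays in it.\<close>

lemma ribbon_between:
  assumes T: "T \<subseteq> {1..<n}" and i: "i \<in> {1..n}" and j: "j \<in> {1..n}"
    and le: "row_index T i \<le> r" "r \<le> row_index T j" "column_index n T i \<le> c" "c \<le> column_index n T j"
  shows "(r, c) \<in> ribbon n T"
proof -
  note ki = cell_content[OF T i] and kj = cell_content[OF T j]
  \<comment> \<open>The position on the path of a cell with the content of \<open>(r, c)\<close>.\<close>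
  define k where "k = n + r - c - card T"
  have cn: "c + card T \<le> n + r"
  proof (cases "i \<le> j")
    case True
    then have "c \<le> column_index n T i" using column_index_antimono[OF True, of n T] le by simp
    then show ?thesis using ki le by simp
  next
    case False
    then have "row_index T j \<le> r" using row_index_mono[of j i T] le by simp
    then show ?thesis using kj le by simp
  qed
  then have k: "k + c + card T = n + r" by (simp add: k_def)
  show ?thesis
  proof (cases "i \<le> j")
    case True
    have c: "column_index n T i = c" "column_index n T j = c"
      using column_index_antimono[OF True, of n T] le by auto
    then have ikj: "i \<le> k" "k \<le> j" using ki kj k le by auto
    then have "column_index n T k = c"
      using column_index_antimono[of i k n T] column_index_antimono[of k j n T] c by simp
    moreover have "k \<in> {1..n}" using ikj i j by auto
    moreover have "row_index T k = r" using cell_content[OF T \<open>k \<in> {1..n}\<close>] k \<open>column_index n T k = c\<close> by simp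
    ultimately show ?thesis unfolding ribbon_def ribbon_cell_def by blast
  next
    case False
    then have ji: "j \<le> i" by simp
    have r: "row_index T i = r" "row_index T j = r"
      using row_index_mono[OF ji, of T] le by auto
    then have jki: "j \<le> k" "k \<le> i" using ki kj k le by auto
    then have "row_index T k = r"
      using row_index_mono[of j k T] row_index_mono[of k i T] r by simp
    moreover have "k \<in> {1..n}" using jki i j by auto
    moreover have "column_index n T k = c" using cell_content[OF T \<open>k \<in> {1..n}\<close>] k \<open>row_index T k = r\<close> by simp
    ultimately show ?thesis unfolding ribbon_def ribbon_cell_def by blast
  qed
qed

text \<open>The ribbon is what remains of the Young diagram that it generates after removing the cells
  to its upper left, which form a Young diagram by the previous lemma.\<close>

lemma skew_shape_ribbon:
  assumes T: "T \<subseteq> {1..<n}"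
  shows "skew_shape (ribbon n T)"
proof -
  let ?D = "ribbon n T"
  \<comment> \<open>The Young diagram generated by the ribbon.\<close>
  define L where "L = (\<Union>x\<in>?D. {..fst x} \<times> {..snd x})"
  have DL: "?D \<subseteq> L" by (auto simp: L_def)
  have finL: "finite L" unfolding L_def ribbon_def by auto
  have downL: "(r', c') \<in> L" if rc: "(r, c) \<in> L" "r' \<le> r" "c' \<le> c" for r c r' c'
  proof -
    obtain x where "x \<in> ?D" "r \<le> fst x" "c \<le> snd x" using rc(1) by (auto simp: L_def)
    then show ?thesis using rc(2,3) unfolding L_def by (intro UN_I[of x]) auto
  qed
  have downM: "(r', c') \<in> L - ?D" if rc: "(r, c) \<in> L - ?D" "r' \<le> r" "c' \<le> c" for r c r' c'
  proof -
    have "(r', c') \<notin> ?D"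
    proof
      assume "(r', c') \<in> ?D"
      then obtain i where i: "i \<in> {1..n}" "r' = row_index T i" "c' = column_index n T i"
        by (auto simp: ribbon_def ribbon_cell_def)
      obtain j where j: "j \<in> {1..n}" "r \<le> row_index T j" "c \<le> column_index n T j"
        using rc(1) by (auto simp: L_def ribbon_def ribbon_cell_def)
      have "(r, c) \<in> ?D" by (rule ribbon_between[OF T i(1) j(1)]) (use rc i j in auto)
      then show False using rc(1) by blast
    qed
    then show ?thesis using downL rc by blast
  qed
  have "young_diagram L" unfolding young_diagram_def using finL downL by blast
  moreover have "young_diagram (L - ?D)"
    unfolding young_diagram_def using finite_Diff[OF finL] downM by blast
  moreover have "?D = L - (L - ?D)" using DL by blast
  ultimately show ?thesis unfolding skew_shape_def by blast
qed

lemma connected_ribbon: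
  assumes T: "T \<subseteq> {1..<n}"
  shows "connected_shape (ribbon n T)"
proof -
  let ?D = "ribbon n T"
  let ?R = "{(u, v). u \<in> ?D \<and> v \<in> ?D \<and> adjacent_cells u v}"
  have adj: "adjacent_cells (ribbon_cell n T i) (ribbon_cell n T (Suc i))" if "i < n" for i
    using column_index_Suc[OF that, of T] row_index_Suc[of T i]
    by (auto simp: adjacent_cells_def ribbon_cell_def)
  have sym: "adjacent_cells u v \<Longrightarrow> adjacent_cells v u" for u v
    by (auto simp: adjacent_cells_def)
  have fwd: "(ribbon_cell n T i, ribbon_cell n T j) \<in> ?R\<^sup>* \<and> (ribbon_cell n T j, ribbon_cell n T i) \<in> ?R\<^sup>*"
    if "1 \<le> i" "i \<le> j" "j \<le> n" for i j
    using that(2,3)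
  proof (induction j rule: dec_induct)
    case (step m)
    have "ribbon_cell n T m \<in> ?D" "ribbon_cell n T (Suc m) \<in> ?D"
      unfolding ribbon_def using step that(1) by auto
    then have "(ribbon_cell n T m, ribbon_cell n T (Suc m)) \<in> ?R" "(ribbon_cell n T (Suc m), ribbon_cell n T m) \<in> ?R"
      using adj[of m] sym step by auto
    then show ?case using step by (auto intro: rtrancl_into_rtrancl converse_rtrancl_into_rtrancl)
  qed simp
  have "(x, y) \<in> ?R\<^sup>*" if "x \<in> ?D" "y \<in> ?D" for x y
  proof -
    obtain i j where "i \<in> {1..n}" "x = ribbon_cell n T i" "j \<in> {1..n}" "y = ribbon_cell n T j"
      using \<open>x \<in> ?D\<close> \<open>y \<in> ?D\<close> unfolding ribbon_def by blast
    then show ?thesis using fwd[of i j] fwd[of j i] by (cases "i \<le> j") auto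
  qed
  then show ?thesis unfolding connected_shape_def by blast
qed

lemma ribbon_in_border_shapes:
  assumes T: "T \<subseteq> {1..<n}" and n: "n \<ge> 1"
  shows "ribbon n T \<in> border_shapes n (Suc (card T))"
proof -
  have "\<not> {(r, c), (r, Suc c), (Suc r, c), (Suc r, Suc c)} \<subseteq> ribbon n T" for r c
  proof
    assume "{(r, c), (r, Suc c), (Suc r, c), (Suc r, Suc c)} \<subseteq> ribbon n T"
    then have "(r, c) \<in> ribbon n T" "(Suc r, Suc c) \<in> ribbon n T" by auto
    then obtain i j where ij: "i \<in> {1..n}" "(r, c) = ribbon_cell n T i" "j \<in> {1..n}" "(Suc r, Suc c) = ribbon_cell n T j"
      unfolding ribbon_def by blast
    have "i = j" using cell_content[OF T ij(1)] cell_content[OF T ij(3)] ij(2,4) by (simp add: ribbon_cell_def)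
    then show False using ij(2,4) by (metis Pair_inject n_not_Suc_n)
  qed
  moreover have "card (ribbon n T) = n"
    unfolding ribbon_def by (subst card_image[OF inj_on_ribbon_cell[OF T]]) simp
  moreover have rows: "fst ` ribbon n T = {..card T}"
    unfolding ribbon_def image_image ribbon_cell_def using row_index_image[OF T n] by simp
  moreover have "0 \<in> snd ` ribbon n T"
  proof -
    have "ribbon_cell n T n \<in> ribbon n T" unfolding ribbon_def using n by auto
    moreover have "snd (ribbon_cell n T n) = 0" by (simp add: ribbon_cell_def column_index_n)
    ultimately show ?thesis by force
  qed
  ultimately show ?thesis
    using skew_shape_ribbon[OF T] connected_ribbon[OF T] unfolding border_shapes_def border_shape_def by auto
qed

lemma inj_on_ribbon:
  assumes n: "n \<ge> 1"
  shows "inj_on (ribbon n) (Pow {1..<n})"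
proof (rule inj_onI)
  fix S T assume S: "S \<in> Pow {1..<n}" and T: "T \<in> Pow {1..<n}" and eq: "ribbon n S = ribbon n T"
  have "Suc (card S) = Suc (card T)"
    using ribbon_in_border_shapes[of S n] ribbon_in_border_shapes[of T n] S T n eq by (auto simp: border_shapes_def)
  then have card: "card S = card T" by simp
  have cell: "row_index S i = row_index T i" if i: "i \<in> {1..n}" for i
  proof -
    have "ribbon_cell n S i \<in> ribbon n S" unfolding ribbon_def using i by blast
    then have "ribbon_cell n S i \<in> ribbon n T" unfolding eq .
    then obtain j where j: "j \<in> {1..n}" "ribbon_cell n S i = ribbon_cell n T j" unfolding ribbon_def by blast
    then have "i = j"
      using cell_content[of S n i] cell_content[of T n j] S T i card by (auto simp: ribbon_cell_def)
    then show ?thesis using j(2) by (simp add: ribbon_cell_def)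
  qed
  have "i \<in> S \<longleftrightarrow> i \<in> T" if i: "i \<in> {1..<n}" for i
  proof -
    have "row_index S i = row_index T i" by (rule cell) (use i in auto)
    moreover have "row_index S (Suc i) = row_index T (Suc i)" by (rule cell) (use i in auto)
    ultimately show ?thesis unfolding row_index_Suc by (cases "i \<in> S"; cases "i \<in> T") simp_all
  qed
  then show "S = T" using S T by blast
qed

definition content :: "cell \<Rightarrow> int" where
  "content x = int (snd x) - int (fst x)"

lemma adjacent_content: "adjacent_cells x y \<Longrightarrow> content x = content y + 1 \<or> content y = content x + 1"
  by (auto simp: adjacent_cells_def content_def)

lemma adjacent_content_cases:
  assumes "adjacent_cells x y" "content x = content y + 1"
  shows "(fst y = Suc (fst x) \<and> snd y = snd x) \<or> (fst y = fst x \<and> snd x = Suc (snd y))"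
  using assms by (auto simp: adjacent_cells_def content_def)

lemma skew_shape_convex:
  assumes "skew_shape D" "(a, b) \<in> D" "(a', b') \<in> D" "a \<le> r" "r \<le> a'" "b \<le> c" "c \<le> b'"
  shows "(r, c) \<in> D"
  using assms unfolding skew_shape_def young_diagram_def by blast

text \<open>Two cells on the same diagonal would span a \<open>2 \<times> 2\<close> square.\<close>

lemma border_shape_content_inj:
  assumes "border_shape D"
  shows "inj_on content D"
proof (rule inj_onI)
  have skew: "skew_shape D" and sq: "\<And>r c. \<not> {(r, c), (r, Suc c), (Suc r, c), (Suc r, Suc c)} \<subseteq> D"
    using assms unfolding border_shape_def by blast+
  have no: False if "(r, c) \<in> D" "(r', c') \<in> D" "r < r'" "content (r, c) = content (r', c')" for r c r' c'
  proof -
    have "c < c'" using that(3,4) by (simp add: content_def)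
    then have "{(r, c), (r, Suc c), (Suc r, c), (Suc r, Suc c)} \<subseteq> D"
      using that(3) by (auto intro!: skew_shape_convex[OF skew that(1,2)])
    then show False using sq by blast
  qed
  fix x y assume x: "x \<in> D" and y: "y \<in> D" and eq: "content x = content y"
  have "\<not> fst x < fst y" using no[of "fst x" "snd x" "fst y" "snd y"] x y eq by auto
  moreover have "\<not> fst y < fst x" using no[of "fst y" "snd y" "fst x" "snd x"] x y eq by auto
  ultimately have "fst x = fst y" by simp
  then show "x = y" using eq by (simp add: content_def prod_eq_iff)
qed

text \<open>Contents change by one between neighbours, so they take intermediate values along any chain
  of neighbours.\<close>

lemma connected_shape_crossing:
  assumes "connected_shape D" "x \<in> D" "y \<in> D" "content y \<le> c" "c < content x"
  obtains u v where "u \<in> D" "v \<in> D" "adjacent_cells u v" "content u = c + 1" "content v = c"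
proof -
  let ?R = "{(u, v). u \<in> D \<and> v \<in> D \<and> adjacent_cells u v}"
  have "(x, y) \<in> ?R\<^sup>*" using assms(1-3) unfolding connected_shape_def by blast
  then have "\<exists>u v. u \<in> D \<and> v \<in> D \<and> adjacent_cells u v \<and> content u = c + 1 \<and> content v = c"
    using assms(4)
  proof (induction rule: rtrancl_induct)
    case base
    then show ?case using assms(5) by simp
  next
    case (step y z)
    show ?case
    proof (cases "content y \<le> c")
      case False
      have yz: "y \<in> D" "z \<in> D" "adjacent_cells y z" using step.hyps(2) by auto
      moreover have "content y = c + 1" "content z = c"
        using adjacent_content[OF yz(3)] False step.prems by auto
      ultimately show ?thesis by blast
    qed (rule step.IH)
  qed
  then show thesis using that by blast
qed

text \<open>By connectedness the contents form an interval, and cells of consecutive contents are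
  neighbours. Reading the cells by decreasing content therefore gives a path that steps left or
  down.\<close>

lemma border_shape_is_ribbon:
  assumes D: "D \<in> border_shapes n (Suc k)" and n: "n \<ge> 1"
  obtains T where "T \<subseteq> {1..<n}" "card T = k" "D = ribbon n T"
proof -
  have bs: "border_shape D" and cardD: "card D = n" and rows: "card (fst ` D) = Suc k"
    and row0: "0 \<in> fst ` D" and col0: "0 \<in> snd ` D" using D by (auto simp: border_shapes_def)
  have conn: "connected_shape D" using bs by (simp add: border_shape_def)
  note inj = border_shape_content_inj[OF bs]
  have finD: "finite D" "D \<noteq> {}" using cardD n card_ge_0_finite[of D] by auto
  define a where "a = Max (content ` D)"
  define b where "b = Min (content ` D)"
  have aD: "a \<in> content ` D" and bD: "b \<in> content ` D" using finD by (auto simp: a_def b_def)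
  have range: "content ` D = {b..a}"
  proof (intro equalityI subsetI)
    fix c assume "c \<in> content ` D"
    then show "c \<in> {b..a}" using finD by (auto simp: a_def b_def)
  next
    fix c assume c: "c \<in> {b..a}"
    show "c \<in> content ` D"
    proof (cases "c = a")
      case False
      obtain x y where xy: "x \<in> D" "content x = a" "y \<in> D" "content y = b" using aD bD by force
      have le: "content y \<le> c" "c < content x" using c False xy by auto
      obtain u v where "v \<in> D" "content v = c"
        by (rule connected_shape_crossing[OF conn xy(1,3) le])
      then show ?thesis by blast
    qed (use aD in simp)
  qed
  have "card (content ` D) = n" using card_image[OF inj] cardD by simp
  then have ab: "b = a + 1 - int n" using range n by auto
  define x where "x i = inv_into D content (a + 1 - int i)" for i
  have x: "x i \<in> D" "content (x i) = a + 1 - int i" if i: "i \<in> {1..n}" for i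
  proof -
    have "a + 1 - int i \<in> content ` D" unfolding range ab using i by auto
    then show "x i \<in> D" "content (x i) = a + 1 - int i"
      unfolding x_def by (auto intro: inv_into_into f_inv_into_f)
  qed
  have D_eq: "D = x ` {1..n}"
  proof (intro equalityI subsetI)
    fix y assume y: "y \<in> D"
    then have "content y \<in> {b..a}" using range by blast
    then have i: "nat (a + 1 - content y) \<in> {1..n}" and le: "content y \<le> a" using ab by auto
    have "content (x (nat (a + 1 - content y))) = content y" using x(2)[OF i] le by simp
    then have "x (nat (a + 1 - content y)) = y" by (rule inj_onD[OF inj _ x(1)[OF i] y])
    then show "y \<in> x ` {1..n}" using imageI[OF i, of x] by metis
  qed (use x(1) in blast)
  have path: "(fst (x (Suc i)) = Suc (fst (x i)) \<and> snd (x (Suc i)) = snd (x i)) \<or>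
      (fst (x (Suc i)) = fst (x i) \<and> snd (x i) = Suc (snd (x (Suc i))))" if i: "i \<in> {1..<n}" for i
  proof -
    have i1: "i \<in> {1..n}" "Suc i \<in> {1..n}" using i by auto
    have le: "content (x (Suc i)) \<le> a + 1 - int (Suc i)" "a + 1 - int (Suc i) < content (x i)"
      using x(2)[OF i1(1)] x(2)[OF i1(2)] by simp_all
    obtain u v where uv: "u \<in> D" "v \<in> D" "adjacent_cells u v"
        "content u = a + 1 - int (Suc i) + 1" "content v = a + 1 - int (Suc i)"
      by (rule connected_shape_crossing[OF conn x(1)[OF i1(1)] x(1)[OF i1(2)] le])
    have "u = x i" by (rule inj_onD[OF inj _ uv(1) x(1)[OF i1(1)]]) (use uv(4) x(2)[OF i1(1)] in simp)
    moreover have "v = x (Suc i)" by (rule inj_onD[OF inj _ uv(2) x(1)[OF i1(2)]]) (use uv(5) x(2)[OF i1(2)] in simp)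
    ultimately show ?thesis using adjacent_content_cases[OF uv(3)] uv(4,5) by simp
  qed
  define T where "T = {i \<in> {1..<n}. fst (x (Suc i)) = Suc (fst (x i))}"
  have T: "T \<subseteq> {1..<n}" by (auto simp: T_def)
  have row: "fst (x i) = fst (x 1) + row_index T i" if "i \<in> {1..n}" for i
  proof -
    have "1 \<le> i" "i \<le> n" using that by auto
    then show ?thesis
    proof (induction i rule: dec_induct)
      case base
      then show ?case using row_index_1[OF T] by simp
    next
      case (step m)
      then have "m \<in> {1..<n}" by auto
      then show ?case using step.IH step.prems path[of m] row_index_Suc[of T m]
        by (auto simp: T_def)
    qed
  qed
  have col: "snd (x i) = snd (x n) + column_index n T i" if "i \<in> {1..n}" for i
  proof -
    have "1 \<le> i" "i \<le> n" using that by auto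
    from this(2,1) show ?thesis
    proof (induction i rule: inc_induct)
      case base
      then show ?case by (simp add: column_index_n)
    next
      case (step m)
      then have "m \<in> {1..<n}" by auto
      then show ?case using step.IH step.prems path[of m] column_index_Suc[of m n T]
        by (auto simp: T_def)
    qed
  qed
  have "fst (x 1) = 0"
  proof -
    obtain i where "i \<in> {1..n}" "fst (x i) = 0" using row0 unfolding D_eq by force
    then show ?thesis using row[of i] by simp
  qed
  moreover have "snd (x n) = 0"
  proof -
    obtain i where "i \<in> {1..n}" "snd (x i) = 0" using col0 unfolding D_eq by force
    then show ?thesis using col[of i] by simp
  qed
  ultimately have "x i = ribbon_cell n T i" if "i \<in> {1..n}" for i
    using row[OF that] col[OF that] by (simp add: ribbon_cell_def prod_eq_iff)
  then have DT: "D = ribbon n T" unfolding D_eq ribbon_def by (rule image_cong[OF refl])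
  have "Suc (card T) = Suc k"
    using ribbon_in_border_shapes[OF T n] rows by (simp add: DT border_shapes_def)
  then show thesis using that[OF T _ DT] by simp
qed

lemma border_shapes_eq:
  assumes n: "n \<ge> 1"
  shows "border_shapes n (Suc k) = ribbon n ` {T \<in> Pow {1..<n}. card T = k}"
proof (intro equalityI subsetI)
  fix D assume "D \<in> border_shapes n (Suc k)"
  from border_shape_is_ribbon[OF this n] obtain T where "T \<subseteq> {1..<n}" "card T = k" "D = ribbon n T" .
  then show "D \<in> ribbon n ` {T \<in> Pow {1..<n}. card T = k}" by blast
next
  fix D assume "D \<in> ribbon n ` {T \<in> Pow {1..<n}. card T = k}"
  then obtain T where "T \<subseteq> {1..<n}" "card T = k" "D = ribbon n T" by blast
  then show "D \<in> border_shapes n (Suc k)" using ribbon_in_border_shapes[OF _ n] by blast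
qed

section \<open>Skew Specht modules of ribbons inside the regular representation\<close>

text \<open>Two tableaux, read as permutations, have the same rows exactly if they differ by a right
  multiplication with a row permutation; the same holds for columns.\<close>

lemma blocks_image_eq_iff:
  assumes u: "u permutes {1..n}" and v: "v permutes {1..n}"
  shows "(\<forall>r. v ` {i \<in> {1..n}. \<beta> i = r} = u ` {i \<in> {1..n}. \<beta> i = r}) \<longleftrightarrow> (\<exists>y\<in>young_subgroup n \<beta>. v = u \<circ> y)"
    (is "?L \<longleftrightarrow> ?R")
proof
  assume L: ?L
  define y where "y = inv' u \<circ> v"
  have py: "y permutes {1..n}" unfolding y_def by (rule permutes_compose[OF v permutes_inv[OF u]])
  have "\<beta> (y i) = \<beta> i" if i: "i \<in> {1..n}" for i
  proof -
    have "v i \<in> v ` {k \<in> {1..n}. \<beta> k = \<beta> i}" using i by blast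
    then have "v i \<in> u ` {k \<in> {1..n}. \<beta> k = \<beta> i}" using L by blast
    then obtain k where k: "\<beta> k = \<beta> i" "v i = u k" by blast
    then have "y i = k" using permutes_inverses(2)[OF u] by (simp add: y_def)
    then show ?thesis using k by simp
  qed
  then have "y \<in> young_subgroup n \<beta>" using py by (simp add: young_subgroup_def)
  moreover have "v = u \<circ> y" using permutes_inv_o(1)[OF u] by (simp add: y_def o_assoc)
  ultimately show ?R by blast
next
  assume ?R
  then obtain y where y: "y \<in> young_subgroup n \<beta>" "v = u \<circ> y" by blast
  have sub: "z ` {i \<in> {1..n}. \<beta> i = r} \<subseteq> {i \<in> {1..n}. \<beta> i = r}" if "z \<in> young_subgroup n \<beta>" for z r
    using that permutes_in_image[OF young_permutes[OF that]] by (auto simp: young_subgroup_def simp del: atLeastAtMost_iff)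
  have "y ` {i \<in> {1..n}. \<beta> i = r} = {i \<in> {1..n}. \<beta> i = r}" for r
  proof
    show "{i \<in> {1..n}. \<beta> i = r} \<subseteq> y ` {i \<in> {1..n}. \<beta> i = r}"
    proof
      fix i assume "i \<in> {i \<in> {1..n}. \<beta> i = r}"
      then have "inv' y i \<in> {i \<in> {1..n}. \<beta> i = r}" using sub[OF young_inv[OF y(1)], of r] by blast
      then show "i \<in> y ` {i \<in> {1..n}. \<beta> i = r}"
        using permutes_inverses(1)[OF young_permutes[OF y(1)], of i] by (metis imageI)
    qed
  qed (rule sub[OF y(1)])
  then show ?L by (simp only: y(2) image_comp[symmetric] simp_thms)
qed

text \<open>Reading columns from the other end numbers the blocks of the complement of \<open>T\<close> backwards,
  which does not change the blocks.\<close>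

lemma young_column_index: "young_subgroup n (column_index n T) = row_group n ({1..<n} - T)"
proof -
  have eq: "row_index ({1..<n} - T) i + column_index n T i = card ({1..<n} - T)" if i: "i \<in> {1..n}" for i
  proof -
    have "{1..<n} - T = {t \<in> {1..<n} - T. t < i} \<union> ({i..<n} - T)" using i by auto
    then have "card ({1..<n} - T) = card ({t \<in> {1..<n} - T. t < i} \<union> ({i..<n} - T))" by (rule arg_cong)
    also have "\<dots> = row_index ({1..<n} - T) i + column_index n T i"
      unfolding row_index_def column_index_def by (rule card_Un_disjoint) auto
    finally show ?thesis by simp
  qed
  have iff: "row_index ({1..<n} - T) i = row_index ({1..<n} - T) j \<longleftrightarrow> column_index n T i = column_index n T j"
    if "i \<in> {1..n}" "j \<in> {1..n}" for i j
    using eq[OF that(1)] eq[OF that(2)] by linarith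
  show ?thesis
  proof
    show "young_subgroup n (column_index n T) \<subseteq> row_group n ({1..<n} - T)"
      by (rule young_mono) (use iff in blast)
    show "row_group n ({1..<n} - T) \<subseteq> young_subgroup n (column_index n T)"
      by (rule young_mono) (use iff in blast)
  qed
qed

text \<open>Listing entries along the path identifies the tableaux of a ribbon with permutations. The
  value \<open>0\<close> outside of the ribbon is the convention for tableaux.\<close>

definition path_tableau :: "nat \<Rightarrow> nat set \<Rightarrow> (nat \<Rightarrow> nat) \<Rightarrow> tableau" where
  "path_tableau n T w = (\<lambda>x. if x \<in> ribbon n T then w (inv_into {1..n} (ribbon_cell n T) x) else 0)"

context
  fixes n :: nat and T :: "nat set"
  assumes T: "T \<subseteq> {1..<n}"
begin

lemma path_tableau_cell: "i \<in> {1..n} \<Longrightarrow> path_tableau n T w (ribbon_cell n T i) = w i"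
  using inv_into_f_f[OF inj_on_ribbon_cell[OF T]] by (simp add: path_tableau_def ribbon_def)

lemma path_tableau_outside: "x \<notin> ribbon n T \<Longrightarrow> path_tableau n T w x = 0"
  by (simp add: path_tableau_def)

lemma path_tableau_eq_iff:
  assumes "u permutes {1..n}" "v permutes {1..n}"
  shows "path_tableau n T u = path_tableau n T v \<longleftrightarrow> u = v"
proof
  assume eq: "path_tableau n T u = path_tableau n T v"
  show "u = v"
  proof
    fix i show "u i = v i"
    proof (cases "i \<in> {1..n}")
      case True
      then show ?thesis using path_tableau_cell[OF True, of u] path_tableau_cell[OF True, of v] eq by simp
    next
      case False
      then show ?thesis using permutes_not_in[OF assms(1)] permutes_not_in[OF assms(2)] by simp
    qed
  qed
qed simp

lemma path_tableau_comp:
  assumes "\<pi> permutes {1..n}"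
  shows "\<pi> \<circ> path_tableau n T w = path_tableau n T (\<pi> \<circ> w)"
proof -
  have "\<pi> 0 = 0" by (rule permutes_not_in[OF assms]) simp
  then show ?thesis by (auto simp: path_tableau_def)
qed

lemma tableaux_ribbon: "tableaux n (ribbon n T) = path_tableau n T ` perms n"
proof (intro equalityI subsetI)
  have bij: "bij_betw (ribbon_cell n T) {1..n} (ribbon n T)"
    using inj_on_ribbon_cell[OF T] by (simp add: bij_betw_def ribbon_def)
  {
    fix t assume t: "t \<in> tableaux n (ribbon n T)"
    define w where "w i = (if i \<in> {1..n} then t (ribbon_cell n T i) else i)" for i
    have "bij_betw (t \<circ> ribbon_cell n T) {1..n} {1..n}"
      using t by (intro bij_betw_trans[OF bij]) (simp add: tableaux_def)
    then have "bij_betw w {1..n} {1..n}"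
      by (rule iffD1[OF bij_betw_cong, rotated]) (simp add: w_def)
    then have "w permutes {1..n}" by (rule bij_imp_permutes) (simp only: w_def if_False)
    moreover have "t = path_tableau n T w"
    proof
      fix x show "t x = path_tableau n T w x"
      proof (cases "x \<in> ribbon n T")
        case True
        then obtain i where i: "i \<in> {1..n}" "x = ribbon_cell n T i" unfolding ribbon_def by blast
        then show ?thesis using path_tableau_cell[OF i(1), of w] by (simp add: w_def)
      next
        case False
        then have "t x = 0" using t unfolding tableaux_def by blast
        then show ?thesis using path_tableau_outside[OF False] by simp
      qed
    qed
    ultimately show "t \<in> path_tableau n T ` perms n" by blast
  next
    fix t assume "t \<in> path_tableau n T ` perms n"
    then obtain w where w: "w permutes {1..n}" "t = path_tableau n T w" by blast
    have "bij_betw (w \<circ> inv_into {1..n} (ribbon_cell n T)) (ribbon n T) {1..n}"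
      by (rule bij_betw_trans[OF bij_betw_inv_into[OF bij] permutes_imp_bij[OF w(1)]])
    then have "bij_betw t (ribbon n T) {1..n}"
      by (rule iffD1[OF bij_betw_cong, rotated]) (simp add: w(2) path_tableau_def)
    then show "t \<in> tableaux n (ribbon n T)"
      by (simp add: tableaux_def w(2) path_tableau_outside)
  }
qed

lemma path_tableau_row:
  "path_tableau n T w ` {x \<in> ribbon n T. fst x = r} = w ` {i \<in> {1..n}. row_index T i = r}"
proof -
  have "{x \<in> ribbon n T. fst x = r} = ribbon_cell n T ` {i \<in> {1..n}. row_index T i = r}"
    unfolding ribbon_def by (auto simp: ribbon_cell_def)
  then have "path_tableau n T w ` {x \<in> ribbon n T. fst x = r}
      = (\<lambda>i. path_tableau n T w (ribbon_cell n T i)) ` {i \<in> {1..n}. row_index T i = r}"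
    by (simp only: image_image)
  also have "\<dots> = w ` {i \<in> {1..n}. row_index T i = r}"
    by (rule image_cong[OF refl]) (use path_tableau_cell in blast)
  finally show ?thesis .
qed

lemma path_tableau_column:
  "path_tableau n T w ` {x \<in> ribbon n T. snd x = c} = w ` {i \<in> {1..n}. column_index n T i = c}"
proof -
  have "{x \<in> ribbon n T. snd x = c} = ribbon_cell n T ` {i \<in> {1..n}. column_index n T i = c}"
    unfolding ribbon_def by (auto simp: ribbon_cell_def)
  then have "path_tableau n T w ` {x \<in> ribbon n T. snd x = c}
      = (\<lambda>i. path_tableau n T w (ribbon_cell n T i)) ` {i \<in> {1..n}. column_index n T i = c}"
    by (simp only: image_image)
  also have "\<dots> = w ` {i \<in> {1..n}. column_index n T i = c}"
    by (rule image_cong[OF refl]) (use path_tableau_cell in blast)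
  finally show ?thesis .
qed

lemma tabloid_path_tableau:
  assumes u: "u permutes {1..n}"
  shows "tabloid n (ribbon n T) (path_tableau n T u) = (\<lambda>y. path_tableau n T (u \<circ> y)) ` row_group n T"
proof (intro equalityI subsetI)
  fix s assume "s \<in> tabloid n (ribbon n T) (path_tableau n T u)"
  then have s: "s \<in> path_tableau n T ` perms n"
      "\<forall>r. s ` {x \<in> ribbon n T. fst x = r} = path_tableau n T u ` {x \<in> ribbon n T. fst x = r}"
    unfolding tabloid_def tableaux_ribbon by blast+
  from s(1) obtain v where v: "v permutes {1..n}" "s = path_tableau n T v" by blast
  have v3: "\<forall>r. v ` {i \<in> {1..n}. row_index T i = r} = u ` {i \<in> {1..n}. row_index T i = r}"
    using s(2) unfolding v(2) path_tableau_row .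
  show "s \<in> (\<lambda>y. path_tableau n T (u \<circ> y)) ` row_group n T"
    using iffD1[OF blocks_image_eq_iff[OF u v(1)] v3] v(2) by blast
next
  fix s assume "s \<in> (\<lambda>y. path_tableau n T (u \<circ> y)) ` row_group n T"
  then obtain y where y: "y \<in> row_group n T" "s = path_tableau n T (u \<circ> y)" by blast
  have uy: "u \<circ> y permutes {1..n}" by (rule permutes_compose[OF young_permutes[OF y(1)] u])
  have "\<forall>r. (u \<circ> y) ` {i \<in> {1..n}. row_index T i = r} = u ` {i \<in> {1..n}. row_index T i = r}"
    using iffD2[OF blocks_image_eq_iff[OF u uy]] y(1) by blast
  then show "s \<in> tabloid n (ribbon n T) (path_tableau n T u)"
    unfolding tabloid_def tableaux_ribbon y(2) mem_Collect_eq path_tableau_row using uy by blast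
qed

lemma tabloid_eq_iff:
  assumes u: "u permutes {1..n}" and v: "v permutes {1..n}"
  shows "tabloid n (ribbon n T) (path_tableau n T u) = tabloid n (ribbon n T) (path_tableau n T v)
      \<longleftrightarrow> (\<exists>y\<in>row_group n T. u = v \<circ> y)"
proof
  assume "tabloid n (ribbon n T) (path_tableau n T u) = tabloid n (ribbon n T) (path_tableau n T v)"
  moreover have "path_tableau n T u \<in> tabloid n (ribbon n T) (path_tableau n T u)"
    unfolding tabloid_path_tableau[OF u] using young_id by (intro image_eqI[of _ _ id]) simp_all
  ultimately have "path_tableau n T u \<in> (\<lambda>y. path_tableau n T (v \<circ> y)) ` row_group n T"
    by (simp only: tabloid_path_tableau[OF v])
  then obtain y where y: "y \<in> row_group n T" "path_tableau n T u = path_tableau n T (v \<circ> y)" by blast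
  have "v \<circ> y permutes {1..n}" by (rule permutes_compose[OF young_permutes[OF y(1)] v])
  then have "u = v \<circ> y" using path_tableau_eq_iff[OF u] y(2) by blast
  then show "\<exists>y\<in>row_group n T. u = v \<circ> y" using y(1) by blast
next
  assume "\<exists>y\<in>row_group n T. u = v \<circ> y"
  then obtain y where y: "y \<in> row_group n T" "u = v \<circ> y" by blast
  have "(\<lambda>z. path_tableau n T (u \<circ> z)) ` row_group n T = (\<lambda>z. path_tableau n T (v \<circ> z)) ` row_group n T"
  proof (intro equalityI subsetI)
    fix s assume "s \<in> (\<lambda>z. path_tableau n T (u \<circ> z)) ` row_group n T"
    then obtain z where "z \<in> row_group n T" "s = path_tableau n T (u \<circ> z)" by blast
    then show "s \<in> (\<lambda>z. path_tableau n T (v \<circ> z)) ` row_group n T"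
      using young_comp[OF y(1)] y(2) by (intro image_eqI[of _ _ "y \<circ> z"]) (simp_all add: o_assoc)
  next
    fix s assume "s \<in> (\<lambda>z. path_tableau n T (v \<circ> z)) ` row_group n T"
    then obtain z where z: "z \<in> row_group n T" "s = path_tableau n T (v \<circ> z)" by blast
    have "u \<circ> (inv' y \<circ> z) = v \<circ> (y \<circ> inv' y) \<circ> z" by (simp add: y(2) o_assoc)
    then have "u \<circ> (inv' y \<circ> z) = v \<circ> z" using permutes_inv_o(1)[OF young_permutes[OF y(1)]] by simp
    then show "s \<in> (\<lambda>z. path_tableau n T (u \<circ> z)) ` row_group n T"
      using young_comp[OF young_inv[OF y(1)] z(1)] z(2) by (intro image_eqI[of _ _ "inv' y \<circ> z"]) simp_all
  qed
  then show "tabloid n (ribbon n T) (path_tableau n T u) = tabloid n (ribbon n T) (path_tableau n T v)"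
    by (simp only: tabloid_path_tableau[OF u] tabloid_path_tableau[OF v])
qed

text \<open>The column stabilizer permutes entries and the row and column groups permute positions,
  which accounts for the conjugation by \<open>w\<close>.\<close>

lemma column_stabilizer_path_tableau:
  assumes w: "w permutes {1..n}"
  shows "column_stabilizer n (ribbon n T) (path_tableau n T w) = (\<lambda>c. w \<circ> c \<circ> inv' w) ` row_group n ({1..<n} - T)"
proof -
  have iff: "\<pi> \<in> column_stabilizer n (ribbon n T) (path_tableau n T w)
      \<longleftrightarrow> \<pi> permutes {1..n} \<and> (\<exists>c\<in>row_group n ({1..<n} - T). \<pi> \<circ> w = w \<circ> c)" for \<pi>
  proof (cases "\<pi> permutes {1..n}")
    case True
    have "\<pi> \<circ> w permutes {1..n}" by (rule permutes_compose[OF w True])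
    from blocks_image_eq_iff[OF w this, of "column_index n T"] show ?thesis
      using True unfolding column_stabilizer_def mem_Collect_eq path_tableau_column young_column_index
      by (simp only: image_comp)
  qed (simp add: column_stabilizer_def)
  have conj: "\<pi> \<circ> w = w \<circ> c \<longleftrightarrow> \<pi> = w \<circ> c \<circ> inv' w" for \<pi> c
    using permutes_inv_o[OF w] by (metis comp_id o_assoc)
  have "w \<circ> c \<circ> inv' w permutes {1..n}" if "c \<in> row_group n ({1..<n} - T)" for c
    by (rule permutes_compose[OF permutes_inv[OF w] permutes_compose[OF young_permutes[OF that] w]])
  then show ?thesis using iff conj by blast
qed

lemma polytabloid_path_tableau:
  assumes w: "w permutes {1..n}"
  shows "polytabloid n (ribbon n T) (path_tableau n T w) A
       = (\<Sum>c\<in>row_group n ({1..<n} - T). of_int (sign c) *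
            (if A = tabloid n (ribbon n T) (path_tableau n T (w \<circ> c)) then 1 else 0))"
proof -
  let ?C = "row_group n ({1..<n} - T)"
  let ?f = "\<lambda>\<pi>. of_int (sign \<pi>) * (if A = tabloid n (ribbon n T) (\<pi> \<circ> path_tableau n T w) then 1 else 0 :: complex)"
  have inj: "inj_on (\<lambda>c. w \<circ> c \<circ> inv' w) ?C"
  proof (rule inj_onI)
    fix c d assume "w \<circ> c \<circ> inv' w = w \<circ> d \<circ> inv' w"
    then have "inv' w \<circ> (w \<circ> c \<circ> inv' w) \<circ> w = inv' w \<circ> (w \<circ> d \<circ> inv' w) \<circ> w" by simp
    moreover have "inv' w \<circ> (w \<circ> c \<circ> inv' w) \<circ> w = c" for c
      using permutes_inverses(2)[OF w] by (simp add: fun_eq_iff)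
    ultimately show "c = d" by simp
  qed
  have "polytabloid n (ribbon n T) (path_tableau n T w) A
      = (\<Sum>\<pi>\<in>(\<lambda>c. w \<circ> c \<circ> inv' w) ` ?C. ?f \<pi>)"
    by (simp only: polytabloid_def column_stabilizer_path_tableau[OF w])
  also have "\<dots> = (\<Sum>c\<in>?C. ?f (w \<circ> c \<circ> inv' w))"
    by (subst sum.reindex[OF inj]) (simp only: o_def)
  also have "\<dots> = (\<Sum>c\<in>?C. of_int (sign c) *
            (if A = tabloid n (ribbon n T) (path_tableau n T (w \<circ> c)) then 1 else 0))"
  proof (rule sum.cong[OF refl])
    fix c assume c: "c \<in> ?C"
    have pc: "permutation c" "permutation w" "permutation (inv' w)"
      using young_permutes[OF c] w permutes_inv[OF w] permutation_permutes by blast+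
    have pw: "w \<circ> c \<circ> inv' w permutes {1..n}"
      by (rule permutes_compose[OF permutes_inv[OF w] permutes_compose[OF young_permutes[OF c] w]])
    have "sign (w \<circ> c \<circ> inv' w) = sign w * sign c * sign w"
      using pc by (simp add: sign_compose permutation_compose sign_inverse)
    then have sgn: "sign (w \<circ> c \<circ> inv' w) = sign c" by (simp add: sign_def)
    have "(w \<circ> c \<circ> inv' w) \<circ> w = w \<circ> c" using permutes_inv_o(2)[OF w] by (simp add: o_assoc[symmetric])
    then show "?f (w \<circ> c \<circ> inv' w) = of_int (sign c) *
            (if A = tabloid n (ribbon n T) (path_tableau n T (w \<circ> c)) then 1 else 0)"
      by (simp only: sgn path_tableau_comp[OF pw])
  qed
  finally show ?thesis .
qed

text \<open>The tabloid of \<open>u\<close> is the coset of \<open>u\<close> under the row group, so functions of tabloids are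
  row-invariant functions of permutations.\<close>

definition tabloid_pullback :: "(tableau set \<Rightarrow> complex) \<Rightarrow> (nat \<Rightarrow> nat) \<Rightarrow> complex" where
  "tabloid_pullback v = (\<lambda>u. if u \<in> perms n then v (tabloid n (ribbon n T) (path_tableau n T u)) else 0)"

lemma linear_map_tabloid_pullback: "linear_map tabloid_pullback"
  by (auto simp: linear_map_def tabloid_pullback_def fun_eq_iff)

lemma pullback_polytabloid:
  assumes w: "w permutes {1..n}"
  shows "tabloid_pullback (polytabloid n (ribbon n T) (path_tableau n T w)) = ribbon_vector n T w"
proof
  fix u
  show "tabloid_pullback (polytabloid n (ribbon n T) (path_tableau n T w)) u = ribbon_vector n T w u"
  proof (cases "u permutes {1..n}")
    case True
    show ?thesis
      unfolding ribbon_vector_apply[OF w] tabloid_pullback_def polytabloid_path_tableau[OF w]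
      using True tabloid_eq_iff[OF True permutes_compose[OF young_permutes w]]
      by (simp cong: sum.cong)
  next
    case False
    have "\<not> (\<exists>y\<in>row_group n T. u = w \<circ> c \<circ> y)" if "c \<in> row_group n ({1..<n} - T)" for c
      using False permutes_compose[OF young_permutes permutes_compose[OF young_permutes[OF that] w]] by blast
    then have "ribbon_vector n T w u = 0"
      unfolding ribbon_vector_apply[OF w] by (intro sum.neutral) simp
    then show ?thesis using False by (simp add: tabloid_pullback_def)
  qed
qed

lemma pullback_specht_module: "tabloid_pullback ` specht_module n (ribbon n T) = ribbon_module n T"
proof -
  have "tabloid_pullback ` specht_module n (ribbon n T)
      = fun_space.span (tabloid_pullback ` polytabloid n (ribbon n T) ` path_tableau n T ` perms n)"
    unfolding specht_module_def tableaux_ribbon by (rule linear_map_image_span[OF linear_map_tabloid_pullback])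
  also have "tabloid_pullback ` polytabloid n (ribbon n T) ` path_tableau n T ` perms n = ribbon_vector n T ` perms n"
    unfolding image_image by (rule image_cong[OF refl]) (simp add: pullback_polytabloid)
  finally show ?thesis by (simp only: ribbon_module_eq_span)
qed

abbreviation ribbon_tabloids :: "tableau set set" where
  "ribbon_tabloids \<equiv> (\<lambda>u. tabloid n (ribbon n T) (path_tableau n T u)) ` perms n"

lemma specht_module_supported: "specht_module n (ribbon n T) \<subseteq> supported_on ribbon_tabloids"
  unfolding specht_module_def tableaux_ribbon
proof (rule fun_space.span_minimal)
  show "polytabloid n (ribbon n T) ` path_tableau n T ` perms n \<subseteq> supported_on ribbon_tabloids"
  proof
    fix v assume "v \<in> polytabloid n (ribbon n T) ` path_tableau n T ` perms n"
    then obtain w where w: "w permutes {1..n}" "v = polytabloid n (ribbon n T) (path_tableau n T w)" by blast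
    have "v A = 0" if A: "A \<notin> ribbon_tabloids" for A
    proof -
      have "A \<noteq> tabloid n (ribbon n T) (path_tableau n T (w \<circ> c))" if "c \<in> row_group n ({1..<n} - T)" for c
        using A permutes_compose[OF young_permutes[OF that] w(1)] by blast
      then show ?thesis unfolding w(2) polytabloid_path_tableau[OF w(1)] by (intro sum.neutral) simp
    qed
    then show "v \<in> supported_on ribbon_tabloids" by (simp add: supported_on_def)
  qed
  show "fun_space.subspace (supported_on ribbon_tabloids)"
    by (rule finite_dim_subspace[OF finite_dim_supported_on[OF finite_imageI[OF finite_perms]]])
qed

lemma pullback_injective: "inj_on tabloid_pullback (supported_on ribbon_tabloids)"
proof (rule inj_onI)
  fix v w assume v: "v \<in> supported_on ribbon_tabloids" and w: "w \<in> supported_on ribbon_tabloids"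
    and eq: "tabloid_pullback v = tabloid_pullback w"
  show "v = w"
  proof
    fix A show "v A = w A"
    proof (cases "A \<in> ribbon_tabloids")
      case True
      then obtain u where "u \<in> perms n" "A = tabloid n (ribbon n T) (path_tableau n T u)" by blast
      then show ?thesis using fun_cong[OF eq, of u] by (simp add: tabloid_pullback_def)
    next
      case False
      then show ?thesis using v w by (simp add: supported_on_def)
    qed
  qed
qed

lemma image_tabloid:
  assumes \<pi>: "\<pi> permutes {1..n}" and u: "u permutes {1..n}"
  shows "(\<lambda>s. \<pi> \<circ> s) ` tabloid n (ribbon n T) (path_tableau n T u) = tabloid n (ribbon n T) (path_tableau n T (\<pi> \<circ> u))"
  unfolding tabloid_path_tableau[OF u] tabloid_path_tableau[OF permutes_compose[OF u \<pi>]] image_image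
  by (simp only: path_tableau_comp[OF \<pi>] o_assoc)

lemma linear_map_perm_action: "linear_map (perm_action \<pi>)"
  by (auto simp: linear_map_def perm_action_def)

lemma perm_action_supported:
  assumes \<pi>: "\<pi> permutes {1..n}" and v: "v \<in> supported_on ribbon_tabloids"
  shows "perm_action \<pi> v \<in> supported_on ribbon_tabloids"
proof -
  have "perm_action \<pi> v A = 0" if A: "A \<notin> ribbon_tabloids" for A
  proof -
    have "(\<lambda>s. inv' \<pi> \<circ> s) ` A \<notin> ribbon_tabloids"
    proof
      assume "(\<lambda>s. inv' \<pi> \<circ> s) ` A \<in> ribbon_tabloids"
      then obtain u where u: "u permutes {1..n}" "(\<lambda>s. inv' \<pi> \<circ> s) ` A = tabloid n (ribbon n T) (path_tableau n T u)"
        by blast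
      have "A = (\<lambda>s. \<pi> \<circ> s) ` (\<lambda>s. inv' \<pi> \<circ> s) ` A"
        using permutes_inv_o(1)[OF \<pi>] by (simp add: image_image o_assoc)
      also have "\<dots> = tabloid n (ribbon n T) (path_tableau n T (\<pi> \<circ> u))"
        unfolding u(2) by (rule image_tabloid[OF \<pi> u(1)])
      finally show False using A permutes_compose[OF u(1) \<pi>] by blast
    qed
    then show ?thesis using v by (simp add: perm_action_def supported_on_def)
  qed
  then show ?thesis by (simp add: supported_on_def)
qed

lemma pullback_perm_action:
  assumes \<pi>: "\<pi> permutes {1..n}"
  shows "tabloid_pullback (perm_action \<pi> v) = left_op \<pi> (tabloid_pullback v)"
proof
  fix u
  have iff: "inv' \<pi> \<circ> u permutes {1..n} \<longleftrightarrow> u permutes {1..n}"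
  proof
    assume "inv' \<pi> \<circ> u permutes {1..n}"
    then have "\<pi> \<circ> (inv' \<pi> \<circ> u) permutes {1..n}" by (rule permutes_compose[OF _ \<pi>])
    then show "u permutes {1..n}" using permutes_inv_o(1)[OF \<pi>] by (simp add: o_assoc)
  qed (rule permutes_compose[OF _ permutes_inv[OF \<pi>]])
  show "tabloid_pullback (perm_action \<pi> v) u = left_op \<pi> (tabloid_pullback v) u"
    using iff image_tabloid[OF permutes_inv[OF \<pi>], of u]
    by (simp add: tabloid_pullback_def perm_action_def left_op_def)
qed

text \<open>The pullback maps polytabloids to ribbon vectors and commutes with the action, and on
  functions supported on tabloids it is injective.\<close>

theorem specht_trace_eq_ribbon_trace:
  assumes \<pi>: "\<pi> permutes {1..n}"
  shows "trace_on (specht_module n (ribbon n T)) (perm_action \<pi>) = trace_on (ribbon_module n T) (left_op \<pi>)"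
proof -
  let ?V = "specht_module n (ribbon n T)"
  have inj: "inj_on tabloid_pullback ?V" by (rule inj_on_subset[OF pullback_injective specht_module_supported])
  have "trace_on ?V (perm_action \<pi>) = trace_on (tabloid_pullback ` ?V) (left_op \<pi>)"
  proof (rule trace_on_transfer(1))
    show "finite_dim ?V"
      unfolding specht_module_def tableaux_ribbon by (intro finite_dim_span finite_imageI finite_perms)
    show "perm_action \<pi> v \<in> ?V" if v: "v \<in> ?V" for v
    proof -
      have "tabloid_pullback v \<in> ribbon_module n T" using v pullback_specht_module by blast
      then have "tabloid_pullback (perm_action \<pi> v) \<in> ribbon_module n T"
        unfolding pullback_perm_action[OF \<pi>] by (rule ribbon_module_left_op[OF \<pi>])
      then obtain v' where v': "v' \<in> ?V" "tabloid_pullback (perm_action \<pi> v) = tabloid_pullback v'"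
        using pullback_specht_module by (metis imageE)
      have "perm_action \<pi> v = v'"
        by (rule inj_onD[OF pullback_injective, OF v'(2)])
           (use v v'(1) specht_module_supported perm_action_supported[OF \<pi>] in blast)+
      then show ?thesis using v'(1) by simp
    qed
    show "tabloid_pullback (perm_action \<pi> v) = left_op \<pi> (tabloid_pullback v)" for v
      by (rule pullback_perm_action[OF \<pi>])
  qed (rule linear_map_tabloid_pullback inj linear_map_perm_action linear_map_left_op)+
  then show ?thesis by (simp only: pullback_specht_module)
qed

end

section \<open>The Foulkes characters\<close>

text \<open>Ribbons with \<open>i + 1\<close> rows correspond to sets of \<open>i\<close> down steps.\<close>

lemma foulkes_character_eq:
  assumes n: "n \<ge> 1" and \<pi>: "\<pi> \<in> carrier (sym_group n)"
  shows "foulkes_character n i \<pi> = (\<Sum>T\<in>{T \<in> Pow {1..<n}. card T = i}. trace_on (ribbon_module n T) (left_op \<pi>))"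
proof -
  let ?I = "{T \<in> Pow {1..<n}. card T = i}"
  have p: "\<pi> permutes {1..n}" using \<pi> by (simp add: sym_group_carrier)
  have inj: "inj_on (ribbon n) ?I" by (rule inj_on_subset[OF inj_on_ribbon[OF n]]) blast
  have "foulkes_character n i \<pi> = (\<Sum>D\<in>ribbon n ` ?I. specht_character n D \<pi>)"
    using \<pi> border_shapes_eq[OF n, of i] by (simp only: foulkes_character_def restrict_apply if_True Suc_eq_plus1)
  also have "\<dots> = (\<Sum>T\<in>?I. specht_character n (ribbon n T) \<pi>)"
    by (subst sum.reindex[OF inj]) (simp only: o_def)
  also have "\<dots> = (\<Sum>T\<in>?I. trace_on (ribbon_module n T) (left_op \<pi>))"
    using \<pi> specht_trace_eq_ribbon_trace[OF _ p] by (intro sum.cong refl) (simp add: specht_character_def)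
  finally show ?thesis .
qed

lemma foulkes_character_in_characters:
  assumes n: "n \<ge> 1"
  shows "foulkes_character n i \<in> characters (sym_group n)"
proof -
  let ?G = "sym_group n"
  let ?\<chi> = "\<lambda>T. \<lambda>\<pi>\<in>carrier ?G. trace_on (ribbon_module n T) (left_op \<pi>)"
  have "?\<chi> T \<in> characters ?G" for T
    by (rule fun_rep_trace_in_characters[OF fun_rep_ribbon_module sym_group_is_group finite_sym_group])
  then have "(\<lambda>\<pi>\<in>carrier ?G. \<Sum>T\<in>{T \<in> Pow {1..<n}. card T = i}. ?\<chi> T \<pi>) \<in> characters ?G"
    by (rule characters_sum)
  moreover have "foulkes_character n i = (\<lambda>\<pi>\<in>carrier ?G. \<Sum>T\<in>{T \<in> Pow {1..<n}. card T = i}. ?\<chi> T \<pi>)"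
  proof
    fix \<pi>
    show "foulkes_character n i \<pi> = (\<lambda>\<pi>\<in>carrier ?G. \<Sum>T\<in>{T \<in> Pow {1..<n}. card T = i}. ?\<chi> T \<pi>) \<pi>"
    proof (cases "\<pi> \<in> carrier ?G")
      case True
      then show ?thesis by (simp add: foulkes_character_eq[OF n])
    next
      case False
      then show ?thesis by (simp add: foulkes_character_def)
    qed
  qed
  ultimately show ?thesis by simp
qed

theorem power_num_cycles_eq_sum_foulkes:
  assumes n: "n \<ge> 1" and \<pi>: "\<pi> \<in> carrier (sym_group n)"
  shows "of_nat x ^ num_cycles n \<pi> = (\<Sum>i<n. of_nat ((x + n - 1 - i) choose n) * foulkes_character n i \<pi>)"
proof -
  let ?\<tau> = "\<lambda>T. trace_on (ribbon_module n T) (left_op \<pi>)"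
  have p: "\<pi> permutes {1..n}" using \<pi> by (simp add: sym_group_carrier)
  have "of_nat x ^ num_cycles n \<pi> = (\<Sum>T\<in>Pow {1..<n}. of_nat ((x + n - 1 - card T) choose n) * ?\<tau> T)"
    by (rule power_num_cycles_eq_sum_ribbons[OF n p])
  also have "\<dots> = (\<Sum>i\<in>{..<n}. \<Sum>T\<in>{T \<in> Pow {1..<n}. card T = i}. of_nat ((x + n - 1 - card T) choose n) * ?\<tau> T)"
  proof (rule sum.group[symmetric])
    show "card ` Pow {1..<n} \<subseteq> {..<n}"
    proof
      fix k assume "k \<in> card ` Pow {1..<n}"
      then have "k \<le> card {1..<n}" using card_mono[of "{1..<n}"] by auto
      then show "k \<in> {..<n}" using n by auto
    qed
  qed auto
  also have "\<dots> = (\<Sum>i<n. of_nat ((x + n - 1 - i) choose n) * foulkes_character n i \<pi>)"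
    unfolding foulkes_character_eq[OF n \<pi>] sum_distrib_left by (intro sum.cong refl) auto
  finally show ?thesis .
qed

section \<open>Counting lattice points\<close>

text \<open>The matrix acts on row vectors \<open>s\<close> with indices \<open>1, \<dots>, n\<close> and yields row vectors with
  indices \<open>0, \<dots>, n - 1\<close>; with this shift it is unitriangular.\<close>

locale unitriangular =
  fixes n :: nat and B :: "nat \<Rightarrow> nat \<Rightarrow> int"
  assumes diag: "i < n \<Longrightarrow> B (Suc i) i = 1" and upper: "k \<le> i \<Longrightarrow> i < n \<Longrightarrow> B k i = 0"
begin

lemma solve: "\<exists>s. \<forall>i<n. (\<Sum>k\<in>{1..n}. s k * of_int (B k i)) = (t i :: real)"
proof -
  have "\<exists>s. \<forall>i<n. n - m \<le> i \<longrightarrow> (\<Sum>k\<in>{1..n}. s k * of_int (B k i)) = t i" if "m \<le> n" for m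
    using that
  proof (induction m)
    case (Suc m)
    then obtain s where s: "\<forall>i<n. n - m \<le> i \<longrightarrow> (\<Sum>k\<in>{1..n}. s k * of_int (B k i)) = t i" by auto
    define j where "j = n - Suc m"
    have j: "j < n" "Suc j = n - m" using Suc.prems by (auto simp: j_def)
    \<comment> \<open>Changing the coordinate of index \<open>j + 1\<close> corrects column \<open>j\<close> and, by triangularity, leaves
      the columns after it alone.\<close>
    define c where "c = t j - (\<Sum>k\<in>{1..n}. s k * of_int (B k j))"
    define s' where "s' k = (if k = Suc j then s k + c else s k)" for k
    have s': "(\<Sum>k\<in>{1..n}. s' k * of_int (B k i)) = (\<Sum>k\<in>{1..n}. s k * of_int (B k i)) + c * of_int (B (Suc j) i)" for i
    proof -
      have "(\<Sum>k\<in>{1..n}. s' k * of_int (B k i))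
          = (\<Sum>k\<in>{1..n}. s k * of_int (B k i) + (if k = Suc j then c * of_int (B (Suc j) i) else 0))"
        by (intro sum.cong) (auto simp: s'_def algebra_simps)
      then show ?thesis using j by (simp add: sum.distrib)
    qed
    have "(\<Sum>k\<in>{1..n}. s' k * of_int (B k i)) = t i" if i: "i < n" "n - Suc m \<le> i" for i
    proof (cases "i = j")
      case True
      then show ?thesis unfolding s' using diag[OF j(1)] by (simp add: c_def)
    next
      case False
      then have "n - m \<le> i" using i j by (simp add: j_def)
      then show ?thesis unfolding s' using s i upper[of "Suc j" i] j by simp
    qed
    then show ?case by blast
  qed simp
  from this[of n] show ?thesis by simp
qed

lemma integral_iff:
  fixes s :: "nat \<Rightarrow> real"
  shows "(\<forall>i<n. (\<Sum>k\<in>{1..n}. s k * of_int (B k i)) \<in> \<int>) \<longleftrightarrow> (\<forall>k\<in>{1..n}. s k \<in> \<int>)"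
proof
  assume int: "\<forall>i<n. (\<Sum>k\<in>{1..n}. s k * of_int (B k i)) \<in> \<int>"
  have "s (n - m) \<in> \<int>" if "m < n" for m
    using that
  proof (induction m rule: less_induct)
    case (less m)
    define i where "i = n - Suc m"
    have i: "i < n" "Suc i = n - m" using less.prems by (auto simp: i_def)
    have "(\<Sum>k\<in>{1..n}. s k * of_int (B k i)) = s (Suc i) * of_int (B (Suc i) i) + (\<Sum>k\<in>{1..n} - {Suc i}. s k * of_int (B k i))"
      using i by (intro sum.remove) auto
    then have "s (n - m) = (\<Sum>k\<in>{1..n}. s k * of_int (B k i)) - (\<Sum>k\<in>{1..n} - {Suc i}. s k * of_int (B k i))"
      using diag[OF i(1)] i(2) by simp
    also have "\<dots> \<in> \<int>"
    proof (rule Ints_diff)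
      show "(\<Sum>k\<in>{1..n} - {Suc i}. s k * of_int (B k i)) \<in> \<int>"
      proof (rule Ints_sum)
        fix k assume k: "k \<in> {1..n} - {Suc i}"
        show "s k * of_int (B k i) \<in> \<int>"
        proof (cases "k \<le> i")
          case True
          then show ?thesis using upper[OF True i(1)] by simp
        next
          case False
          then have "n - k < m" "k = n - (n - k)" using k i by auto
          then have "s k \<in> \<int>" using less.IH[of "n - k"] less.prems by auto
          then show ?thesis by (intro Ints_mult) auto
        qed
      qed
    qed (use int i in blast)
    finally show ?case .
  qed
  then show "\<forall>k\<in>{1..n}. s k \<in> \<int>"
  proof (intro ballI)
    fix k assume "k \<in> {1..n}"
    then have "n - k < n" "k = n - (n - k)" by auto
    then show "s k \<in> \<int>" using \<open>\<And>m. m < n \<Longrightarrow> s (n - m) \<in> \<int>\<close>[of "n - k"] by simp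
  qed
next
  assume "\<forall>k\<in>{1..n}. s k \<in> \<int>"
  then show "\<forall>i<n. (\<Sum>k\<in>{1..n}. s k * of_int (B k i)) \<in> \<int>"
    by (intro allI impI Ints_sum Ints_mult) auto
qed

text \<open>The vectors \<open>t\<close> that satisfy the condition on \<open>s\<close> form a lattice that contains all integral
  vectors, because \<open>B\<close> is invertible over the integers. The unit cube meets every coset of the
  integral vectors once, and representatives of the cosets are the \<open>s\<close> with \<open>s k = m / d k\<close> and
  \<open>0 \<le> m < d k\<close>. The bijection \<open>\<Phi>\<close> takes such a representative to the fractional parts of its
  image.\<close>

lemma card_cube_points:
  fixes d :: "nat \<Rightarrow> nat"
  assumes d: "\<And>k. k \<in> {1..n} \<Longrightarrow> d k > 0"
  shows "card {t \<in> {..<n} \<rightarrow>\<^sub>E {0..<1::real}. \<exists>s. (\<forall>i<n. t i = (\<Sum>k\<in>{1..n}. s k * of_int (B k i))) \<and> (\<forall>k\<in>{1..n}. s k * real (d k) \<in> \<int>)}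
       = (\<Prod>k\<in>{1..n}. d k)"
proof -
  let ?X = "{t \<in> {..<n} \<rightarrow>\<^sub>E {0..<1::real}. \<exists>s. (\<forall>i<n. t i = (\<Sum>k\<in>{1..n}. s k * of_int (B k i))) \<and> (\<forall>k\<in>{1..n}. s k * real (d k) \<in> \<int>)}"
  let ?M = "PiE {1..n} (\<lambda>k. {..<d k})"
  define T where "T s i = (\<Sum>k\<in>{1..n}. s k * of_int (B k i))" for s :: "nat \<Rightarrow> real" and i
  have T_diff: "T s i - T s' i = T (\<lambda>k. s k - s' k) i" for s s' i
    by (simp add: T_def sum_subtractf left_diff_distrib)
  have T_int: "(\<forall>i<n. T s i \<in> \<int>) \<longleftrightarrow> (\<forall>k\<in>{1..n}. s k \<in> \<int>)" for s
    unfolding T_def by (rule integral_iff)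
  define \<Phi> where "\<Phi> m = (\<lambda>i\<in>{..<n}. frac (T (\<lambda>k. real (m k) / real (d k)) i))" for m :: "nat \<Rightarrow> nat"
  have "bij_betw \<Phi> ?M ?X"
    unfolding bij_betw_def
  proof
    show "inj_on \<Phi> ?M"
    proof (rule inj_onI)
      fix m m' assume m: "m \<in> ?M" and m': "m' \<in> ?M" and eq: "\<Phi> m = \<Phi> m'"
      have "T (\<lambda>k. real (m k) / real (d k) - real (m' k) / real (d k)) i \<in> \<int>" if "i < n" for i
      proof -
        have "frac (T (\<lambda>k. real (m k) / real (d k)) i) = frac (T (\<lambda>k. real (m' k) / real (d k)) i)"
          using fun_cong[OF eq, of i] that by (simp add: \<Phi>_def)
        then have "T (\<lambda>k. real (m k) / real (d k)) i - T (\<lambda>k. real (m' k) / real (d k)) i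
            = of_int (\<lfloor>T (\<lambda>k. real (m k) / real (d k)) i\<rfloor> - \<lfloor>T (\<lambda>k. real (m' k) / real (d k)) i\<rfloor>)"
          by (simp add: frac_def)
        then show ?thesis unfolding T_diff by simp
      qed
      then have int: "\<forall>k\<in>{1..n}. real (m k) / real (d k) - real (m' k) / real (d k) \<in> \<int>"
        unfolding T_int[of "\<lambda>k. real (m k) / real (d k) - real (m' k) / real (d k)", symmetric] by simp
      show "m = m'"
      proof (rule PiE_ext[OF m m'])
        fix k assume k: "k \<in> {1..n}"
        then have mk: "m k < d k" "m' k < d k" using m m' by (auto simp: PiE_iff)
        obtain z where z: "real (m k) / real (d k) - real (m' k) / real (d k) = of_int z"
          by (rule Ints_cases[OF bspec[OF int k]])
        have dk: "real (d k) > 0" using d[OF k] by simp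
        have "0 \<le> real (m k) / real (d k)" "real (m k) / real (d k) < 1"
          "0 \<le> real (m' k) / real (d k)" "real (m' k) / real (d k) < 1" using mk dk by auto
        then have "-1 < real_of_int z" "real_of_int z < 1" using z by linarith+
        then have "z = 0" by linarith
        then show "m k = m' k" using z dk by simp
      qed
    qed
    show "\<Phi> ` ?M = ?X"
    proof (intro equalityI subsetI)
      fix t assume "t \<in> \<Phi> ` ?M"
      then obtain m where m: "m \<in> ?M" "t = \<Phi> m" by blast
      define s0 where "s0 k = real (m k) / real (d k)" for k
      define z where "z i = real_of_int \<lfloor>T s0 i\<rfloor>" for i
      \<comment> \<open>The integral vector \<open>z\<close> removed by taking fractional parts comes from an integral \<open>r\<close>.\<close>
      obtain r where r: "\<forall>i<n. T r i = z i" using solve[of z] unfolding T_def by blast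
      have "\<forall>i<n. T r i \<in> \<int>" using r by (simp add: z_def)
      then have rint: "r k \<in> \<int>" if "k \<in> {1..n}" for k using T_int that by blast
      have ti: "t i = T (\<lambda>k. s0 k - r k) i" if i: "i < n" for i
      proof -
        have "t i = T s0 i - z i" using i by (simp add: m(2) \<Phi>_def frac_def z_def s0_def[abs_def])
        then show ?thesis using i r T_diff[of s0 i r] by simp
      qed
      have den: "(s0 k - r k) * real (d k) \<in> \<int>" if k: "k \<in> {1..n}" for k
      proof -
        have "(s0 k - r k) * real (d k) = real (m k) - r k * real (d k)"
          using d[OF k] by (simp add: s0_def left_diff_distrib)
        also have "\<dots> \<in> \<int>" by (rule Ints_diff[OF Ints_of_nat Ints_mult[OF rint[OF k] Ints_of_nat]])
        finally show ?thesis .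
      qed
      have box: "t \<in> {..<n} \<rightarrow>\<^sub>E {0..<1}" by (auto simp: m(2) \<Phi>_def frac_lt_1)
      show "t \<in> ?X"
        by (intro CollectI conjI box exI[of _ "\<lambda>k. s0 k - r k"] allI impI ballI ti[unfolded T_def] den)
    next
      fix t assume "t \<in> ?X"
      then obtain s where t: "t \<in> {..<n} \<rightarrow>\<^sub>E {0..<1}" and s: "\<forall>i<n. t i = T s i" "\<forall>k\<in>{1..n}. s k * real (d k) \<in> \<int>"
        unfolding T_def by blast
      have "\<forall>k\<in>{1..n}. \<exists>z. s k * real (d k) = of_int z" using s(2) by (blast elim: Ints_cases)
      then obtain z where z: "\<And>k. k \<in> {1..n} \<Longrightarrow> s k * real (d k) = of_int (z k)" by metis
      define m where "m = (\<lambda>k\<in>{1..n}. nat (z k mod int (d k)))"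
      have mM: "m \<in> ?M" using d by (auto simp: m_def nat_less_iff)
      have diff: "s k - real (m k) / real (d k) = of_int (z k div int (d k))" if k: "k \<in> {1..n}" for k
      proof -
        have dk: "real (d k) > 0" using d[OF k] by simp
        have "real (m k) = real_of_int (z k mod int (d k))" using k d[OF k] by (simp add: m_def)
        also have "\<dots> = real_of_int (z k) - real_of_int (z k div int (d k)) * real (d k)"
          by (simp flip: minus_div_mult_eq_mod)
        also have "\<dots> = (s k - of_int (z k div int (d k))) * real (d k)"
          using z[OF k] by (simp add: left_diff_distrib)
        finally show ?thesis using dk by simp
      qed
      have "\<forall>k\<in>{1..n}. s k - real (m k) / real (d k) \<in> \<int>" using diff by simp
      then have int: "\<forall>i<n. T (\<lambda>k. s k - real (m k) / real (d k)) i \<in> \<int>" by (rule T_int[THEN iffD2])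
      have fr: "frac (T (\<lambda>k. real (m k) / real (d k)) i) = frac (T s i)" if i: "i < n" for i
      proof -
        have "T (\<lambda>k. s k - real (m k) / real (d k)) i \<in> \<int>" using int i by simp
        then obtain z where "T (\<lambda>k. s k - real (m k) / real (d k)) i = of_int z" by (rule Ints_cases)
        then have "T s i = T (\<lambda>k. real (m k) / real (d k)) i + of_int z"
          using T_diff[of s i "\<lambda>k. real (m k) / real (d k)"] by linarith
        then show ?thesis by (simp add: frac_def)
      qed
      have "t = \<Phi> m"
      proof
        fix i show "t i = \<Phi> m i"
        proof (cases "i < n")
          case True
          then have "t i \<in> {0..<1}" using t by (auto simp: PiE_iff)
          then have "frac (t i) = t i" by (simp add: frac_eq)
          then show ?thesis using True fr[OF True] s(1) by (simp add: \<Phi>_def)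
        next
          case False
          then show ?thesis using t by (auto simp: \<Phi>_def PiE_iff extensional_def)
        qed
      qed
      then show "t \<in> \<Phi> ` ?M" using mM by blast
    qed
  qed
  then have "card ?X = card ?M" by (rule bij_betw_same_card[symmetric])
  also have "\<dots> = (\<Prod>k\<in>{1..n}. d k)" by (subst card_PiE) auto
  finally show ?thesis .
qed

end

definition foulkes_matrix :: "nat \<Rightarrow> nat \<Rightarrow> nat \<Rightarrow> int" where
  "foulkes_matrix n k i = int ((k + n - 1 - i) choose n)"

lemma unitriangular_foulkes_matrix: "unitriangular n (foulkes_matrix n)"
  by unfold_locales (auto simp: foulkes_matrix_def)

definition foulkes_combination :: "nat \<Rightarrow> (nat \<Rightarrow> real) \<Rightarrow> (nat \<Rightarrow> nat) \<Rightarrow> complex" where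
  "foulkes_combination n t = (\<lambda>\<pi>\<in>carrier (sym_group n). \<Sum>i<n. complex_of_real (t i) * foulkes_character n i \<pi>)"

lemma foulkes_combination_powers:
  assumes n: "n \<ge> 1" and t: "\<And>i. i < n \<Longrightarrow> t i = (\<Sum>k\<in>{1..n}. s k * of_int (foulkes_matrix n k i))"
    and \<pi>: "\<pi> \<in> carrier (sym_group n)"
  shows "foulkes_combination n t \<pi> = (\<Sum>k\<in>{1..n}. of_real (s k) * of_nat k ^ num_cycles n \<pi>)"
proof -
  have "foulkes_combination n t \<pi>
      = (\<Sum>i<n. \<Sum>k\<in>{1..n}. of_real (s k) * (of_nat ((k + n - 1 - i) choose n) * foulkes_character n i \<pi>))"
    using \<pi> t by (simp add: foulkes_combination_def foulkes_matrix_def sum_distrib_right mult.assoc)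
  also have "\<dots> = (\<Sum>k\<in>{1..n}. of_real (s k) * (\<Sum>i<n. of_nat ((k + n - 1 - i) choose n) * foulkes_character n i \<pi>))"
    by (subst sum.swap) (simp add: sum_distrib_left)
  finally show ?thesis by (simp only: power_num_cycles_eq_sum_foulkes[OF n \<pi>, symmetric])
qed

text \<open>If the combination is a character, integral sign multiplicities on all Young subgroups bound
  the denominators. Conversely, the condition makes it an integral combination of the characters
  \<open>gcd k n / k * k ^ \<ell>\<close>, and as the \<open>t i\<close> are nonnegative it has nonnegative inner products with
  irreducible characters.\<close>

lemma foulkes_combination_in_characters_iff:
  assumes n: "n \<ge> 1" and t: "\<And>i. i < n \<Longrightarrow> t i = (\<Sum>k\<in>{1..n}. s k * of_int (foulkes_matrix n k i))"
    and pos: "\<And>i. i < n \<Longrightarrow> t i \<ge> 0"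
  shows "foulkes_combination n t \<in> characters (sym_group n) \<longleftrightarrow> (\<forall>k\<in>{1..n}. s k * real (k div gcd k n) \<in> \<int>)"
proof
  assume "foulkes_combination n t \<in> characters (sym_group n)"
  from sign_multiplicity_integral[OF this foulkes_combination_powers[OF n t]]
  have "(\<Sum>x\<in>{1..n}. s x * real (\<Prod>b\<in>\<beta> ` {1..n}. x choose block_size n \<beta> b)) \<in> \<int>" for \<beta> .
  then show "\<forall>k\<in>{1..n}. s k * real (k div gcd k n) \<in> \<int>" using integral_binomial_sums by blast
next
  let ?G = "sym_group n"
  assume "\<forall>k\<in>{1..n}. s k * real (k div gcd k n) \<in> \<int>"
  then have "\<forall>k\<in>{1..n}. \<exists>z. s k * real (k div gcd k n) = of_int z" by (auto elim: Ints_cases)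
  then obtain z where z: "\<And>k. k \<in> {1..n} \<Longrightarrow> s k * real (k div gcd k n) = of_int (z k)" by metis
  define \<psi> where "\<psi> k = (\<lambda>\<pi>\<in>carrier ?G. of_nat (gcd k n) / of_nat k * of_nat k ^ num_cycles n \<pi> :: complex)" for k
  have eq: "(\<Sum>k\<in>{1..n}. of_int (z k) * \<psi> k \<pi>) = foulkes_combination n t \<pi>" if \<pi>: "\<pi> \<in> carrier ?G" for \<pi>
  proof -
    have "of_int (z k) * \<psi> k \<pi> = of_real (s k) * of_nat k ^ num_cycles n \<pi>" if k: "k \<in> {1..n}" for k
    proof -
      have g: "gcd k n dvd k" "gcd k n > 0" using k by auto
      have "real (k div gcd k n) = real k / real (gcd k n)" using g by (simp add: real_of_nat_div)
      then have "real_of_int (z k) * (real (gcd k n) / real k) = s k"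
        using z[OF k] g k by (simp add: field_simps flip: z[OF k])
      then have "complex_of_real (real_of_int (z k) * (real (gcd k n) / real k)) = of_real (s k)" by (rule arg_cong)
      then have "of_int (z k) * (of_nat (gcd k n) / of_nat k) = complex_of_real (s k)" by simp
      then show ?thesis using \<pi> by (simp only: \<psi>_def restrict_apply if_True mult.assoc[symmetric])
    qed
    then have "(\<Sum>k\<in>{1..n}. of_int (z k) * \<psi> k \<pi>) = (\<Sum>k\<in>{1..n}. of_real (s k) * of_nat k ^ num_cycles n \<pi>)"
      by (rule sum.cong[OF refl])
    also have "\<dots> = foulkes_combination n t \<pi>"
      by (rule foulkes_combination_powers[OF n _ \<pi>, symmetric]) (rule t)
    finally show ?thesis .
  qed
  have "(\<lambda>\<pi>\<in>carrier ?G. \<Sum>k\<in>{1..n}. of_int (z k) * \<psi> k \<pi>) \<in> characters ?G"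
  proof (rule integral_nonneg_combination_in_characters[OF sym_group_is_group finite_sym_group])
    show "\<psi> k \<in> characters ?G" if "k \<in> {1..n}" for k
      unfolding \<psi>_def using that by (intro scaled_power_num_cycles_character[OF n]) simp
    show "foulkes_character n i \<in> characters ?G" for i by (rule foulkes_character_in_characters[OF n])
    show "0 \<le> t i" if "i \<in> {..<n}" for i using pos that by simp
    show "(\<Sum>k\<in>{1..n}. of_int (z k) * \<psi> k \<pi>) = (\<Sum>i<n. of_real (t i) * foulkes_character n i \<pi>)"
      if "\<pi> \<in> carrier ?G" for \<pi>
      using eq[OF that] that by (simp add: foulkes_combination_def)
  qed simp_all
  also have "(\<lambda>\<pi>\<in>carrier ?G. \<Sum>k\<in>{1..n}. of_int (z k) * \<psi> k \<pi>) = foulkes_combination n t"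
    using eq by (auto simp: fun_eq_iff foulkes_combination_def)
  finally show "foulkes_combination n t \<in> characters ?G" .
qed

text \<open>If a combination vanishes, then so do all its real multiples. Being characters, they would
  have coefficients whose denominators are bounded, which is impossible for all multiples of a
  nonzero number.\<close>

lemma foulkes_combination_inj:
  assumes n: "n \<ge> 1" and eq: "foulkes_combination n t = foulkes_combination n t'" and i: "i < n"
  shows "t i = t' i"
proof -
  interpret unitriangular n "foulkes_matrix n" by (rule unitriangular_foulkes_matrix)
  obtain s where s: "\<forall>i<n. (\<Sum>k\<in>{1..n}. s k * of_int (foulkes_matrix n k i)) = t i - t' i"
    using solve[of "\<lambda>i. t i - t' i"] by blast
  have zero: "(\<Sum>k\<in>{1..n}. of_real (s k) * of_nat k ^ num_cycles n \<pi>) = (0 :: complex)" if \<pi>: "\<pi> \<in> carrier (sym_group n)" for \<pi>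
  proof -
    have "(\<Sum>k\<in>{1..n}. of_real (s k) * of_nat k ^ num_cycles n \<pi>) = foulkes_combination n (\<lambda>i. t i - t' i) \<pi>"
      by (rule foulkes_combination_powers[OF n _ \<pi>, symmetric]) (use s in simp)
    also have "\<dots> = foulkes_combination n t \<pi> - foulkes_combination n t' \<pi>"
      using \<pi> by (simp add: foulkes_combination_def left_diff_distrib sum_subtractf)
    finally show ?thesis using eq by simp
  qed
  have "s k = 0" if k: "k \<in> {1..n}" for k
  proof (rule ccontr)
    assume nz: "s k \<noteq> 0"
    let ?d = "real (k div gcd k n)"
    have d: "?d > 0" using k by (simp add: div_greater_zero_iff dvd_imp_le)
    \<comment> \<open>The multiple by \<open>c\<close> would make \<open>1 / 2\<close> an integer.\<close>
    define c where "c = 1 / (2 * s k * ?d)"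
    have "(\<Sum>x\<in>{1..n}. (c * s x) * real (\<Prod>b\<in>\<beta> ` {1..n}. x choose block_size n \<beta> b)) \<in> \<int>" for \<beta>
    proof (rule sign_multiplicity_integral[OF zero_in_characters])
      fix \<pi> assume \<pi>: "\<pi> \<in> carrier (sym_group n)"
      have "(\<Sum>x\<in>{1..n}. of_real (c * s x) * of_nat x ^ num_cycles n \<pi>)
          = of_real c * (\<Sum>x\<in>{1..n}. of_real (s x) * of_nat x ^ num_cycles n \<pi> :: complex)"
        by (simp add: sum_distrib_left mult.assoc)
      then show "(\<lambda>g\<in>carrier (sym_group n). 0) \<pi> = (\<Sum>x\<in>{1..n}. of_real (c * s x) * of_nat x ^ num_cycles n \<pi> :: complex)"
        using zero[OF \<pi>] \<pi> by simp
    qed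
    then have "(c * s k) * ?d \<in> \<int>" by (rule integral_binomial_sums[OF _ k])
    moreover have "(c * s k) * ?d = 1 / 2" using nz d by (simp add: c_def)
    ultimately have "(1 / 2 :: real) \<in> \<int>" by simp
    then obtain z where z: "(1 / 2 :: real) = of_int z" by (auto elim: Ints_cases)
    then have "real_of_int (2 * z) = 1" by simp
    then have "2 * z = 1" by (metis of_int_eq_1_iff)
    then show False by presburger
  qed
  then have "(\<Sum>k\<in>{1..n}. s k * of_int (foulkes_matrix n k i)) = 0" by simp
  then show ?thesis using s i by auto
qed

theorem theorem1p3:
  fixes n :: nat
  assumes "n \<ge> 1"
  shows "real (card {\<theta> \<in> characters (sym_group n).
            depends_only_on_num_cycles n \<theta> \<and> \<theta> \<in> foulkes_parallelepiped n})
         = fact n / real (\<Prod>k=1..n. gcd k n)"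
proof -
  interpret unitriangular n "foulkes_matrix n" by (rule unitriangular_foulkes_matrix)
  let ?d = "\<lambda>k. k div gcd k n"
  let ?\<Theta> = "{\<theta> \<in> characters (sym_group n). depends_only_on_num_cycles n \<theta> \<and> \<theta> \<in> foulkes_parallelepiped n}"
  let ?X = "{t \<in> {..<n} \<rightarrow>\<^sub>E {0..<1::real}. \<exists>s. (\<forall>i<n. t i = (\<Sum>k\<in>{1..n}. s k * of_int (foulkes_matrix n k i)))
      \<and> (\<forall>k\<in>{1..n}. s k * real (?d k) \<in> \<int>)}"
  have depends: "depends_only_on_num_cycles n (foulkes_combination n t)" for t
  proof -
    obtain s where "\<forall>i<n. (\<Sum>k\<in>{1..n}. s k * of_int (foulkes_matrix n k i)) = t i" using solve by blast
    then have "t i = (\<Sum>k\<in>{1..n}. s k * of_int (foulkes_matrix n k i))" if "i < n" for i using that by simp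
    from foulkes_combination_powers[OF assms this] show ?thesis
      unfolding depends_only_on_num_cycles_def by simp
  qed
  have char: "foulkes_combination n t \<in> characters (sym_group n) \<longleftrightarrow> t \<in> ?X" if t: "t \<in> {..<n} \<rightarrow>\<^sub>E {0..<1}" for t
  proof -
    have pos: "t i \<ge> 0" if "i < n" for i using t that by (auto simp: PiE_iff)
    have iff: "foulkes_combination n t \<in> characters (sym_group n) \<longleftrightarrow> (\<forall>k\<in>{1..n}. s k * real (?d k) \<in> \<int>)"
      if s: "\<forall>i<n. t i = (\<Sum>k\<in>{1..n}. s k * of_int (foulkes_matrix n k i))" for s
      by (rule foulkes_combination_in_characters_iff[OF assms _ pos]) (use s in auto)
    obtain s where "\<forall>i<n. (\<Sum>k\<in>{1..n}. s k * of_int (foulkes_matrix n k i)) = t i" using solve by blast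
    then have "\<forall>i<n. t i = (\<Sum>k\<in>{1..n}. s k * of_int (foulkes_matrix n k i))" by simp
    then show ?thesis using iff t by blast
  qed
  have parallelepiped: "foulkes_parallelepiped n = foulkes_combination n ` ({..<n} \<rightarrow>\<^sub>E {0..<1})"
  proof (intro equalityI subsetI)
    fix \<theta> assume "\<theta> \<in> foulkes_parallelepiped n"
    then obtain t where t: "\<theta> = foulkes_combination n t" "\<forall>i<n. t i \<in> {0..<1}"
      unfolding foulkes_parallelepiped_def foulkes_combination_def by blast
    have "foulkes_combination n t = foulkes_combination n (restrict t {..<n})"
      by (simp add: foulkes_combination_def cong: restrict_cong)
    moreover have "restrict t {..<n} \<in> {..<n} \<rightarrow>\<^sub>E {0..<1}" using t(2) by auto
    ultimately show "\<theta> \<in> foulkes_combination n ` ({..<n} \<rightarrow>\<^sub>E {0..<1})" using t(1) by blast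
  next
    fix \<theta> assume "\<theta> \<in> foulkes_combination n ` ({..<n} \<rightarrow>\<^sub>E {0..<1})"
    then obtain t where "\<theta> = foulkes_combination n t" "\<forall>i<n. t i \<in> {0..<1}" by (auto simp: PiE_iff)
    then show "\<theta> \<in> foulkes_parallelepiped n"
      unfolding foulkes_parallelepiped_def foulkes_combination_def by blast
  qed
  have "?\<Theta> = foulkes_combination n ` ?X"
  proof (intro equalityI subsetI)
    fix \<theta> assume \<theta>: "\<theta> \<in> ?\<Theta>"
    then obtain t where t: "\<theta> = foulkes_combination n t" "t \<in> {..<n} \<rightarrow>\<^sub>E {0..<1}"
      unfolding parallelepiped by blast
    have "foulkes_combination n t \<in> characters (sym_group n)" using \<theta> unfolding t(1) by simp
    then have "t \<in> ?X" using char[OF t(2)] by (rule iffD1[rotated])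
    then show "\<theta> \<in> foulkes_combination n ` ?X" unfolding t(1) by (rule imageI)
  next
    fix \<theta> assume "\<theta> \<in> foulkes_combination n ` ?X"
    then obtain t where t: "\<theta> = foulkes_combination n t" "t \<in> ?X" by (rule imageE)
    have box: "t \<in> {..<n} \<rightarrow>\<^sub>E {0..<1}" using t(2) by simp
    have "\<theta> \<in> characters (sym_group n)" unfolding t(1) using char[OF box] t(2) by (rule iffD2)
    moreover have "\<theta> \<in> foulkes_parallelepiped n" unfolding t(1) parallelepiped using box by (rule imageI)
    ultimately show "\<theta> \<in> ?\<Theta>" using depends[of t] unfolding t(1) by simp
  qed
  moreover have "inj_on (foulkes_combination n) ?X"
  proof (rule inj_onI)
    fix t t' assume t: "t \<in> ?X" and t': "t' \<in> ?X" and eq: "foulkes_combination n t = foulkes_combination n t'"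
    have tt': "t \<in> {..<n} \<rightarrow>\<^sub>E {0..<1}" "t' \<in> {..<n} \<rightarrow>\<^sub>E {0..<1}" using t t' by blast+
    show "t = t'"
      by (rule PiE_ext[OF tt']) (use foulkes_combination_inj[OF assms eq] in simp)
  qed
  ultimately have "card ?\<Theta> = card ?X" by (simp only: card_image)
  also have "\<dots> = (\<Prod>k\<in>{1..n}. ?d k)"
    by (rule card_cube_points) (simp add: div_greater_zero_iff dvd_imp_le)
  finally have "real (card ?\<Theta>) = (\<Prod>k\<in>{1..n}. real (?d k))" by simp
  also have "\<dots> = (\<Prod>k\<in>{1..n}. real k / real (gcd k n))"
    by (intro prod.cong refl) (simp add: real_of_nat_div)
  also have "\<dots> = fact n / real (\<Prod>k=1..n. gcd k n)"
    by (simp add: prod_dividef fact_prod)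
  finally show ?thesis .
qed

end
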